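(* Let $(k,\ell)\in PC$, and for $i=1,2$ let $u_{0,i}\in H$, $f_i\in L^2(0,T;H)$, and let $(u_i,\xi_i)\in L^2(0,T;H)\times L^2(0,T;H)$ be a strong solution pair on $[0,T]$ of $$\partial_t[k*(u_i-u_{0,i})](t)+\partial\varphi^t(u_i(t))\ni f_i(t)\quad\text{in }H,\ t\in(0,T),$$ for the data $(u_{0,i},f_i)$. Then there exists a constant $c_T\in[0,\infty)$, independent of $u_{0,1},u_{0,2},f_1,f_2$, such that $$\|u_1-u_2\|_{L^2(0,T;H)}^2\le c_T\left(\|u_{0,1}-u_{0,2}\|_H^2+\|f_1-f_2\|_{L^2(0,T;H)}^2\right).$$ In particular, if $u_{0,1}=u_{0,2}$ and $f_1=f_2$, then $u_1=u_2$.
   Context: $T\in(0,\infty)$ is fixed and $H$ is a real Hilbert space with inner product $(\cdot,\cdot)_H$ and norm $\|\cdot\|_H$. For each $t\in[0,T]$, $\varphi^t:H\to(-\infty,\infty]$ is a proper (i.e. $\varphi^t\not\equiv\infty$) lower-semicontinuous convex functional, with effective domain $D(\varphi^t)=\{w\in H:\varphi^t(w)<\infty\}$ and subdifferential $\partial\varphi^t(z)=\{\xi\in H:\varphi^t(v)-\varphi^t(z)\ge(\xi,v-z)_H\ \text{for all }v\in D(\varphi^t)\}$ for $z \in H$; $D(\partial\varphi^t)=\{w\in D(\varphi^t):\partial\varphi^t(w)\ne\emptyset\}$. Convolution: $(k*w)(t)=\int_0^t k(t-s)w(s)\,ds$ for $t \in (0,T)$. $(k,\ell)\in PC$ means: $k,\ell\in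 L^1_{\mathrm{loc}}([0,\infty))$ are both nonnegative and nonincreasing, and $(k*\ell)(t)=\int_0^tk(t-s)\ell(s)\,ds=1$ for all $t\in(0,\infty)$. Strong solution pair: given $u_0\in H$ and $f\in L^2(0,T;H)$, a pair $(u,\xi)$ with $u,\xi\in L^2(0,T;H)$ is a strong solution pair on $[0,T]$ for $(u_0,f)$ if (i) $k*(u-u_0)\in W^{1,2}(0,T;H)$, $[k*(u-u_0)](0)=0$, and $u(t)\in D(\partial\varphi^t)$ for a.e. $t\in(0,T)$; (ii) $\xi(t)\in\partial\varphi^t(u(t))$ and $\partial_t[k*(u-u_0)](t)+\xi(t)=f(t)$ for a.e. $t\in(0,T)$. *)

theory Defs
  imports "HOL-Analysis.Analysis"
begin

text \<open>
  The library's \<^const>\<open>has_bochner_integral\<close> is restricted to second-countable (hence separable)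
  target spaces. As the Hilbert space here need not be separable, the Bochner integral is set up
  again, following the library but with strong measurability (almost everywhere limit of simple
  functions) instead of Borel measurability.
\<close>

definition strongly_measurable :: "'m measure \<Rightarrow> ('m \<Rightarrow> 'a::real_normed_vector) \<Rightarrow> bool" where
  "strongly_measurable M f \<longleftrightarrow>
     (\<exists>s. (\<forall>n::nat. simple_function M (s n)) \<and> (AE x in M. (\<lambda>n. s n x) \<longlonglongrightarrow> f x))"

definition has_bochner_int :: "'m measure \<Rightarrow> ('m \<Rightarrow> 'a::real_normed_vector) \<Rightarrow> 'a \<Rightarrow> bool" where
  "has_bochner_int M f y \<longleftrightarrow> strongly_measurable M f \<and>
     (\<exists>s. (\<forall>n::nat. Bochner_Integration.simple_bochner_integrable M (s n)) \<and>
          (\<lambda>n. \<integral>\<^sup>+ x. ennreal (norm (f x - s n x)) \<partial>M) \<longlonglongrightarrow> 0 \<and>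
          (\<lambda>n. Bochner_Integration.simple_bochner_integral M (s n)) \<longlonglongrightarrow> y)"

definition bochner_int :: "'m measure \<Rightarrow> ('m \<Rightarrow> 'a::real_normed_vector) \<Rightarrow> 'a" where
  "bochner_int M f =
     (if \<exists>y. has_bochner_int M f y then THE y. has_bochner_int M f y else 0)"

text \<open>For second-countable targets this is the library's integral.\<close>

lemma strongly_measurable_iff_borel:
  fixes f :: "real \<Rightarrow> 'a::{real_normed_vector, second_countable_topology}"
  assumes "S \<in> sets lebesgue"
  shows "strongly_measurable (lebesgue_on S) f \<longleftrightarrow> f \<in> borel_measurable (lebesgue_on S)"
proof
  assume "strongly_measurable (lebesgue_on S) f"
  then obtain s where s: "\<And>n::nat. simple_function (lebesgue_on S) (s n)"
    and lim: "AE x in lebesgue_on S. (\<lambda>n. s n x) \<longlonglongrightarrow> f x"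
    unfolding strongly_measurable_def by blast
  have "AE x in lebesgue. x \<in> S \<longrightarrow> (\<lambda>n. s n x) \<longlonglongrightarrow> f x"
    using lim assms by (simp add: AE_restrict_space_iff)
  then obtain N where N: "N \<in> null_sets lebesgue" "\<And>x. x \<in> S - N \<Longrightarrow> (\<lambda>n. s n x) \<longlonglongrightarrow> f x"
    unfolding eventually_ae_filter by auto
  let ?M = "lebesgue_on S"
  let ?g = "\<lambda>x. if x \<in> N then 0 else f x"
  have NM: "N \<inter> S \<in> sets ?M" using N(1) assms by (auto simp: sets_restrict_space)
  have g: "?g \<in> borel_measurable ?M"
  proof (rule borel_measurable_LIMSEQ_metric)
    fix n
    have "s n \<in> borel_measurable ?M" by (rule borel_measurable_simple_function[OF s])
    moreover have "{x \<in> space ?M. x \<in> N} \<in> sets ?M"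
      using NM by (simp add: Int_def conj_commute)
    ultimately show "(\<lambda>x. if x \<in> N then 0 else s n x) \<in> borel_measurable ?M"
      by (intro measurable_If) auto
  next
    fix x assume "x \<in> space ?M"
    then show "(\<lambda>n. if x \<in> N then 0 else s n x) \<longlonglongrightarrow> ?g x"
      using N(2)[of x] by auto
  qed
  show "f \<in> borel_measurable ?M"
  proof (rule measurableI)
    fix A :: "'a set" assume A: "A \<in> sets borel"
    let ?B = "f -` A \<inter> space ?M" and ?C = "?g -` A \<inter> space ?M"
    have 1: "?C - N \<in> sets ?M"
      using measurable_sets[OF g A] NM
      by (metis (no_types, lifting) Diff_Int2 sets.Diff space_lebesgue_on)
    have "?B \<inter> N \<in> null_sets lebesgue"
      using N(1) by (meson Int_lower2 completion.complete2 null_sets_completion_subset)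
    then have 2: "?B \<inter> N \<in> sets ?M"
      using assms by (auto simp: sets_restrict_space_iff)
    have "?B = (?C - N) \<union> (?B \<inter> N)" by auto
    also have "\<dots> \<in> sets ?M" using 1 2 by (rule sets.Un)
    finally show "?B \<in> sets ?M" .
  qed simp
next
  assume f: "f \<in> borel_measurable (lebesgue_on S)"
  from borel_measurable_implies_sequence_metric[OF f, of 0]
  show "strongly_measurable (lebesgue_on S) f"
    unfolding strongly_measurable_def by (blast intro: AE_I2)
qed

lemma has_bochner_int_iff:
  fixes f :: "real \<Rightarrow> 'a::{real_normed_vector, second_countable_topology}"
  assumes "S \<in> sets lebesgue"
  shows "has_bochner_int (lebesgue_on S) f y \<longleftrightarrow> has_bochner_integral (lebesgue_on S) f y"
  unfolding has_bochner_int_def has_bochner_integral.simps strongly_measurable_iff_borel[OF assms]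
  by blast

lemma bochner_int_eq_lebesgue_integral:
  fixes f :: "real \<Rightarrow> 'a::{real_normed_vector, second_countable_topology}"
  assumes "S \<in> sets lebesgue"
  shows "bochner_int (lebesgue_on S) f = integral\<^sup>L (lebesgue_on S) f"
  unfolding bochner_int_def lebesgue_integral_def has_bochner_int_iff[OF assms] ..

text \<open>
  Elements of \<open>L\<^sup>2(0,T;H)\<close> are represented by functions on the real line; only the values almost
  everywhere in \<open>(0,T)\<close> matter.
\<close>

abbreviation time_measure :: "real \<Rightarrow> real measure" where
  "time_measure T \<equiv> lebesgue_on {0<..<T}"

definition L2 :: "real \<Rightarrow> (real \<Rightarrow> 'a::real_normed_vector) \<Rightarrow> bool" where
  "L2 T f \<longleftrightarrow> strongly_measurable (time_measure T) f \<and>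
     integrable (time_measure T) (\<lambda>t. (norm (f t))\<^sup>2)"

definition L2_time_norm :: "real \<Rightarrow> (real \<Rightarrow> 'a::real_normed_vector) \<Rightarrow> real" where
  "L2_time_norm T f = sqrt (\<integral>t. (norm (f t))\<^sup>2 \<partial>time_measure T)"

definition test_function :: "real \<Rightarrow> (real \<Rightarrow> real) \<Rightarrow> bool" where
  "test_function T \<eta> \<longleftrightarrow>
     (\<forall>n t. (deriv ^^ n) \<eta> differentiable (at t)) \<and>
     (\<exists>a b. 0 < a \<and> b < T \<and> (\<forall>t. t \<notin> {a..b} \<longrightarrow> \<eta> t = 0))"

definition has_weak_derivative ::
    "real \<Rightarrow> (real \<Rightarrow> 'a::real_normed_vector) \<Rightarrow> (real \<Rightarrow> 'a) \<Rightarrow> bool" where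
  "has_weak_derivative T v v' \<longleftrightarrow>
     (\<forall>\<eta>. test_function T \<eta> \<longrightarrow>
        bochner_int (time_measure T) (\<lambda>t. deriv \<eta> t *\<^sub>R v t) =
        - bochner_int (time_measure T) (\<lambda>t. \<eta> t *\<^sub>R v' t))"

text \<open>
  \<open>W12_derivative T v v'\<close>: \<open>v\<close> is in \<open>W\<^sup>1\<^sup>,\<^sup>2(0,T;H)\<close> and \<open>v'\<close> represents \<open>\<partial>\<^sub>t v\<close>, which is unique
  up to null sets.
\<close>

definition W12_derivative ::
    "real \<Rightarrow> (real \<Rightarrow> 'a::real_normed_vector) \<Rightarrow> (real \<Rightarrow> 'a) \<Rightarrow> bool" where
  "W12_derivative T v v' \<longleftrightarrow> L2 T v \<and> L2 T v' \<and> has_weak_derivative T v v'"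

text \<open>The value at time \<open>0\<close> of a Sobolev function is that of its continuous representative.\<close>

definition has_initial_value ::
    "real \<Rightarrow> (real \<Rightarrow> 'a::real_normed_vector) \<Rightarrow> 'a \<Rightarrow> bool" where
  "has_initial_value T v y \<longleftrightarrow>
     (\<exists>V. continuous_on {0..T} V \<and> (AE t in time_measure T. V t = v t) \<and> V 0 = y)"

definition convolution ::
    "(real \<Rightarrow> real) \<Rightarrow> (real \<Rightarrow> 'a::real_normed_vector) \<Rightarrow> real \<Rightarrow> 'a" where
  "convolution k w t = bochner_int (lebesgue_on {0<..<t}) (\<lambda>s. k (t - s) *\<^sub>R w s)"

text \<open>
  The kernels may be unbounded at \<open>0\<close> (for instance \<open>t\<close> to a negative power), so sign and
  monotonicity are required on \<open>(0,\<infinity>)\<close> only and the value at \<open>0\<close> is irrelevant.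
\<close>

definition L1_loc :: "(real \<Rightarrow> real) \<Rightarrow> bool" where
  "L1_loc k \<longleftrightarrow> (\<forall>R>0. set_integrable lebesgue {0..R} k)"

definition PC :: "(real \<Rightarrow> real) \<Rightarrow> (real \<Rightarrow> real) \<Rightarrow> bool" where
  "PC k l \<longleftrightarrow>
     L1_loc k \<and> L1_loc l \<and>
     (\<forall>t>0. 0 \<le> k t) \<and> (\<forall>t>0. 0 \<le> l t) \<and>
     antimono_on {0<..} k \<and> antimono_on {0<..} l \<and>
     (\<forall>t>0. convolution k l t = 1)"

definition proper_functional :: "('a \<Rightarrow> ereal) \<Rightarrow> bool" where
  "proper_functional \<phi> \<longleftrightarrow> (\<forall>w. \<phi> w \<noteq> -\<infinity>) \<and> (\<exists>w. \<phi> w \<noteq> \<infinity>)"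

definition lsc_functional :: "('a::topological_space \<Rightarrow> ereal) \<Rightarrow> bool" where
  "lsc_functional \<phi> \<longleftrightarrow> (\<forall>w. \<phi> w \<le> Liminf (at w) \<phi>)"

definition convex_functional :: "('a::real_vector \<Rightarrow> ereal) \<Rightarrow> bool" where
  "convex_functional \<phi> \<longleftrightarrow>
     (\<forall>v w r. 0 \<le> r \<and> r \<le> 1 \<longrightarrow>
        \<phi> ((1 - r) *\<^sub>R v + r *\<^sub>R w) \<le> ereal (1 - r) * \<phi> v + ereal r * \<phi> w)"

definition eff_domain :: "('a \<Rightarrow> ereal) \<Rightarrow> 'a set" where
  "eff_domain \<phi> = {w. \<phi> w < \<infinity>}"

definition subdifferential :: "('a::real_inner \<Rightarrow> ereal) \<Rightarrow> 'a \<Rightarrow> 'a set" where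
  "subdifferential \<phi> z = {\<xi>. \<forall>v\<in>eff_domain \<phi>. \<phi> v - \<phi> z \<ge> ereal (\<xi> \<bullet> (v - z))}"

definition subdiff_domain :: "('a::real_inner \<Rightarrow> ereal) \<Rightarrow> 'a set" where
  "subdiff_domain \<phi> = {w \<in> eff_domain \<phi>. subdifferential \<phi> w \<noteq> {}}"

definition strong_solution_pair ::
    "real \<Rightarrow> (real \<Rightarrow> real) \<Rightarrow> (real \<Rightarrow> 'a::real_inner \<Rightarrow> ereal) \<Rightarrow> 'a \<Rightarrow> (real \<Rightarrow> 'a) \<Rightarrow>
     (real \<Rightarrow> 'a) \<Rightarrow> (real \<Rightarrow> 'a) \<Rightarrow> bool" where
  "strong_solution_pair T k \<phi> u0 f u \<xi> \<longleftrightarrow>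
     L2 T u \<and> L2 T \<xi> \<and>
     has_initial_value T (convolution k (\<lambda>s. u s - u0)) 0 \<and>
     (AE t in time_measure T. u t \<in> subdiff_domain (\<phi> t)) \<and>
     (AE t in time_measure T. \<xi> t \<in> subdifferential (\<phi> t) (u t)) \<and>
     (\<exists>v'. W12_derivative T (convolution k (\<lambda>s. u s - u0)) v' \<and>
           (AE t in time_measure T. v' t + \<xi> t = f t))"

end

theory Submission
  imports Defs
begin

text \<open>
  Let \<open>w = u\<^sub>1 - u\<^sub>2\<close>, \<open>w\<^sub>0 = u\<^sub>0\<^sub>1 - u\<^sub>0\<^sub>2\<close>, \<open>f = f\<^sub>1 - f\<^sub>2\<close>, let \<open>g\<close> be the weak derivative of
  \<open>k * (w - w\<^sub>0)\<close>, and let \<open>L t\<close> be the integral of \<open>l\<close> over \<open>(0,t)\<close>. Subdifferentials are monotone,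
  so \<open>(g, w) \<le> (f, w)\<close> almost everywhere. The theorem therefore follows from the energy inequality
  \<open>1/2 \<integral> \<parallel>w\<parallel>\<^sup>2 - T/2 \<parallel>w\<^sub>0\<parallel>\<^sup>2 \<le> \<integral> L (T - t) (g, w) dt\<close> on \<open>(0,T)\<close>, the integrated form of
  \<open>1/2 (\<parallel>w\<parallel>\<^sup>2 - \<parallel>w\<^sub>0\<parallel>\<^sup>2) \<le> l * (g, w)\<close>: the weight \<open>L (T - t)\<close> lies between \<open>0\<close> and \<open>L T\<close>, so that
  the right-hand side is at most \<open>(L T)\<^sup>2 \<integral> \<parallel>f\<parallel>\<^sup>2 + 1/4 \<integral> \<parallel>w\<parallel>\<^sup>2\<close> and the last term is absorbed on the
  left. This gives the constant \<open>2 T + 4 (L T)\<^sup>2\<close>.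

  The energy inequality is proved for the real functions \<open>(w, e)\<close> and \<open>(g, e)\<close> and summed over
  orthogonal bases of an increasing sequence of finite-dimensional subspaces that exhausts the
  essential range of \<open>w\<close> (\<open>energy_inequality_vector\<close>). All Bochner integrals disappear when the inner
  product with \<open>e\<close> is taken (\<open>bochner_int_inner\<close>); in particular the definition of the weak derivative
  becomes the identity \<open>k * (w - w\<^sub>0) = 1 * g\<close> of real functions (\<open>primitive_of_weak_derivative\<close>,
  \<open>solution_scalar_equation\<close>).

  In the scalar case put \<open>z = w - w\<^sub>0\<close>. Convolving \<open>k * z = 1 * g\<close> with \<open>l\<close> gives \<open>z = l * g\<close>, and the
  terms linear in \<open>w\<^sub>0\<close> on the two sides cancel because \<open>\<integral> z = \<integral> L (T - t) g dt\<close>. What remains is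
  \<open>1/2 \<integral> z\<^sup>2 \<le> \<integral> L (T - t) g z dt\<close> for \<open>z = l * g\<close>. By truncation \<open>g\<close> may be taken bounded, say by
  \<open>G\<close>. Then the increment of \<open>1 * g = k * z\<close> over \<open>(t - h, t)\<close> is the integral of
  \<open>(k x - k (x - h)) z (t - x)\<close>, whose kernel is nonnegative on \<open>(0,h)\<close> and nonpositive beyond. In
  \<open>z (t - x) z t = 1/2 z (t - x)\<^sup>2 + 1/2 (z t)\<^sup>2 - 1/2 (z t - z (t - x))\<^sup>2\<close> the last square helps for \<open>x > h\<close>,
  and for \<open>x < h\<close> it is controlled by the modulus of continuity \<open>2 G L x\<close> of \<open>l * g\<close> together
  with \<open>k x L x \<le> (k * l) x = 1\<close>. The term \<open>1/2 k * z\<^sup>2\<close> that is left turns into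
  \<open>1/2 (1 * 1 * z\<^sup>2)\<close> after integration against \<open>L (T - t)\<close>, since \<open>L * k = 1 * 1\<close>. Division by \<open>h\<close>
  and \<open>h \<rightarrow> 0\<close> give the claim, with all errors of order \<open>h + L h\<close>.
\<close>

section \<open>Strong measurability and the Bochner integral\<close>

text \<open>
  Sums, products and norms of strongly measurable functions are all obtained from one continuous
  function of two arguments, applied to the approximating simple functions.
\<close>

lemma strongly_measurable_compose2:
  fixes f :: "'m \<Rightarrow> 'a::real_normed_vector" and g :: "'m \<Rightarrow> 'b::real_normed_vector"
    and h :: "'a \<times> 'b \<Rightarrow> 'c::real_normed_vector"
  assumes f: "strongly_measurable M f" and g: "strongly_measurable M g"
    and h: "continuous_on UNIV h"
  shows "strongly_measurable M (\<lambda>x. h (f x, g x))"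
proof -
  from f g obtain s r where sr: "\<And>n::nat. simple_function M (s n)" "\<And>n::nat. simple_function M (r n)"
    and lim: "AE x in M. (\<lambda>n. s n x) \<longlonglongrightarrow> f x" "AE x in M. (\<lambda>n. r n x) \<longlonglongrightarrow> g x"
    unfolding strongly_measurable_def by blast
  have "simple_function M (\<lambda>x. h (s n x, r n x))" for n
    using simple_function_compose2[OF sr, where h="\<lambda>a b. h (a, b)"] by (simp add: comp_def)
  moreover have "AE x in M. (\<lambda>n. h (s n x, r n x)) \<longlonglongrightarrow> h (f x, g x)"
    using lim
  proof eventually_elim
    case (elim x)
    then show ?case
      using continuous_on_tendsto_compose[OF h tendsto_Pair, of "\<lambda>n. s n x" "f x" sequentially "\<lambda>n. r n x" "g x"] by simp
  qed
  ultimately show ?thesis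
    unfolding strongly_measurable_def by (intro exI[of _ "\<lambda>n x. h (s n x, r n x)"]) auto
qed

lemma strongly_measurable_const: "strongly_measurable M (\<lambda>x. c)"
  unfolding strongly_measurable_def by (intro exI[of _ "\<lambda>n x. c"]) auto

lemma strongly_measurable_diff:
  "strongly_measurable M f \<Longrightarrow> strongly_measurable M g \<Longrightarrow> strongly_measurable M (\<lambda>x. f x - g x)"
  using strongly_measurable_compose2[of M f g "\<lambda>p. fst p - snd p"] by (simp add: continuous_intros)

lemma strongly_measurable_scaleR:
  "strongly_measurable M f \<Longrightarrow> strongly_measurable M g \<Longrightarrow> strongly_measurable M (\<lambda>x. f x *\<^sub>R g x)"
  using strongly_measurable_compose2[of M f g "\<lambda>p. fst p *\<^sub>R snd p"] by (simp add: continuous_intros)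

lemma strongly_measurable_inner:
  fixes f g :: "'m \<Rightarrow> 'a::real_inner"
  shows "strongly_measurable M f \<Longrightarrow> strongly_measurable M g \<Longrightarrow> strongly_measurable M (\<lambda>x. f x \<bullet> g x)"
  using strongly_measurable_compose2[of M f g "\<lambda>p. fst p \<bullet> snd p"] by (simp add: continuous_intros)

lemma strongly_measurable_norm:
  "strongly_measurable M f \<Longrightarrow> strongly_measurable M (\<lambda>x. norm (f x))"
  using strongly_measurable_compose2[of M f f "\<lambda>p. norm (fst p)"] by (simp add: continuous_intros)

lemma strongly_measurable_restrict:
  assumes f: "strongly_measurable (lebesgue_on S) f"
    and S: "S \<in> sets lebesgue" "R \<in> sets lebesgue" "R \<subseteq> S"
  shows "strongly_measurable (lebesgue_on R) f"
proof -
  obtain s where s: "\<And>n::nat. simple_function (lebesgue_on S) (s n)"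
    and lim: "AE x in lebesgue_on S. (\<lambda>n. s n x) \<longlonglongrightarrow> f x"
    using f unfolding strongly_measurable_def by auto
  have "simple_function (lebesgue_on R) (s n)" for n
  proof -
    have "finite (s n ` R)"
      using s[of n] S by (auto simp: simple_function_def intro: finite_subset[of _ "s n ` S"])
    moreover have "s n -` {y} \<inter> R \<in> sets (lebesgue_on R)" for y
    proof -
      have "s n -` {y} \<inter> S \<in> sets (lebesgue_on S)"
      proof (cases "y \<in> s n ` S")
        case True then show ?thesis using s[of n] by (auto simp: simple_function_def)
      next
        case False
        then have "s n -` {y} \<inter> S = {}" by auto
        then show ?thesis by (metis sets.empty_sets)
      qed
      then have "s n -` {y} \<inter> S \<in> sets lebesgue"
        using S by (simp add: sets_restrict_space_iff)
      then have "(s n -` {y} \<inter> S) \<inter> R \<in> sets lebesgue" using S by blast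
      moreover have "(s n -` {y} \<inter> S) \<inter> R = s n -` {y} \<inter> R" using S by auto
      ultimately show ?thesis using S by (simp add: sets_restrict_space_iff)
    qed
    ultimately show ?thesis by (simp add: simple_function_def)
  qed
  moreover have "AE x in lebesgue_on R. (\<lambda>n. s n x) \<longlonglongrightarrow> f x"
    using lim S by (auto simp: AE_restrict_space_iff elim: eventually_mono)
  ultimately show ?thesis
    unfolding strongly_measurable_def by (intro exI[of _ s]) auto
qed

text \<open>
  The integral of a vector-valued function is accessible only through the real integrals
  \<open>\<integral> (f, e)\<close>, to which the whole theory of the Bochner integral with separable values applies.
  Uniqueness of the vector-valued integral is a first consequence.
\<close>

lemma has_bochner_int_inner:
  fixes f :: "real \<Rightarrow> 'a::real_inner"
  assumes S: "S \<in> sets lebesgue" and f: "has_bochner_int (lebesgue_on S) f y"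
  shows "has_bochner_integral (lebesgue_on S) (\<lambda>x. f x \<bullet> e) (y \<bullet> e)"
proof -
  let ?M = "lebesgue_on S"
  from f obtain s where fm: "strongly_measurable ?M f"
    and s: "\<And>n::nat. Bochner_Integration.simple_bochner_integrable ?M (s n)"
    and lim: "(\<lambda>n. \<integral>\<^sup>+ x. ennreal (norm (f x - s n x)) \<partial>?M) \<longlonglongrightarrow> 0"
    and y: "(\<lambda>n. Bochner_Integration.simple_bochner_integral ?M (s n)) \<longlonglongrightarrow> y"
    unfolding has_bochner_int_def by blast
  have ssm: "strongly_measurable ?M (s n)" for n
    using s[of n] unfolding strongly_measurable_def simple_bochner_integrable.simps
    by (intro exI[of _ "\<lambda>_. s n"]) auto
  show ?thesis
  proof (rule has_bochner_integral.intros)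
    show "(\<lambda>x. f x \<bullet> e) \<in> borel_measurable ?M"
      using strongly_measurable_inner[OF fm strongly_measurable_const]
      by (simp add: strongly_measurable_iff_borel[OF S])
    show "Bochner_Integration.simple_bochner_integrable ?M (\<lambda>x. s i x \<bullet> e)" for i
      using simple_bochner_integrable_compose2[of "\<lambda>a b. a \<bullet> e", OF _ s s] by simp
    show "(\<lambda>i. Bochner_Integration.simple_bochner_integral ?M (\<lambda>x. s i x \<bullet> e)) \<longlonglongrightarrow> y \<bullet> e"
      by (subst simple_bochner_integral_linear[OF _ s])
        (auto intro!: tendsto_inner y bounded_linear.linear[OF bounded_linear_inner_left])
    show "(\<lambda>i. \<integral>\<^sup>+ x. ennreal (norm (f x \<bullet> e - s i x \<bullet> e)) \<partial>?M) \<longlonglongrightarrow> 0"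
    proof (rule tendsto_sandwich[where f="\<lambda>_. 0"])
      have "(\<integral>\<^sup>+ x. ennreal (norm (f x \<bullet> e - s i x \<bullet> e)) \<partial>?M)
          \<le> ennreal (norm e) * (\<integral>\<^sup>+ x. ennreal (norm (f x - s i x)) \<partial>?M)" for i
      proof -
        have "(\<lambda>x. norm (f x - s i x)) \<in> borel_measurable ?M"
          using strongly_measurable_norm[OF strongly_measurable_diff[OF fm ssm]]
          by (simp add: strongly_measurable_iff_borel[OF S])
        then have "ennreal (norm e) * (\<integral>\<^sup>+ x. ennreal (norm (f x - s i x)) \<partial>?M)
            = (\<integral>\<^sup>+ x. ennreal (norm e) * ennreal (norm (f x - s i x)) \<partial>?M)"
          by (subst nn_integral_cmult) auto
        moreover have "\<dots> \<ge> (\<integral>\<^sup>+ x. ennreal (norm (f x \<bullet> e - s i x \<bullet> e)) \<partial>?M)"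
          by (intro nn_integral_mono)
            (simp flip: ennreal_mult inner_diff_left add: mult.commute[of "norm e"] Cauchy_Schwarz_ineq2 ennreal_leI)
        ultimately show ?thesis by simp
      qed
      then show "\<forall>\<^sub>F i in sequentially. (\<integral>\<^sup>+ x. ennreal (norm (f x \<bullet> e - s i x \<bullet> e)) \<partial>?M)
          \<le> ennreal (norm e) * (\<integral>\<^sup>+ x. ennreal (norm (f x - s i x)) \<partial>?M)"
        by auto
      show "(\<lambda>i. ennreal (norm e) * (\<integral>\<^sup>+ x. ennreal (norm (f x - s i x)) \<partial>?M)) \<longlonglongrightarrow> 0"
        using ennreal_tendsto_cmult[OF _ lim, of "ennreal (norm e)"] by simp
    qed auto
  qed
qed

lemma has_bochner_int_unique:
  fixes f :: "real \<Rightarrow> 'a::real_inner"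
  assumes S: "S \<in> sets lebesgue"
    and "has_bochner_int (lebesgue_on S) f y" "has_bochner_int (lebesgue_on S) f z"
  shows "y = z"
proof -
  have "y \<bullet> e = z \<bullet> e" for e
    using has_bochner_int_inner[OF S assms(2), of e] has_bochner_int_inner[OF S assms(3), of e]
    by (metis has_bochner_integral_eq)
  then show ?thesis using vector_eq_rdot by blast
qed

lemma simple_bochner_integral_dist_le:
  fixes f :: "real \<Rightarrow> 'a::real_normed_vector"
  assumes S: "S \<in> sets lebesgue" and f: "strongly_measurable (lebesgue_on S) f"
    and s: "Bochner_Integration.simple_bochner_integrable (lebesgue_on S) s"
    and t: "Bochner_Integration.simple_bochner_integrable (lebesgue_on S) t"
  shows "ennreal (norm (Bochner_Integration.simple_bochner_integral (lebesgue_on S) s - Bochner_Integration.simple_bochner_integral (lebesgue_on S) t)) \<le>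
    (\<integral>\<^sup>+ x. ennreal (norm (f x - s x)) \<partial>lebesgue_on S) + (\<integral>\<^sup>+ x. ennreal (norm (f x - t x)) \<partial>lebesgue_on S)"
proof -
  let ?M = "lebesgue_on S"
  have st: "Bochner_Integration.simple_bochner_integrable ?M (\<lambda>x. s x - t x)"
    using simple_bochner_integrable_compose2[of "(-)", OF _ s t] by simp
  have ssm: "strongly_measurable ?M s" "strongly_measurable ?M t"
    using s t unfolding strongly_measurable_def simple_bochner_integrable.simps
    by (intro exI[of _ "\<lambda>_. s"] exI[of _ "\<lambda>_. t"]; auto)+
  have [measurable]: "(\<lambda>x. norm (f x - s x)) \<in> borel_measurable ?M" "(\<lambda>x. norm (f x - t x)) \<in> borel_measurable ?M"
    using strongly_measurable_norm[OF strongly_measurable_diff[OF f]] ssm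
    by (simp_all add: strongly_measurable_iff_borel[OF S])
  have "ennreal (norm (Bochner_Integration.simple_bochner_integral ?M s - Bochner_Integration.simple_bochner_integral ?M t))
      = ennreal (norm (Bochner_Integration.simple_bochner_integral ?M (\<lambda>x. s x - t x)))"
    by (subst simple_bochner_integral_diff[OF s t]) auto
  also have "\<dots> \<le> ennreal (Bochner_Integration.simple_bochner_integral ?M (\<lambda>x. norm (s x - t x)))"
    by (intro ennreal_leI simple_bochner_integral_norm_bound st)
  also have "\<dots> = (\<integral>\<^sup>+x. norm (s x - t x) \<partial>?M)"
    using simple_bochner_integrable_compose2[of "\<lambda>x y. norm (x - y)", OF _ s t]
    by (intro simple_bochner_integral_eq_nn_integral) auto
  also have "\<dots> \<le> (\<integral>\<^sup>+x. ennreal (norm (f x - s x)) + ennreal (norm (f x - t x)) \<partial>?M)"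
  proof (intro nn_integral_mono)
    fix x
    have "norm (s x - t x) \<le> norm (f x - s x) + norm (f x - t x)"
      using norm_triangle_ineq4[of "f x - t x" "f x - s x"] by simp
    then show "ennreal (norm (s x - t x)) \<le> ennreal (norm (f x - s x)) + ennreal (norm (f x - t x))"
      by (simp flip: ennreal_plus)
  qed
  also have "\<dots> = (\<integral>\<^sup>+ x. ennreal (norm (f x - s x)) \<partial>?M) + (\<integral>\<^sup>+ x. ennreal (norm (f x - t x)) \<partial>?M)"
    by (intro nn_integral_add) auto
  finally show ?thesis .
qed

text \<open>
  As \<^const>\<open>bochner_int\<close> is \<open>0\<close> where there is no integral, existence is required before anything
  can be said about its value. Replacing an approximating simple function by \<open>0\<close> wherever it
  exceeds twice the norm of \<open>f\<close> makes dominated convergence available; the integrals of these simple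
  functions form a Cauchy sequence, which converges as the space is complete.
\<close>

lemma has_bochner_int_exists:
  fixes f :: "real \<Rightarrow> 'a::{real_inner, banach}"
  assumes S: "S \<in> sets lebesgue" and fin: "emeasure lebesgue S < \<infinity>"
    and f: "strongly_measurable (lebesgue_on S) f"
    and int: "integrable (lebesgue_on S) (\<lambda>x. norm (f x))"
  shows "\<exists>y. has_bochner_int (lebesgue_on S) f y"
proof -
  let ?M = "lebesgue_on S"
  obtain s where s: "\<And>n::nat. simple_function ?M (s n)"
    and lim: "AE x in ?M. (\<lambda>n. s n x) \<longlonglongrightarrow> f x"
    using f unfolding strongly_measurable_def by auto
  have sm: "strongly_measurable ?M (s n)" for n
    using s[of n] unfolding strongly_measurable_def by (intro exI[of _ "\<lambda>_. s n"]) auto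
  have [measurable]: "(\<lambda>x. norm (f x)) \<in> borel_measurable ?M" "(\<lambda>x. norm (s n x)) \<in> borel_measurable ?M" for n
    using strongly_measurable_norm[OF f] strongly_measurable_norm[OF sm]
    by (simp_all add: strongly_measurable_iff_borel[OF S])
  \<comment> \<open>The factor 2 leaves room where \<open>f x \<noteq> 0\<close>; where \<open>f x = 0\<close> it forces \<open>r n x = 0\<close>.\<close>
  define r where "r n x = (if norm (s n x) \<le> 2 * norm (f x) then s n x else 0)" for n x
  have r: "simple_function ?M (r n)" for n
    unfolding r_def by (intro simple_function_If s simple_function_const) measurable
  have rsm: "strongly_measurable ?M (r n)" for n
    using r[of n] unfolding strongly_measurable_def by (intro exI[of _ "\<lambda>_. r n"]) auto
  have mfr [measurable]: "(\<lambda>x. norm (f x - r n x)) \<in> borel_measurable ?M" for n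
    using strongly_measurable_norm[OF strongly_measurable_diff[OF f rsm]]
    by (simp add: strongly_measurable_iff_borel[OF S])
  have Mfin: "emeasure ?M (space ?M) < \<infinity>"
    using fin S by (simp add: emeasure_restrict_space)
  have rb: "Bochner_Integration.simple_bochner_integrable ?M (r n)" for n
  proof (intro simple_bochner_integrable.intros r)
    have "emeasure ?M {y \<in> space ?M. r n y \<noteq> 0} \<le> emeasure ?M (space ?M)"
      by (rule emeasure_space)
    also have "\<dots> < \<infinity>" by (rule Mfin)
    finally show "emeasure ?M {y \<in> space ?M. r n y \<noteq> 0} \<noteq> \<infinity>" by simp
  qed
  have rle: "norm (f x - r n x) \<le> 3 * norm (f x)" for n x
    unfolding r_def using norm_triangle_ineq4[of "f x" "s n x"] by auto
  have rlim: "AE x in ?M. (\<lambda>n. norm (f x - r n x)) \<longlonglongrightarrow> 0"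
    using lim
  proof eventually_elim
    case (elim x)
    have "(\<lambda>n. r n x) \<longlonglongrightarrow> f x"
    proof (cases "f x = 0")
      case True
      then have "r n x = 0" for n by (simp add: r_def)
      then show ?thesis using True by simp
    next
      case False
      have "(\<lambda>n. norm (s n x)) \<longlonglongrightarrow> norm (f x)" using elim by (rule tendsto_norm)
      then have "\<forall>\<^sub>F n in sequentially. norm (s n x) < 2 * norm (f x)"
        by (rule order_tendstoD) (use False in auto)
      then have "\<forall>\<^sub>F n in sequentially. s n x = r n x"
        by eventually_elim (simp add: r_def)
      then show ?thesis using elim by (rule Lim_transform_eventually[rotated])
    qed
    then show ?case
      using tendsto_norm[OF tendsto_diff[OF tendsto_const[of "f x"]]] by fastforce
  qed
  have "(\<lambda>n. \<integral>\<^sup>+ x. ennreal (norm (f x - r n x)) \<partial>?M) \<longlonglongrightarrow> (\<integral>\<^sup>+ x. 0 \<partial>?M)"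
  proof (rule nn_integral_dominated_convergence[where w="\<lambda>x. ennreal (3 * norm (f x))"])
    show "(\<integral>\<^sup>+ x. ennreal (3 * norm (f x)) \<partial>?M) < \<infinity>"
      using integrable_mult_right[OF int, of 3] by (subst (asm) integrable_iff_bounded) auto
    show "AE x in ?M. (\<lambda>n. ennreal (norm (f x - r n x))) \<longlonglongrightarrow> 0"
      using rlim by eventually_elim (use tendsto_ennrealI in force)
  qed (use rle in \<open>auto intro: ennreal_leI\<close>)
  then have conv: "(\<lambda>n. \<integral>\<^sup>+ x. ennreal (norm (f x - r n x)) \<partial>?M) \<longlonglongrightarrow> 0" by simp
  have "Cauchy (\<lambda>n. Bochner_Integration.simple_bochner_integral ?M (r n))"
  proof (rule metric_CauchyI)
    fix \<epsilon> :: real assume "0 < \<epsilon>"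
    then have "\<forall>\<^sub>F n in sequentially. (\<integral>\<^sup>+ x. ennreal (norm (f x - r n x)) \<partial>?M) < ennreal (\<epsilon>/2)"
      by (intro order_tendstoD(2)[OF conv]) auto
    then obtain N where N: "\<And>n. n \<ge> N \<Longrightarrow> (\<integral>\<^sup>+ x. ennreal (norm (f x - r n x)) \<partial>?M) < ennreal (\<epsilon>/2)"
      by (auto simp: eventually_sequentially)
    show "\<exists>M. \<forall>m\<ge>M. \<forall>n\<ge>M. dist (Bochner_Integration.simple_bochner_integral ?M (r m)) (Bochner_Integration.simple_bochner_integral ?M (r n)) < \<epsilon>"
    proof (intro exI[of _ N] allI impI)
      fix m n assume "N \<le> m" "N \<le> n"
      have "ennreal (dist (Bochner_Integration.simple_bochner_integral ?M (r m)) (Bochner_Integration.simple_bochner_integral ?M (r n)))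
        \<le> (\<integral>\<^sup>+ x. ennreal (norm (f x - r m x)) \<partial>?M) + (\<integral>\<^sup>+ x. ennreal (norm (f x - r n x)) \<partial>?M)"
        unfolding dist_norm by (rule simple_bochner_integral_dist_le[OF S f rb rb])
      also have "\<dots> < ennreal (\<epsilon>/2) + ennreal (\<epsilon>/2)"
        by (intro add_strict_mono N \<open>N \<le> m\<close> \<open>N \<le> n\<close>)
      also have "\<dots> = ennreal \<epsilon>"
        using \<open>0 < \<epsilon>\<close> by (simp flip: ennreal_plus)
      finally show "dist (Bochner_Integration.simple_bochner_integral ?M (r m)) (Bochner_Integration.simple_bochner_integral ?M (r n)) < \<epsilon>"
        by (simp add: ennreal_less_iff)
    qed
  qed
  then obtain y where "(\<lambda>n. Bochner_Integration.simple_bochner_integral ?M (r n)) \<longlonglongrightarrow> y"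
    by (auto simp: Cauchy_convergent_iff convergent_def)
  then show ?thesis
    unfolding has_bochner_int_def using f rb conv by blast
qed

lemma bochner_int_inner:
  fixes f :: "real \<Rightarrow> 'a::{real_inner, banach}"
  assumes S: "S \<in> sets lebesgue" and fin: "emeasure lebesgue S < \<infinity>"
    and f: "strongly_measurable (lebesgue_on S) f"
    and int: "integrable (lebesgue_on S) (\<lambda>x. norm (f x))"
  shows "bochner_int (lebesgue_on S) f \<bullet> e = (\<integral>x. f x \<bullet> e \<partial>lebesgue_on S)"
proof -
  obtain y where y: "has_bochner_int (lebesgue_on S) f y"
    using has_bochner_int_exists[OF assms] by blast
  have "bochner_int (lebesgue_on S) f = y"
    unfolding bochner_int_def using y has_bochner_int_unique[OF S] by (auto intro: the_equality)
  then show ?thesis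
    using has_bochner_integral_integral_eq[OF has_bochner_int_inner[OF S y, of e]] by simp
qed

section \<open>Smooth test functions and primitives\<close>

text \<open>
  For every polynomial \<open>p\<close> the function \<open>p(1/x) exp(-1/x)\<close>, continued by \<open>0\<close> to \<open>x \<le> 0\<close>, has a derivative
  of the same form. This is the source of all smooth functions with compact support below.
\<close>

definition flat :: "real poly \<Rightarrow> real \<Rightarrow> real" where
  "flat p x = (if x > 0 then poly p (1 / x) * exp (- (1 / x)) else 0)"

lemma poly_exp_tendsto_0: "((\<lambda>y::real. poly p y * exp (- y)) \<longlongrightarrow> 0) at_top"
proof -
  have "((\<lambda>y. \<Sum>i\<le>degree p. coeff p i * (y ^ i / exp y)) \<longlongrightarrow> (\<Sum>i\<le>degree p. coeff p i * 0)) at_top"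
    by (intro tendsto_intros tendsto_power_div_exp_0)
  then show ?thesis
    by (simp add: poly_altdef exp_minus sum_distrib_right divide_inverse mult.assoc)
qed

lemma flat_has_derivative:
  "(flat p has_real_derivative flat ([:0, 0, 1:] * (p - pderiv p)) x) (at x)"
proof -
  consider "x > 0" | "x < 0" | "x = 0" by linarith
  then show ?thesis
  proof cases
    case 1
    have "((\<lambda>x. poly p (1 / x) * exp (- (1 / x))) has_real_derivative
        flat ([:0, 0, 1:] * (p - pderiv p)) x) (at x)"
      using 1 unfolding flat_def
      by (auto intro!: derivative_eq_intros DERIV_chain2[OF poly_DERIV]
          simp: field_simps power2_eq_square)
    then show ?thesis
      by (rule has_field_derivative_transform_within_open[where S="{0<..}"])
        (use 1 in \<open>auto simp: flat_def\<close>)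
  next
    case 2
    have "((\<lambda>x. 0) has_real_derivative 0) (at x)" by simp
    then have "(flat p has_real_derivative 0) (at x)"
      by (rule has_field_derivative_transform_within_open[where S="{..<0}"])
        (use 2 in \<open>auto simp: flat_def\<close>)
    then show ?thesis using 2 by (simp add: flat_def)
  next
    case 3
    have "((\<lambda>h. flat p h / h) \<longlongrightarrow> 0) (at_right 0)"
    proof (rule Lim_transform_eventually)
      show "((\<lambda>x. poly ([:0, 1:] * p) (inverse x) * exp (- (inverse x))) \<longlongrightarrow> 0) (at_right (0::real))"
        by (rule filterlim_compose[OF poly_exp_tendsto_0 filterlim_inverse_at_top_right])
      show "\<forall>\<^sub>F x in at_right 0. poly ([:0, 1:] * p) (inverse x) * exp (- (inverse x)) = flat p x / x"
        using eventually_at_right_less[of "0::real"]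
        by eventually_elim (auto simp: flat_def divide_inverse)
    qed
    moreover have "((\<lambda>h. flat p h / h) \<longlongrightarrow> 0) (at_left 0)"
    proof (rule Lim_transform_eventually)
      show "\<forall>\<^sub>F x in at_left 0. 0 = flat p x / x"
        by (auto simp: flat_def eventually_at_filter)
    qed simp
    ultimately have "((\<lambda>h. flat p h / h) \<longlongrightarrow> 0) (at 0)"
      by (simp add: filterlim_split_at)
    then show ?thesis
      using 3 by (simp add: DERIV_def flat_def)
  qed
qed

text \<open>
  A class of functions closed under differentiation, hence consisting of smooth functions, and
  large enough to contain a bump supported in \<open>[0,1]\<close>.
\<close>

inductive smooth_class :: "(real \<Rightarrow> real) \<Rightarrow> bool" where
  flat: "smooth_class (\<lambda>x. flat p (a * x + b))"
| scale: "smooth_class f \<Longrightarrow> smooth_class (\<lambda>x. c * f x)"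
| add: "smooth_class f \<Longrightarrow> smooth_class g \<Longrightarrow> smooth_class (\<lambda>x. f x + g x)"
| mult: "smooth_class f \<Longrightarrow> smooth_class g \<Longrightarrow> smooth_class (\<lambda>x. f x * g x)"

lemma smooth_class_has_derivative:
  "smooth_class f \<Longrightarrow> \<exists>f'. smooth_class f' \<and> (\<forall>x. (f has_real_derivative f' x) (at x))"
proof (induction rule: smooth_class.induct)
  case (flat p a b)
  have "((\<lambda>x. flat p (a * x + b)) has_real_derivative
      a * flat ([:0, 0, 1:] * (p - pderiv p)) (a * x + b)) (at x)" for x
  proof -
    have "((\<lambda>x. a * x + b) has_real_derivative a) (at x)"
      by (auto intro!: derivative_eq_intros)
    from DERIV_chain2[OF flat_has_derivative this] show ?thesis
      by (subst mult.commute)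
  qed
  then show ?case
    using smooth_class.scale[OF smooth_class.flat] by blast
next
  case (scale f c)
  then obtain f' where "smooth_class f'" "\<And>x. (f has_real_derivative f' x) (at x)" by blast
  then show ?case
    by (intro exI[of _ "\<lambda>x. c * f' x"]) (auto intro: smooth_class.scale DERIV_cmult)
next
  case (add f g)
  then obtain f' g' where "smooth_class f'" "\<And>x. (f has_real_derivative f' x) (at x)"
    "smooth_class g'" "\<And>x. (g has_real_derivative g' x) (at x)" by blast
  then show ?case
    by (intro exI[of _ "\<lambda>x. f' x + g' x"]) (auto intro: smooth_class.add DERIV_add)
next
  case (mult f g)
  then obtain f' g' where f': "smooth_class f'" "\<And>x. (f has_real_derivative f' x) (at x)"
    and g': "smooth_class g'" "\<And>x. (g has_real_derivative g' x) (at x)" by blast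
  have "smooth_class (\<lambda>x. f' x * g x + g' x * f x)"
    by (intro smooth_class.add smooth_class.mult f' g' mult.hyps)
  then show ?case
    using f' g' by (intro exI[of _ "\<lambda>x. f' x * g x + g' x * f x"]) (auto intro: DERIV_mult)
qed

lemma smooth_class_compose_affine: "smooth_class f \<Longrightarrow> smooth_class (\<lambda>x. f (c * x + d))"
proof (induction rule: smooth_class.induct)
  case (flat p a b)
  then show ?case
    using smooth_class.flat[of p "a * c" "a * d + b"] by (simp add: algebra_simps)
qed (auto intro: smooth_class.intros)

lemma smooth_class_deriv: "smooth_class f \<Longrightarrow> smooth_class (deriv f)"
  using smooth_class_has_derivative[of f] by (metis DERIV_imp_deriv ext)

lemma smooth_class_higher_deriv: "smooth_class f \<Longrightarrow> smooth_class ((deriv ^^ n) f)"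
  by (induction n) (auto intro: smooth_class_deriv)

lemma smooth_class_differentiable: "smooth_class f \<Longrightarrow> f differentiable (at x)"
  using smooth_class_has_derivative[of f] real_differentiable_def by blast

text \<open>
  The primitive of a bump in the class above, normalised to rise from \<open>0\<close> to \<open>1\<close> on \<open>[0,1]\<close>.
\<close>

lemma smooth_step:
  obtains \<sigma> \<sigma>' :: "real \<Rightarrow> real" where "smooth_class \<sigma>'"
    "\<And>x. (\<sigma> has_real_derivative \<sigma>' x) (at x)"
    "\<And>x. x \<le> 0 \<Longrightarrow> \<sigma> x = 0" "\<And>x. x \<ge> 1 \<Longrightarrow> \<sigma> x = 1"
    "\<And>x. 0 \<le> \<sigma> x" "\<And>x. \<sigma> x \<le> 1"
    "\<And>x. 0 \<le> \<sigma>' x" "\<And>x. x \<notin> {0<..<1} \<Longrightarrow> \<sigma>' x = 0"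
proof -
  define b where "b x = flat 1 x * flat 1 (1 - x)" for x
  have b: "smooth_class b"
    using smooth_class.mult[OF smooth_class.flat[of 1 1 0] smooth_class.flat[of 1 "-1" 1]]
    by (simp add: b_def[abs_def])
  have b0: "b x = 0" if "x \<notin> {0<..<1}" for x using that by (auto simp: b_def flat_def)
  have bpos: "b x > 0" if "x \<in> {0<..<1}" for x using that by (auto simp: b_def flat_def)
  have bnn: "b x \<ge> 0" for x using b0[of x] bpos[of x] by (cases "x \<in> {0<..<1}") auto
  have cont: "isCont b x" for x
    using smooth_class_has_derivative[OF b] DERIV_isCont by blast
  obtain F where "\<And>x. (F has_vector_derivative b x) (at x)"
    using einterval_antiderivative[of "-\<infinity>" "\<infinity>" b] cont by auto
  then have F: "(F has_real_derivative b x) (at x)" for x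
    by (simp add: has_real_derivative_iff_has_vector_derivative)
  have mono: "F x \<le> F y" if "x \<le> y" for x y
    using DERIV_nonneg_imp_nondecreasing[OF that, of F] F bnn by blast
  have less: "F 0 < F 1"
    by (rule DERIV_pos_imp_increasing_open)
      (use F bpos in \<open>auto intro!: continuous_at_imp_continuous_on DERIV_isCont\<close>)
  have F0: "F x = F 0" if "x \<le> 0" for x
  proof (cases "x = 0")
    case False
    then show ?thesis
      using that F b0 
      by (intro DERIV_isconst_end[of x 0 F, symmetric])
        (auto intro!: continuous_at_imp_continuous_on DERIV_isCont, metis F b0 greaterThanLessThan_iff not_less_iff_gr_or_eq)
  qed simp
  have F1: "F x = F 1" if "x \<ge> 1" for x
  proof (cases "x = 1")
    case False
    then show ?thesis
      using that F b0 
      by (intro DERIV_isconst_end[of 1 x F])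
        (auto intro!: continuous_at_imp_continuous_on DERIV_isCont, metis F b0 greaterThanLessThan_iff not_less_iff_gr_or_eq)
  qed simp
  define \<sigma> where "\<sigma> x = (F x - F 0) / (F 1 - F 0)" for x
  define \<sigma>' where "\<sigma>' x = 1 / (F 1 - F 0) * b x" for x
  show ?thesis
  proof
    show "smooth_class \<sigma>'" unfolding \<sigma>'_def by (rule smooth_class.scale[OF b])
    show "(\<sigma> has_real_derivative \<sigma>' x) (at x)" for x
      unfolding \<sigma>_def \<sigma>'_def using less by (auto intro!: derivative_eq_intros F)
    show "\<sigma> x = 0" if "x \<le> 0" for x using F0[OF that] by (simp add: \<sigma>_def)
    show "\<sigma> x = 1" if "x \<ge> 1" for x using F1[OF that] less by (simp add: \<sigma>_def)
    have "F 0 \<le> F x" for x using F0[of x] mono[of 0 x] by (cases "x \<le> 0") auto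
    then show "0 \<le> \<sigma> x" for x using less by (simp add: \<sigma>_def)
    have "F x \<le> F 1" for x using F1[of x] mono[of x 1] by (cases "x \<le> 1") auto
    then show "\<sigma> x \<le> 1" for x using less by (simp add: \<sigma>_def divide_le_eq)
    show "0 \<le> \<sigma>' x" for x using less bnn by (simp add: \<sigma>'_def)
    show "\<sigma>' x = 0" if "x \<notin> {0<..<1}" for x using b0[OF that] by (simp add: \<sigma>'_def)
  qed
qed

lemma borel_measurable_lebesgue_onI:
  "h \<in> borel_measurable borel \<Longrightarrow> h \<in> borel_measurable (lebesgue_on S)"
  by (intro measurable_restrict_space1 measurable_completion) simp

lemma has_bochner_integral_lebesgue_onI:
  fixes f :: "real \<Rightarrow> real"
  assumes "has_bochner_integral lborel (\<lambda>t. indicator S t *\<^sub>R f t) x" and "S \<in> sets lebesgue"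
  shows "has_bochner_integral (lebesgue_on S) f x"
proof -
  have "(\<lambda>t. indicator S t *\<^sub>R f t) \<in> borel_measurable lborel"
    using assms(1) by (rule borel_measurable_has_bochner_integral)
  then show ?thesis
    using assms unfolding has_bochner_integral_iff
    by (simp add: integrable_restrict_space integral_restrict_space integrable_completion
        integral_completion)
qed

text \<open>
  Rescaled bumps \<open>n \<sigma>' (n (t - a))\<close> form an approximate identity at \<open>a\<close>.
\<close>

lemma integral_scaled_bump:
  fixes \<sigma> \<sigma>' :: "real \<Rightarrow> real"
  assumes d: "\<And>x. (\<sigma> has_real_derivative \<sigma>' x) (at x)" and c: "\<And>x. isCont \<sigma>' x"
    and s0: "\<And>x. x \<le> 0 \<Longrightarrow> \<sigma> x = 0" and s1: "\<And>x. x \<ge> 1 \<Longrightarrow> \<sigma> x = 1"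
    and supp: "\<And>x. x \<notin> {0<..<1} \<Longrightarrow> \<sigma>' x = 0"
    and n: "0 < n" and a: "0 < a" and T: "a + 1 / n < T"
  shows "has_bochner_integral (time_measure T) (\<lambda>t. n * \<sigma>' (n * (t - a))) 1"
proof -
  let ?f = "\<lambda>t. n * \<sigma>' (n * (t - a))"
  have der: "((\<lambda>t. \<sigma> (n * (t - a))) has_real_derivative ?f t) (at t)" for t
  proof -
    have "((\<lambda>t. n * (t - a)) has_real_derivative n) (at t)"
      by (auto intro!: derivative_eq_intros)
    from DERIV_chain2[OF d this] show ?thesis by (subst mult.commute)
  qed
  have cont: "isCont ?f t" for t
    by (intro continuous_intros isCont_o2[OF _ c])
  have nT: "n * (T - a) \<ge> 1" using T n by (simp add: field_simps)
  have "has_bochner_integral lborel (\<lambda>t. ?f t * indicator {0..T} t) (\<sigma> (n * (T - a)) - \<sigma> (n * (0 - a)))"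
    using n a T by (intro has_bochner_integral_FTC_Icc_real der cont)
      (smt (verit) divide_pos_pos)
  moreover have "\<sigma> (n * (T - a)) - \<sigma> (n * (0 - a)) = 1"
    using s0[of "n * (0 - a)"] s1[OF nT] n a by (simp add: mult_le_0_iff)
  moreover have "?f t * indicator {0..T} t = indicator {0<..<T} t *\<^sub>R ?f t" for t
  proof (cases "n * (t - a) \<in> {0<..<1}")
    case True
    then have "t > a" "t < a + 1 / n" using n by (auto simp: field_simps zero_less_mult_iff)
    then show ?thesis using a T by (auto simp: indicator_def)
  qed (simp add: supp)
  ultimately have "has_bochner_integral lborel (\<lambda>t. indicator {0<..<T} t *\<^sub>R ?f t) 1"
    by simp
  then show ?thesis
    by (intro has_bochner_integral_lebesgue_onI) auto
qed

lemma bump_average_tendsto: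
  fixes \<sigma> \<sigma>' V :: "real \<Rightarrow> real"
  assumes d: "\<And>x. (\<sigma> has_real_derivative \<sigma>' x) (at x)" and c: "\<And>x. isCont \<sigma>' x"
    and s0: "\<And>x. x \<le> 0 \<Longrightarrow> \<sigma> x = 0" and s1: "\<And>x. x \<ge> 1 \<Longrightarrow> \<sigma> x = 1"
    and nn: "\<And>x. 0 \<le> \<sigma>' x" and supp: "\<And>x. x \<notin> {0<..<1} \<Longrightarrow> \<sigma>' x = 0"
    and V: "continuous_on {0..T} V" and a: "0 < a" "a < T"
  shows "\<forall>\<^sub>F n in sequentially. integrable (time_measure T) (\<lambda>t. real n * \<sigma>' (real n * (t - a)) * V t)"
    and "(\<lambda>n. \<integral>t. real n * \<sigma>' (real n * (t - a)) * V t \<partial>time_measure T) \<longlonglongrightarrow> V a"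
proof -
  let ?M = "time_measure T"
  let ?f = "\<lambda>n t. real n * \<sigma>' (real n * (t - a))"
  have ev: "\<forall>\<^sub>F n in sequentially. n > 0 \<and> a + 1 / real n < T"
  proof -
    have "(\<lambda>n. a + 1 / real n) \<longlonglongrightarrow> a + 0" by (intro tendsto_intros lim_1_over_n)
    then have "\<forall>\<^sub>F n in sequentially. a + 1 / real n < T"
      by (rule order_tendstoD) (use a in auto)
    then show ?thesis using eventually_gt_at_top[of 0] by eventually_elim auto
  qed
  have f1: "has_bochner_integral ?M (?f n) 1" if "n > 0" "a + 1 / real n < T" for n
    by (rule integral_scaled_bump[OF d c s0 s1 supp]) (use that a in auto)
  have "bounded (V ` {0..T})"
    using V compact_Icc by (intro compact_imp_bounded compact_continuous_image)
  then obtain B where B: "\<And>t. t \<in> {0..T} \<Longrightarrow> \<bar>V t\<bar> \<le> B"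
    unfolding bounded_iff real_norm_def by blast
  have Vm [measurable]: "V \<in> borel_measurable ?M"
    by (intro continuous_imp_measurable_on_sets_lebesgue continuous_on_subset[OF V]) auto
  have int: "integrable ?M (\<lambda>t. ?f n t * V t)" if "n > 0" "a + 1 / real n < T" for n
  proof (rule Bochner_Integration.integrable_bound)
    show "integrable ?M (\<lambda>t. B * ?f n t)"
      using f1[OF that] by (simp add: has_bochner_integral_iff)
    show "(\<lambda>t. ?f n t * V t) \<in> borel_measurable ?M"
      by (rule borel_measurable_times[OF borel_measurable_has_bochner_integral[OF f1[OF that]] Vm])
    show "AE t in ?M. norm (?f n t * V t) \<le> norm (B * ?f n t)"
    proof (rule AE_I2)
      fix t assume "t \<in> space ?M"
      then have "\<bar>V t\<bar> \<le> B" using B by auto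
      then have "\<bar>?f n t\<bar> * \<bar>V t\<bar> \<le> \<bar>?f n t\<bar> * \<bar>B\<bar>" by (intro mult_left_mono) auto
      then show "norm (?f n t * V t) \<le> norm (B * ?f n t)" by (simp add: abs_mult mult.commute)
    qed
  qed
  show "\<forall>\<^sub>F n in sequentially. integrable ?M (\<lambda>t. ?f n t * V t)"
    using ev by eventually_elim (use int in blast)
  show "(\<lambda>n. \<integral>t. ?f n t * V t \<partial>?M) \<longlonglongrightarrow> V a"
  proof (rule tendstoI)
    fix \<epsilon> :: real assume "0 < \<epsilon>"
    then obtain \<delta> where \<delta>: "\<delta> > 0" "\<And>t. t \<in> {0..T} \<Longrightarrow> \<bar>t - a\<bar> < \<delta> \<Longrightarrow> \<bar>V t - V a\<bar> < \<epsilon> / 2"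
      using V a unfolding continuous_on_iff dist_real_def
      by (metis atLeastAtMost_iff half_gt_zero less_eq_real_def)
    have "\<forall>\<^sub>F n in sequentially. 1 / real n < \<delta>"
      by (rule order_tendstoD(2)[OF lim_1_over_n \<delta>(1)])
    with ev show "\<forall>\<^sub>F n in sequentially. dist (\<integral>t. ?f n t * V t \<partial>?M) (V a) < \<epsilon>"
    proof eventually_elim
      case (elim n)
      then have n: "n > 0" "a + 1 / real n < T" and n\<delta>: "1 / real n < \<delta>" by auto
      note f = f1[OF n]
      have "has_bochner_integral ?M (\<lambda>t. ?f n t * V t - ?f n t * V a) ((\<integral>t. ?f n t * V t \<partial>?M) - 1 * V a)"
        by (intro has_bochner_integral_diff has_bochner_integral_mult_left f
            has_bochner_integral_integrable int n)
      then have eq: "(\<integral>t. ?f n t * V t \<partial>?M) - V a = (\<integral>t. ?f n t * V t - ?f n t * V a \<partial>?M)"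
        by (simp add: has_bochner_integral_integral_eq)
      have "norm (\<integral>t. ?f n t * V t - ?f n t * V a \<partial>?M) \<le> (\<integral>t. ?f n t * (\<epsilon> / 2) \<partial>?M)"
      proof (rule Bochner_Integration.integral_norm_bound_integral)
        show "integrable ?M (\<lambda>t. ?f n t * V t - ?f n t * V a)"
          using int[OF n] f by (auto simp: has_bochner_integral_iff)
        show "integrable ?M (\<lambda>t. ?f n t * (\<epsilon> / 2))"
          using f by (auto simp: has_bochner_integral_iff)
        fix t assume t: "t \<in> space ?M"
        show "norm (?f n t * V t - ?f n t * V a) \<le> ?f n t * (\<epsilon> / 2)"
        proof (cases "real n * (t - a) \<in> {0<..<1}")
          case True
          then have "t > a" "t < a + 1 / real n"
            using n by (auto simp: field_simps zero_less_mult_iff)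
          then have "\<bar>V t - V a\<bar> \<le> \<epsilon> / 2" using \<delta>(2)[of t] n\<delta> t by auto
          then have "?f n t * \<bar>V t - V a\<bar> \<le> ?f n t * (\<epsilon> / 2)"
            using nn by (intro mult_left_mono) auto
          moreover have "norm (?f n t * V t - ?f n t * V a) = ?f n t * \<bar>V t - V a\<bar>"
            using nn by (simp add: abs_mult flip: right_diff_distrib)
          ultimately show ?thesis by simp
        qed (simp add: supp)
      qed
      also have "\<dots> = \<epsilon> / 2"
        using has_bochner_integral_mult_left[OF f, of "\<epsilon> / 2"]
        by (simp add: has_bochner_integral_iff)
      finally show ?case
        using \<open>0 < \<epsilon>\<close> eq by (simp add: dist_real_def)
    qed
  qed
qed

text \<open>
  The difference of two steeper and steeper steps approximates the indicator function of \<open>(a,b]\<close>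
  from within the class of test functions, and its derivative approximates a difference of point
  masses at \<open>a\<close> and \<open>b\<close>.
\<close>

lemma test_function_smooth_step:
  fixes \<sigma> \<sigma>' :: "real \<Rightarrow> real"
  assumes sm: "smooth_class \<sigma>'" and d: "\<And>x. (\<sigma> has_real_derivative \<sigma>' x) (at x)"
    and s0: "\<And>x. x \<le> 0 \<Longrightarrow> \<sigma> x = 0" and s1: "\<And>x. x \<ge> 1 \<Longrightarrow> \<sigma> x = 1"
    and n: "0 < n" and ab: "0 < a" "a < b" "b + 1 / n < T"
  shows "test_function T (\<lambda>t. \<sigma> (n * (t - a)) - \<sigma> (n * (t - b)))"
    and "deriv (\<lambda>t. \<sigma> (n * (t - a)) - \<sigma> (n * (t - b))) t
      = n * \<sigma>' (n * (t - a)) - n * \<sigma>' (n * (t - b))"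
proof -
  let ?\<eta> = "\<lambda>t. \<sigma> (n * (t - a)) - \<sigma> (n * (t - b))"
  let ?\<eta>' = "\<lambda>t. n * \<sigma>' (n * (t - a)) - n * \<sigma>' (n * (t - b))"
  have der: "((\<lambda>t. \<sigma> (n * (t - c))) has_real_derivative n * \<sigma>' (n * (t - c))) (at t)" for t c
  proof -
    have "((\<lambda>t. n * (t - c)) has_real_derivative n) (at t)"
      by (auto intro!: derivative_eq_intros)
    from DERIV_chain2[OF d this] show ?thesis by (subst mult.commute)
  qed
  have \<eta>: "(?\<eta> has_real_derivative ?\<eta>' t) (at t)" for t
    by (intro DERIV_diff der)
  then show deriv: "deriv ?\<eta> t = ?\<eta>' t" for t
    by (rule DERIV_imp_deriv)
  have cl: "smooth_class (\<lambda>t. m * \<sigma>' (n * t + c))" for m c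
    by (intro smooth_class.scale smooth_class_compose_affine sm)
  have "smooth_class ?\<eta>'"
    using smooth_class.add[OF cl[of n "- n * a"] cl[of "- n" "- n * b"]]
    by (simp add: algebra_simps)
  then have "smooth_class (deriv ?\<eta>)"
    using deriv by presburger
  then have "smooth_class ((deriv ^^ Suc m) ?\<eta>)" for m
    using smooth_class_higher_deriv[of "deriv ?\<eta>" m] by (simp add: funpow_Suc_right del: funpow.simps)
  then have "(deriv ^^ Suc m) ?\<eta> differentiable (at t)" for m t
    by (rule smooth_class_differentiable)
  moreover have "?\<eta> differentiable (at t)" for t
    using \<eta> real_differentiable_def by blast
  ultimately have "(deriv ^^ m) ?\<eta> differentiable (at t)" for m t
    by (cases m) auto
  moreover have "?\<eta> t = 0" if "t \<notin> {a..b + 1 / n}" for t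
  proof (cases "t < a")
    case True
    then show ?thesis using n ab s0[of "n * (t - a)"] s0[of "n * (t - b)"]
      by (simp add: mult_le_0_iff)
  next
    case False
    then have "n * (t - b) \<ge> 1" using that n by (simp add: field_simps)
    moreover have "n * (t - a) \<ge> n * (t - b)" using n ab by simp
    ultimately show ?thesis by (simp add: s1)
  qed
  ultimately show "test_function T ?\<eta>"
    unfolding test_function_def using ab by blast
qed

text \<open>
  Testing with such a difference of steps turns the weak formulation into
  \<open>V b - V a = \<integral> g\<close> over \<open>(a,b)\<close>; then \<open>a \<rightarrow> 0\<close>.
\<close>

lemma primitive_of_weak_derivative:
  fixes V g :: "real \<Rightarrow> real"
  assumes V: "continuous_on {0..T} V" "V 0 = 0"
    and g: "integrable (time_measure T) g"
    and weak: "\<And>\<eta>. test_function T \<eta> \<Longrightarrow>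
      (\<integral>t. deriv \<eta> t * V t \<partial>time_measure T) = - (\<integral>t. \<eta> t * g t \<partial>time_measure T)"
    and b: "0 < b" "b < T"
  shows "V b = (\<integral>t. indicator {..b} t * g t \<partial>time_measure T)"
proof -
  let ?M = "time_measure T"
  obtain \<sigma> \<sigma>' :: "real \<Rightarrow> real" where sm: "smooth_class \<sigma>'"
    and d: "\<And>x. (\<sigma> has_real_derivative \<sigma>' x) (at x)"
    and s0: "\<And>x. x \<le> 0 \<Longrightarrow> \<sigma> x = 0" and s1: "\<And>x. x \<ge> 1 \<Longrightarrow> \<sigma> x = 1"
    and s01: "\<And>x. 0 \<le> \<sigma> x" "\<And>x. \<sigma> x \<le> 1"
    and nn: "\<And>x. 0 \<le> \<sigma>' x" and supp: "\<And>x. x \<notin> {0<..<1} \<Longrightarrow> \<sigma>' x = 0"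
    by (rule smooth_step) (rule that; assumption)
  have c: "isCont \<sigma>' x" for x
    using smooth_class_has_derivative[OF sm] DERIV_isCont by blast
  have gm [measurable]: "g \<in> borel_measurable ?M" using g by auto
  have indm: "(\<lambda>t. indicator A t * g t) \<in> borel_measurable ?M" if "A \<in> sets borel" for A
    using that by (intro borel_measurable_times gm borel_measurable_lebesgue_onI) auto
  have step: "V b - V a = (\<integral>t. indicator {a<..b} t * g t \<partial>?M)" if a: "0 < a" "a < b" for a
  proof -
    let ?\<eta> = "\<lambda>n t. \<sigma> (real n * (t - a)) - \<sigma> (real n * (t - b))"
    have bump: "\<forall>\<^sub>F n in sequentially. integrable ?M (\<lambda>t. real n * \<sigma>' (real n * (t - e)) * V t)"
      "(\<lambda>n. \<integral>t. real n * \<sigma>' (real n * (t - e)) * V t \<partial>?M) \<longlonglongrightarrow> V e"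
      if "0 < e" "e < T" for e
      by (rule bump_average_tendsto[OF d c s0 s1 nn supp V(1) that]; assumption)+
    have aT: "a < T" using a b by simp
    have ev: "\<forall>\<^sub>F n in sequentially. n > 0 \<and> b + 1 / real n < T"
    proof -
      have "(\<lambda>n. b + 1 / real n) \<longlonglongrightarrow> b + 0" by (intro tendsto_intros lim_1_over_n)
      then have "\<forall>\<^sub>F n in sequentially. b + 1 / real n < T"
        by (rule order_tendstoD) (use b in auto)
      then show ?thesis using eventually_gt_at_top[of 0] by eventually_elim auto
    qed
    have "(\<lambda>n. (\<integral>t. real n * \<sigma>' (real n * (t - a)) * V t \<partial>?M)
        - (\<integral>t. real n * \<sigma>' (real n * (t - b)) * V t \<partial>?M)) \<longlonglongrightarrow> V a - V b"
      by (intro tendsto_diff bump(2) a aT b)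
    moreover have "\<forall>\<^sub>F n in sequentially. (\<integral>t. real n * \<sigma>' (real n * (t - a)) * V t \<partial>?M)
        - (\<integral>t. real n * \<sigma>' (real n * (t - b)) * V t \<partial>?M) = - (\<integral>t. ?\<eta> n t * g t \<partial>?M)"
      using ev bump(1)[OF a(1) aT] bump(1)[OF b]
    proof eventually_elim
      case (elim n)
      have "test_function T (?\<eta> n)"
        by (rule test_function_smooth_step(1)[OF sm d s0 s1]) (use elim a in auto)
      from weak[OF this] have "(\<integral>t. deriv (?\<eta> n) t * V t \<partial>?M) = - (\<integral>t. ?\<eta> n t * g t \<partial>?M)" .
      moreover have "deriv (?\<eta> n) t = real n * \<sigma>' (real n * (t - a)) - real n * \<sigma>' (real n * (t - b))" for t
        by (rule test_function_smooth_step(2)[OF sm d s0 s1]) (use elim a in auto)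
      ultimately show ?case using elim by (simp add: left_diff_distrib)
    qed
    ultimately have "(\<lambda>n. - (\<integral>t. ?\<eta> n t * g t \<partial>?M)) \<longlonglongrightarrow> V a - V b"
      by (rule Lim_transform_eventually)
    moreover have "(\<lambda>n. \<integral>t. ?\<eta> n t * g t \<partial>?M) \<longlonglongrightarrow> (\<integral>t. indicator {a<..b} t * g t \<partial>?M)"
    proof (rule integral_dominated_convergence[where w="\<lambda>t. \<bar>g t\<bar>"])
      have "(\<lambda>t. \<sigma> (real n * (t - e))) \<in> borel_measurable ?M" for n e
        by (intro continuous_imp_measurable_on_sets_lebesgue continuous_at_imp_continuous_on ballI
            isCont_o2[OF _ DERIV_isCont[OF d]] continuous_intros) auto
      then show "(\<lambda>t. ?\<eta> n t * g t) \<in> borel_measurable ?M" for n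
        by (intro borel_measurable_times borel_measurable_diff gm)
      have lim: "(\<lambda>n. \<sigma> (real n * (t - c))) \<longlonglongrightarrow> indicator {c<..} t" for t c
      proof (cases "t > c")
        case True
        obtain N where N: "real N * (t - c) > 1"
          using reals_Archimedean3[of "t - c"] True by auto
        have "\<sigma> (real n * (t - c)) = 1" if "n \<ge> N" for n
        proof (rule s1)
          have "real N * (t - c) \<le> real n * (t - c)"
            using that True by (intro mult_right_mono) auto
          then show "1 \<le> real n * (t - c)" using N by simp
        qed
        then show ?thesis
          using True by (intro tendsto_eventually) (auto simp: eventually_sequentially)
      next
        case False
        then have "\<sigma> (real n * (t - c)) = 0" for n by (intro s0) (simp add: mult_nonneg_nonpos)
        then show ?thesis using False by simp
      qed
      have ind: "indicator {a<..} t - indicator {b<..} t = (indicator {a<..b} t :: real)" for t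
        using a by (auto simp: indicator_def)
      show "AE t in ?M. (\<lambda>n. ?\<eta> n t * g t) \<longlonglongrightarrow> indicator {a<..b} t * g t"
        unfolding ind[symmetric] by (intro AE_I2 tendsto_intros lim)
      have "\<bar>?\<eta> n t\<bar> \<le> 1" for n t
        using s01(1)[of "real n * (t - a)"] s01(2)[of "real n * (t - a)"]
          s01(1)[of "real n * (t - b)"] s01(2)[of "real n * (t - b)"] by linarith
      then show "AE t in ?M. norm (?\<eta> n t * g t) \<le> \<bar>g t\<bar>" for n
        by (simp add: abs_mult mult_left_le_one_le)
    qed (use g indm in auto)
    ultimately show ?thesis
      using LIMSEQ_unique[OF tendsto_minus] by fastforce
  qed
  \<comment> \<open>The shift by 2 keeps these points strictly between \<open>0\<close> and \<open>b\<close> for every \<open>n\<close>.\<close>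
  let ?a = "\<lambda>n. b / real (n + 2)"
  have a: "0 < ?a n" "?a n < b" for n using b by (auto simp: field_simps add_pos_nonneg)
  have a0: "?a \<longlonglongrightarrow> 0"
    by (rule LIMSEQ_ignore_initial_segment[OF lim_const_over_n])
  have "?a n \<in> {0..T}" for n
    using a[of n] b by auto
  then have "(\<lambda>n. V (?a n)) \<longlonglongrightarrow> V 0"
    using b by (intro continuous_on_tendsto_compose[OF V(1) a0]) auto
  then have "(\<lambda>n. V b - V (?a n)) \<longlonglongrightarrow> V b - 0"
    using V(2) by (intro tendsto_intros) auto
  moreover have "(\<lambda>n. \<integral>t. indicator {?a n<..b} t * g t \<partial>?M) \<longlonglongrightarrow> (\<integral>t. indicator {..b} t * g t \<partial>?M)"
  proof (rule integral_dominated_convergence[where w="\<lambda>t. \<bar>g t\<bar>"])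
    show "AE t in ?M. (\<lambda>n. indicator {?a n<..b} t * g t) \<longlonglongrightarrow> indicator {..b} t * g t"
    proof (rule AE_I2)
      fix t assume "t \<in> space ?M"
      then have "0 < t" by simp
      then have "\<forall>\<^sub>F n in sequentially. ?a n < t" by (rule order_tendstoD(2)[OF a0])
      then have "\<forall>\<^sub>F n in sequentially. indicator {?a n<..b} t * g t = indicator {..b} t * g t"
        by eventually_elim (auto simp: indicator_def)
      then show "(\<lambda>n. indicator {?a n<..b} t * g t) \<longlonglongrightarrow> indicator {..b} t * g t"
        by (rule tendsto_eventually)
    qed
  qed (use g indm in \<open>auto simp del: indicator_simps split: split_indicator\<close>)
  moreover have "V b - V (?a n) = (\<integral>t. indicator {?a n<..b} t * g t \<partial>?M)" for n
    by (rule step[OF a])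
  ultimately show ?thesis
    using LIMSEQ_unique by fastforce
qed

section \<open>Convolution on the half-line\<close>

text \<open>
  Convolution over the whole line. For functions that vanish on \<open>(-\<infinity>,0]\<close> it is the convolution over
  \<open>(0,t)\<close>, and no interval of integration has to be tracked in the algebra of convolutions.
\<close>

definition star :: "(real \<Rightarrow> real) \<Rightarrow> (real \<Rightarrow> real) \<Rightarrow> real \<Rightarrow> real" (infixr "\<star>" 75) where
  "(a \<star> b) t = (\<integral>s. a (t - s) * b s \<partial>lborel)"

text \<open>
  The functions that can be convolved: they vanish up to time \<open>0\<close> and are integrable up to every
  finite time.
\<close>

definition causal :: "(real \<Rightarrow> real) \<Rightarrow> bool" where
  "causal a \<longleftrightarrow> a \<in> borel_measurable borel \<and> (\<forall>x\<le>0. a x = 0) \<and>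
     (\<forall>t. integrable lborel (\<lambda>x. indicator {..t} x * a x))"

abbreviation heaviside :: "real \<Rightarrow> real" where
  "heaviside \<equiv> indicator {0<..}"

lemma causalD:
  assumes "causal a"
  shows "a \<in> borel_measurable borel" "x \<le> 0 \<Longrightarrow> a x = 0" "integrable lborel (\<lambda>x. indicator {..t} x * a x)"
  using assms by (auto simp: causal_def)

lemma causal_integrableI:
  assumes [measurable]: "integrable lborel a" and "\<And>x. x \<le> 0 \<Longrightarrow> a x = 0"
  shows "causal a"
  unfolding causal_def
proof (intro conjI allI impI assms)
  show "integrable lborel (\<lambda>x. indicator {..t} x * a x)" for t
    by (rule Bochner_Integration.integrable_bound[OF assms(1)]) (auto simp: indicator_def)
qed measurable

lemma integrable_const_Icc:
  fixes a b c :: real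
  shows "integrable lborel (\<lambda>x. c * indicator {a..b} x)"
  by (intro integrable_mult_right integrable_real_indicator) (auto simp: emeasure_lborel_Icc_eq)

lemma star_commute: "(a \<star> b) t = (b \<star> a) t"
  unfolding star_def
  by (subst lborel_integral_real_affine[where c="-1" and t=t]) (simp_all add: mult.commute)

lemma star_eq': "(a \<star> b) t = (\<integral>s. b (t - s) * a s \<partial>lborel)"
  by (subst star_commute) (rule star_def)

lemma star_measurable [measurable]:
  assumes [measurable]: "a \<in> borel_measurable borel" "b \<in> borel_measurable borel"
  shows "a \<star> b \<in> borel_measurable borel"
  unfolding star_def[abs_def] by measurable

lemma star_eq_0: "causal a \<Longrightarrow> causal b \<Longrightarrow> t \<le> 0 \<Longrightarrow> (a \<star> b) t = 0"
  unfolding star_def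
  by (rule integral_eq_zero_AE, rule AE_I2) (metis causalD(2) diff_le_0_iff_le linorder_le_cases mult_zero_left mult_zero_right order_trans)

lemma star_cong_AE:
  assumes "causal a" and [measurable]: "b \<in> borel_measurable borel" "c \<in> borel_measurable borel"
    and "AE s in lborel. s < t \<longrightarrow> b s = c s"
  shows "(a \<star> b) t = (a \<star> c) t"
  unfolding star_def
proof (rule integral_cong_AE)
  note [measurable] = causalD(1)[OF assms(1)]
  show "(\<lambda>s. a (t - s) * b s) \<in> borel_measurable lborel" "(\<lambda>s. a (t - s) * c s) \<in> borel_measurable lborel"
    by measurable
  show "AE s in lborel. a (t - s) * b s = a (t - s) * c s"
    using assms(4) by eventually_elim (use causalD(2)[OF assms(1)] in force)
qed

lemma causal_truncated_integrable:
  assumes "causal a"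
  shows "integrable lborel (\<lambda>s. indicator {0..} s * a (t - s))"
proof -
  have "integrable lborel (\<lambda>x. indicator {..t} x * a x)" using assms by (rule causalD)
  then have "integrable lborel (\<lambda>s. indicator {..t} (t + (-1) * s) * a (t + (-1) * s))"
    by (subst lborel_integrable_real_affine_iff) auto
  moreover have "indicator {..t} (t + (-1) * s) = (indicator {0..} s :: real)" for s
    by (auto simp: indicator_def)
  ultimately show ?thesis by (simp only: ) simp
qed

lemma star_integrable:
  assumes a: "causal a" and b: "b \<in> borel_measurable borel" "\<And>x. x \<le> 0 \<Longrightarrow> b x = 0"
    and B: "\<And>x. x \<le> t \<Longrightarrow> \<bar>b x\<bar> \<le> B"
  shows "integrable lborel (\<lambda>s. a (t - s) * b s)"
proof (rule Bochner_Integration.integrable_bound)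
  note [measurable] = causalD(1)[OF a] b(1)
  show "integrable lborel (\<lambda>s. B * (indicator {0..} s * a (t - s)))"
    by (intro integrable_mult_right causal_truncated_integrable a)
  show "(\<lambda>s. a (t - s) * b s) \<in> borel_measurable lborel" by measurable
  have "\<bar>a (t - s) * b s\<bar> \<le> \<bar>B * (indicator {0..} s * a (t - s))\<bar>" for s
  proof -
    consider "s \<le> 0" | "s \<ge> t" | "0 < s" "s < t" by linarith
    then show ?thesis
    proof cases
      case 3
      then have "\<bar>a (t - s)\<bar> * \<bar>b s\<bar> \<le> \<bar>a (t - s)\<bar> * \<bar>B\<bar>"
        using B[of s] by (intro mult_left_mono) auto
      then show ?thesis using 3 by (simp add: abs_mult mult.commute)
    qed (use b(2) causalD(2)[OF a] in auto)
  qed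
  then show "AE s in lborel. norm (a (t - s) * b s) \<le> norm (B * (indicator {0..} s * a (t - s)))"
    by auto
qed

lemma causal_boundedI:
  assumes [measurable]: "b \<in> borel_measurable borel" and "\<And>x. x \<le> 0 \<Longrightarrow> b x = 0"
    and "\<And>t. \<exists>B. \<forall>x\<le>t. \<bar>b x\<bar> \<le> B"
  shows "causal b"
  unfolding causal_def
proof (intro conjI allI impI assms)
  fix t
  obtain B where B: "\<And>x. x \<le> t \<Longrightarrow> \<bar>b x\<bar> \<le> B" using assms(3) by blast
  show "integrable lborel (\<lambda>x. indicator {..t} x * b x)"
  proof (rule Bochner_Integration.integrable_bound)
    show "integrable lborel (\<lambda>x. B * indicator {0..t} x)"
      by (rule integrable_const_Icc)
    show "AE x in lborel. norm (indicator {..t} x * b x) \<le> norm (B * indicator {0..t} x)"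
      using B assms(2) by (intro AE_I2) (force simp: indicator_def abs_mult)
  qed measurable
qed

lemma causal_heaviside: "causal heaviside"
  by (rule causal_boundedI) (auto simp: indicator_def intro!: exI[of _ 1])

text \<open>
  Fubini's theorem at one fixed time \<open>t\<close>. In general associativity holds for almost every \<open>t\<close> only; it
  holds at every \<open>t\<close> if \<open>a * b\<close> is bounded up to \<open>t\<close>. This covers \<open>k * l = 1\<close> with unbounded \<open>k\<close>
  and \<open>l\<close>.
\<close>

lemma star_assoc:
  assumes a: "causal a" "\<And>x. 0 \<le> a x" and b: "causal b" "\<And>x. 0 \<le> b x" and c: "causal c"
    and C: "\<And>x. x \<le> t \<Longrightarrow> (\<integral>\<^sup>+r. ennreal (a (x - r) * b r) \<partial>lborel) \<le> ennreal C"
  shows "(a \<star> (b \<star> c)) t = ((a \<star> b) \<star> c) t"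
proof -
  note [measurable] = causalD(1)[OF a(1)] causalD(1)[OF b(1)] causalD(1)[OF c]
  let ?f = "\<lambda>s r. a (t - r) * b (r - s) * c s"
  have shift: "(\<integral>\<^sup>+r. ennreal (a (t - r) * b (r - s)) \<partial>lborel)
      = (\<integral>\<^sup>+r. ennreal (a ((t - s) - r) * b r) \<partial>lborel)" for s
    by (subst nn_integral_real_affine[where c=1 and t=s]) (auto simp: algebra_simps)
  have "(\<integral>\<^sup>+s. \<integral>\<^sup>+r. ennreal (norm (?f s r)) \<partial>lborel \<partial>lborel)
      = (\<integral>\<^sup>+s. ennreal \<bar>c s\<bar> * (\<integral>\<^sup>+r. ennreal (a ((t - s) - r) * b r) \<partial>lborel) \<partial>lborel)"
    unfolding shift[symmetric]
    by (subst nn_integral_cmult[symmetric])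
      (auto simp: abs_mult a b ennreal_mult[symmetric] ac_simps intro!: nn_integral_cong)
  also have "\<dots> \<le> (\<integral>\<^sup>+s. ennreal (C * \<bar>indicator {..t} s * c s\<bar>) \<partial>lborel)"
  proof (rule nn_integral_mono)
    fix s
    show "ennreal \<bar>c s\<bar> * (\<integral>\<^sup>+r. ennreal (a ((t - s) - r) * b r) \<partial>lborel) \<le> ennreal (C * \<bar>indicator {..t} s * c s\<bar>)"
    proof -
      consider "s \<le> 0" | "0 < s" "s \<le> t" | "s > t" by linarith
      then show ?thesis
      proof cases
        case 2
        then have "ennreal \<bar>c s\<bar> * (\<integral>\<^sup>+r. ennreal (a ((t - s) - r) * b r) \<partial>lborel) \<le> ennreal \<bar>c s\<bar> * ennreal C"
          by (intro mult_left_mono C) auto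
        then show ?thesis using 2 by (simp add: ennreal_mult' mult.commute[of C])
      next
        case 3
        have "ennreal (a ((t - s) - r) * b r) = 0" for r
          using 3 causalD(2)[OF a(1), of "t - s - r"] causalD(2)[OF b(1), of r] by (cases "r \<le> 0") auto
        then show ?thesis by (simp only:) simp
      qed (simp add: causalD(2)[OF c])
    qed
  qed
  also have "\<dots> < \<infinity>"
  proof -
    have "integrable lborel (\<lambda>s. C * \<bar>indicator {..t} s * c s\<bar>)"
      by (intro integrable_mult_right integrable_abs causalD c)
    then have "(\<integral>\<^sup>+s. ennreal (C * \<bar>indicator {..t} s * c s\<bar>) \<partial>lborel) \<noteq> \<infinity>"
      unfolding real_integrable_def by blast
    then show ?thesis by (simp only: less_top infinity_ennreal_def)
  qed
  finally have fin: "(\<integral>\<^sup>+s. \<integral>\<^sup>+r. ennreal (norm (?f s r)) \<partial>lborel \<partial>lborel) < \<infinity>" .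
  have "integrable (lborel \<Otimes>\<^sub>M lborel) (case_prod ?f)"
  proof (rule integrableI_bounded)
    show "case_prod ?f \<in> borel_measurable (lborel \<Otimes>\<^sub>M lborel)" by measurable
    have "(\<integral>\<^sup>+p. ennreal (norm (case_prod ?f p)) \<partial>(lborel \<Otimes>\<^sub>M lborel))
        = (\<integral>\<^sup>+s. \<integral>\<^sup>+r. ennreal (norm (?f s r)) \<partial>lborel \<partial>lborel)"
      by (subst lborel.nn_integral_fst[symmetric]) auto
    with fin show "(\<integral>\<^sup>+p. ennreal (norm (case_prod ?f p)) \<partial>(lborel \<Otimes>\<^sub>M lborel)) < \<infinity>" by simp
  qed
  from lborel_pair.Fubini_integral[OF this]
  have "(\<integral>r. \<integral>s. ?f s r \<partial>lborel \<partial>lborel) = (\<integral>s. \<integral>r. ?f s r \<partial>lborel \<partial>lborel)" .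
  moreover have "(\<integral>s. ?f s r \<partial>lborel) = a (t - r) * (b \<star> c) r" for r
    unfolding star_def by (simp add: mult.assoc)
  moreover have inner: "(\<integral>r. ?f s r \<partial>lborel) = (a \<star> b) (t - s) * c s" for s
  proof -
    have "(\<integral>r. a (t - r) * b (r - s) \<partial>lborel) = (a \<star> b) (t - s)"
      unfolding star_def
      by (subst lborel_integral_real_affine[where c=1 and t=s]) (simp_all add: algebra_simps)
    then show ?thesis by simp
  qed
  ultimately have "(\<integral>r. a (t - r) * (b \<star> c) r \<partial>lborel) = (\<integral>s. (a \<star> b) (t - s) * c s \<partial>lborel)"
    by (simp only:)
  then show ?thesis
    by (simp only: star_def[of a "b \<star> c"] star_def[of "a \<star> b" c])
qed

lemma nn_star_commute:
  fixes a b :: "real \<Rightarrow> real" and x :: real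
  assumes [measurable]: "a \<in> borel_measurable borel" "b \<in> borel_measurable borel"
  shows "(\<integral>\<^sup>+r. ennreal (a (x - r) * b r) \<partial>lborel) = (\<integral>\<^sup>+r. ennreal (b (x - r) * a r) \<partial>lborel)"
  by (subst nn_integral_real_affine[where c="-1" and t=x]) (simp_all add: mult.commute)

lemma nn_star_bound:
  fixes a b :: "real \<Rightarrow> real" and t x A :: real
  assumes a: "a \<in> borel_measurable borel" "\<And>x. x \<le> 0 \<Longrightarrow> a x = 0" "\<And>x. x \<le> t \<Longrightarrow> a x \<le> A" "\<And>x. 0 \<le> a x"
    and b: "causal b" "\<And>x. 0 \<le> b x" and x: "x \<le> t"
  shows "(\<integral>\<^sup>+r. ennreal (a (x - r) * b r) \<partial>lborel) \<le> ennreal (A * (\<integral>r. indicator {..t} r * b r \<partial>lborel))"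
proof -
  have A: "0 \<le> A" using a(3)[of t] a(4)[of t] by linarith
  have "(\<integral>\<^sup>+r. ennreal (a (x - r) * b r) \<partial>lborel) \<le> (\<integral>\<^sup>+r. ennreal (A * (indicator {..t} r * b r)) \<partial>lborel)"
  proof (intro nn_integral_mono ennreal_leI)
    fix r
    consider "r \<le> 0" | "r \<ge> x" | "0 < r" "r < x" by linarith
    then show "a (x - r) * b r \<le> A * (indicator {..t} r * b r)"
    proof cases
      case 3
      then show ?thesis using x a(3)[of "x - r"] b(2)[of r] by (simp add: mult_right_mono)
    next
      case 2
      then show ?thesis using a(2)[of "x - r"] A b(2)[of r] by simp
    qed (simp add: causalD(2)[OF b(1)])
  qed
  also have "\<dots> = ennreal (\<integral>r. A * (indicator {..t} r * b r) \<partial>lborel)"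
    using A b(2) by (intro nn_integral_eq_integral integrable_mult_right causalD b) auto
  finally show ?thesis by simp
qed

text \<open>
  Locally bounded causal functions. Convolution with such a function is defined at every time, and
  is again of this kind.
\<close>

definition causal_bounded :: "(real \<Rightarrow> real) \<Rightarrow> bool" where
  "causal_bounded b \<longleftrightarrow> b \<in> borel_measurable borel \<and> (\<forall>x\<le>0. b x = 0) \<and>
     (\<forall>t. \<exists>B. \<forall>x\<le>t. \<bar>b x\<bar> \<le> B)"

lemma causal_boundedD:
  assumes "causal_bounded b"
  shows "b \<in> borel_measurable borel" "x \<le> 0 \<Longrightarrow> b x = 0" "\<exists>B. \<forall>x\<le>t. \<bar>b x\<bar> \<le> B" "causal b"
  using assms by (auto simp: causal_bounded_def intro: causal_boundedI)

lemma star_integrable_causal: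
  assumes "causal a" "causal_bounded b"
  shows "integrable lborel (\<lambda>s. a (t - s) * b s)"
proof -
  obtain B where "\<forall>x\<le>t. \<bar>b x\<bar> \<le> B" using causal_boundedD(3)[OF assms(2)] by blast
  then show ?thesis
    using assms by (intro star_integrable[where B=B]) (auto dest: causal_boundedD)
qed

lemma integrable_reflect:
  fixes f :: "real \<Rightarrow> real"
  assumes "integrable lborel f"
  shows "integrable lborel (\<lambda>s. f (t - s))"
  using lborel_integrable_real_affine_iff[of "-1" f t] assms by simp

lemma star_integrable_causal':
  assumes "causal a" "causal_bounded b"
  shows "integrable lborel (\<lambda>s. b (t - s) * a s)"
  using integrable_reflect[OF star_integrable_causal[OF assms], of t t] by (simp add: mult.commute)

lemma causal_bounded_star:
  assumes a: "causal a" and b: "causal_bounded b"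
  shows "causal_bounded (a \<star> b)"
  unfolding causal_bounded_def
proof (intro conjI allI impI)
  note [measurable] = causalD(1)[OF a] causal_boundedD(1)[OF b]
  show "a \<star> b \<in> borel_measurable borel" by measurable
  show "(a \<star> b) x = 0" if "x \<le> 0" for x using a causal_boundedD(4)[OF b] that by (rule star_eq_0)
  fix t
  obtain B where B: "\<forall>x\<le>t. \<bar>b x\<bar> \<le> B" using causal_boundedD(3)[OF b] by blast
  have "B \<ge> 0" using B by (meson abs_ge_zero order_refl order_trans)
  have ai: "integrable lborel (\<lambda>s. B * \<bar>indicator {..t} s * a s\<bar>)"
    by (intro integrable_mult_right integrable_abs causalD a)
  show "\<exists>B. \<forall>x\<le>t. \<bar>(a \<star> b) x\<bar> \<le> B"
  proof (intro exI allI impI)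
    fix x assume x: "x \<le> t"
    have "norm (\<integral>s. b (x - s) * a s \<partial>lborel) \<le> (\<integral>s. B * \<bar>indicator {..t} s * a s\<bar> \<partial>lborel)"
    proof (rule Bochner_Integration.integral_norm_bound_integral[OF star_integrable_causal'[OF a b] ai])
      fix s
      show "norm (b (x - s) * a s) \<le> B * \<bar>indicator {..t} s * a s\<bar>"
      proof (cases "0 < s \<and> s < x")
        case True
        then show ?thesis using B x by (auto simp: abs_mult intro!: mult_right_mono)
      next
        case False
        then have "b (x - s) * a s = 0"
          using causalD(2)[OF a, of s] causal_boundedD(2)[OF b, of "x - s"] by auto
        then show ?thesis using \<open>B \<ge> 0\<close> by (simp only:) simp
      qed
    qed
    then show "\<bar>(a \<star> b) x\<bar> \<le> (\<integral>s. B * \<bar>indicator {..t} s * a s\<bar> \<partial>lborel)"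
      by (simp only: star_eq' real_norm_def)
  qed
qed

lemma causal_shift:
  assumes a: "causal a" and "0 \<le> h"
  shows "causal (\<lambda>x. a (x - h))"
  unfolding causal_def
proof (intro conjI allI impI)
  note [measurable] = causalD(1)[OF a]
  show "(\<lambda>x. a (x - h)) \<in> borel_measurable borel" by measurable
  show "a (x - h) = 0" if "x \<le> 0" for x using that assms by (intro causalD(2)[OF a]) auto
  fix t
  have "integrable lborel (\<lambda>s. indicator {..t - h} (- h + 1 * s) * a (- h + 1 * s))"
    using causalD(3)[OF a] by (subst lborel_integrable_real_affine_iff) auto
  moreover have "indicator {..t - h} (- h + 1 * s) = (indicator {..t} s :: real)" for s
    by (auto simp: indicator_def)
  ultimately show "integrable lborel (\<lambda>x. indicator {..t} x * a (x - h))"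
    by (simp only:) (simp add: add.commute)
qed

lemma causal_diff: "causal a \<Longrightarrow> causal b \<Longrightarrow> causal (\<lambda>x. a x - b x)"
  unfolding causal_def by (auto simp: right_diff_distrib)

lemma causal_bounded_shift:
  assumes b: "causal_bounded b" and "0 \<le> h"
  shows "causal_bounded (\<lambda>x. b (x - h))"
  unfolding causal_bounded_def
proof (intro conjI allI impI)
  note [measurable] = causal_boundedD(1)[OF b]
  show "(\<lambda>x. b (x - h)) \<in> borel_measurable borel" by measurable
  show "b (x - h) = 0" if "x \<le> 0" for x using that assms by (intro causal_boundedD(2)[OF b]) auto
  fix t
  obtain B where "\<forall>x\<le>t - h. \<bar>b x\<bar> \<le> B" using causal_boundedD(3)[OF b] by blast
  then show "\<exists>B. \<forall>x\<le>t. \<bar>b (x - h)\<bar> \<le> B" by (intro exI[of _ B]) simp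
qed

lemma causal_bounded_mult:
  assumes b: "causal_bounded b" and c: "causal_bounded c"
  shows "causal_bounded (\<lambda>x. b x * c x)"
  unfolding causal_bounded_def
proof (intro conjI allI impI)
  note [measurable] = causal_boundedD(1)[OF b] causal_boundedD(1)[OF c]
  show "(\<lambda>x. b x * c x) \<in> borel_measurable borel" by measurable
  fix t
  obtain B C where "\<forall>x\<le>t. \<bar>b x\<bar> \<le> B" "\<forall>x\<le>t. \<bar>c x\<bar> \<le> C"
    using causal_boundedD(3)[OF b, of t] causal_boundedD(3)[OF c, of t] by blast
  then show "\<exists>B. \<forall>x\<le>t. \<bar>b x * c x\<bar> \<le> B"
    by (intro exI[of _ "B * C"]) (auto simp: abs_mult intro!: mult_mono intro: order_trans[OF abs_ge_zero])
qed (auto dest: causal_boundedD(2)[OF b])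

lemma causal_bounded_diff:
  assumes b: "causal_bounded b" and c: "causal_bounded c"
  shows "causal_bounded (\<lambda>x. b x - c x)"
  unfolding causal_bounded_def
proof (intro conjI allI impI)
  note [measurable] = causal_boundedD(1)[OF b] causal_boundedD(1)[OF c]
  show "(\<lambda>x. b x - c x) \<in> borel_measurable borel" by measurable
  fix t
  obtain B C where BC: "\<forall>x\<le>t. \<bar>b x\<bar> \<le> B" "\<forall>x\<le>t. \<bar>c x\<bar> \<le> C"
    using causal_boundedD(3)[OF b, of t] causal_boundedD(3)[OF c, of t] by blast
  show "\<exists>B. \<forall>x\<le>t. \<bar>b x - c x\<bar> \<le> B"
  proof (intro exI[of _ "B + C"] allI impI)
    fix x assume "x \<le> t"
    then have "\<bar>b x\<bar> \<le> B" "\<bar>c x\<bar> \<le> C" using BC by auto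
    then show "\<bar>b x - c x\<bar> \<le> B + C" by linarith
  qed
qed (simp add: causal_boundedD(2)[OF b] causal_boundedD(2)[OF c])

lemma causal_bounded_heaviside: "causal_bounded heaviside"
  by (auto simp: causal_bounded_def indicator_def intro!: exI[of _ 1])

lemma star_shift: "(a \<star> b) (t - h) = ((\<lambda>x. a (x - h)) \<star> b) t"
  unfolding star_def by (simp add: algebra_simps)

lemma star_diff:
  assumes "causal a" "causal b" "causal_bounded c"
  shows "((\<lambda>x. a x - b x) \<star> c) t = (a \<star> c) t - (b \<star> c) t"
  unfolding star_def left_diff_distrib
  by (intro Bochner_Integration.integral_diff star_integrable_causal assms)

lemma heaviside_star_eq: "(heaviside \<star> a) t = (\<integral>s. indicator {..<t} s * a s \<partial>lborel)"
proof -
  have "heaviside (t - s) = (indicator {..<t} s :: real)" for s by (auto simp: indicator_def)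
  then show ?thesis unfolding star_def by simp
qed

lemma causal_lt_integrable:
  assumes "causal a" shows "integrable lborel (\<lambda>s. indicator {..<t} s * a s)"
proof (rule Bochner_Integration.integrable_bound[OF causalD(3)[OF assms]])
  note [measurable] = causalD(1)[OF assms]
  show "AE x in lborel. norm (indicator {..<t} x * a x) \<le> norm (indicator {..t} x * a x)"
    by (intro AE_I2) (auto simp: indicator_def)
  show "(\<lambda>s. indicator {..<t} s * a s) \<in> borel_measurable lborel" by measurable
qed

lemma heaviside_star_mono:
  assumes "causal a" "\<And>x. 0 \<le> a x" "s \<le> t"
  shows "(heaviside \<star> a) s \<le> (heaviside \<star> a) t"
  unfolding heaviside_star_eq using assms
  by (intro integral_mono causal_lt_integrable) (auto simp: indicator_def)

text \<open>
  Young's inequality in \<open>L\<^sup>1\<close> up to time \<open>T\<close>: every \<open>s > 0\<close> contributes the integral of \<open>a\<close> over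
  \<open>(0, T - s)\<close>, at most that over \<open>(0,T)\<close>.
\<close>

lemma nn_conv_integral_le:
  fixes h :: "real \<Rightarrow> ennreal"
  assumes a: "causal a" "\<And>x. 0 \<le> a x"
    and h [measurable]: "h \<in> borel_measurable borel" and h0: "\<And>x. x \<le> 0 \<Longrightarrow> h x = 0"
  shows "(\<integral>\<^sup>+t. indicator {..<T} t * (\<integral>\<^sup>+s. ennreal (a (t - s)) * h s \<partial>lborel) \<partial>lborel)
    \<le> ennreal ((heaviside \<star> a) T) * (\<integral>\<^sup>+s. h s \<partial>lborel)"
proof -
  note [measurable] = causalD(1)[OF a(1)]
  have "(\<integral>\<^sup>+t. indicator {..<T} t * (\<integral>\<^sup>+s. ennreal (a (t - s)) * h s \<partial>lborel) \<partial>lborel)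
      = (\<integral>\<^sup>+t. \<integral>\<^sup>+s. ennreal (indicator {..<T} t * a (t - s)) * h s \<partial>lborel \<partial>lborel)"
    by (intro nn_integral_cong) (simp add: indicator_def)
  also have "\<dots> = (\<integral>\<^sup>+s. \<integral>\<^sup>+t. ennreal (indicator {..<T} t * a (t - s)) * h s \<partial>lborel \<partial>lborel)"
    by (rule lborel_pair.Fubini') measurable
  also have "\<dots> \<le> (\<integral>\<^sup>+s. ennreal ((heaviside \<star> a) T) * h s \<partial>lborel)"
  proof (rule nn_integral_mono)
    fix s
    show "(\<integral>\<^sup>+t. ennreal (indicator {..<T} t * a (t - s)) * h s \<partial>lborel) \<le> ennreal ((heaviside \<star> a) T) * h s"
    proof (cases "0 < s")
      case True
      have "(\<integral>\<^sup>+t. ennreal (indicator {..<T} t * a (t - s)) \<partial>lborel)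
          = (\<integral>\<^sup>+x. ennreal (indicator {..<T} (s + 1 * x) * a ((s + 1 * x) - s)) \<partial>lborel)"
        by (subst nn_integral_real_affine[where c=1 and t=s]) auto
      also have "\<dots> \<le> (\<integral>\<^sup>+x. ennreal (indicator {..<T} x * a x) \<partial>lborel)"
        using a(2) True by (intro nn_integral_mono ennreal_leI) (auto simp: indicator_def)
      also have "\<dots> = ennreal ((heaviside \<star> a) T)"
        unfolding heaviside_star_eq using a by (intro nn_integral_eq_integral causal_lt_integrable) auto
      finally show ?thesis by (simp add: nn_integral_multc mult_right_mono)
    qed (simp add: h0)
  qed
  also have "\<dots> = ennreal ((heaviside \<star> a) T) * (\<integral>\<^sup>+s. h s \<partial>lborel)"
    by (rule nn_integral_cmult) measurable
  finally show ?thesis .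
qed

section \<open>Completely positive kernel pairs\<close>

text \<open>
  The pairs \<open>(k,l)\<close> of the theorem, normalised to vanish on \<open>(-\<infinity>,0]\<close>. The hypotheses are symmetric
  in \<open>k\<close> and \<open>l\<close>.
\<close>

locale kernel_pair =
  fixes k l :: "real \<Rightarrow> real"
  assumes k: "causal k" "\<And>x. 0 \<le> k x" "\<And>x y. 0 < x \<Longrightarrow> x \<le> y \<Longrightarrow> k y \<le> k x"
    and l: "causal l" "\<And>x. 0 \<le> l x" "\<And>x y. 0 < x \<Longrightarrow> x \<le> y \<Longrightarrow> l y \<le> l x"
    and kl: "\<And>t. 0 < t \<Longrightarrow> (k \<star> l) t = 1"
begin

lemmas [measurable] = causalD(1)[OF k(1)] causalD(1)[OF l(1)]

text \<open>
  The primitive of \<open>l\<close>, which is the weight in the energy inequality.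
\<close>

definition L :: "real \<Rightarrow> real" where "L = heaviside \<star> l"

lemma L_eq: "L t = (\<integral>s. indicator {..<t} s * l s \<partial>lborel)"
  unfolding L_def by (rule heaviside_star_eq)

lemmas l_integrable = causal_lt_integrable[OF l(1)]

lemma L_nonneg: "0 \<le> L t"
  unfolding L_eq using l(2) by (intro Bochner_Integration.integral_nonneg) auto

lemma L_mono: "s \<le> t \<Longrightarrow> L s \<le> L t"
  unfolding L_eq using l(2) by (intro integral_mono l_integrable) (auto simp: indicator_def)

lemma L_0: "t \<le> 0 \<Longrightarrow> L t = 0"
  unfolding L_def by (intro star_eq_0 causal_heaviside l)

lemma L_measurable [measurable]: "L \<in> borel_measurable borel"
  unfolding L_def by measurable

lemma causal_bounded_L: "causal_bounded L"
  unfolding causal_bounded_def using L_mono L_nonneg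
  by (auto simp: L_0 intro!: exI[of _ "L t" for t])

lemmas causal_L = causal_boundedD(4)[OF causal_bounded_L]

lemma l_shift_integrable: "0 \<le> \<tau> \<Longrightarrow> integrable lborel (\<lambda>s. indicator {..<t} s * l (s - \<tau>))"
  by (rule causal_lt_integrable[OF causal_shift[OF l(1)]])

lemma L_shift_eq: "L (t - \<tau>) = (\<integral>s. indicator {..<t} s * l (s - \<tau>) \<partial>lborel)"
proof -
  have "indicator {..<t - \<tau>} (- \<tau> + 1 * s) = (indicator {..<t} s :: real)" for s
    by (auto simp: indicator_def)
  then show ?thesis
    unfolding L_eq by (subst lborel_integral_real_affine[where c=1 and t="-\<tau>"]) (simp_all add: add.commute)
qed

text \<open>
  Translating a nonincreasing kernel by \<open>\<tau>\<close> changes it by at most twice its mass on \<open>(0,\<tau>)\<close>: there the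
  translate vanishes, and beyond \<open>\<tau>\<close> the difference has a sign.
\<close>

lemma l_variation:
  assumes "0 < \<tau>"
  shows "integrable lborel (\<lambda>s. indicator {..<t} s * \<bar>l s - l (s - \<tau>)\<bar>)"
    and "(\<integral>s. indicator {..<t} s * \<bar>l s - l (s - \<tau>)\<bar> \<partial>lborel) \<le> 2 * L \<tau>"
proof -
  \<comment> \<open>The absolute difference with the sign it has beyond \<open>\<tau>\<close>, corrected on \<open>(0,\<tau>)\<close>; at \<open>\<tau>\<close> itself the bound may fail.\<close>
  let ?r = "\<lambda>s. indicator {..<t} s * l (s - \<tau>) - indicator {..<t} s * l s + 2 * (indicator {..<\<tau>} s * l s)"
  have int: "integrable lborel ?r"
    by (intro Bochner_Integration.integrable_add Bochner_Integration.integrable_diff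
        l_shift_integrable l_integrable integrable_mult_right less_imp_le[OF assms])
  have le: "indicator {..<t} s * \<bar>l s - l (s - \<tau>)\<bar> \<le> ?r s" if "s \<noteq> \<tau>" for s
  proof (cases "s < \<tau>")
    case True
    then show ?thesis using causalD(2)[OF l(1), of "s - \<tau>"] l(2)[of s] by (auto simp: indicator_def)
  next
    case False
    then have "l s \<le> l (s - \<tau>)" using that assms by (intro l(3)) auto
    then show ?thesis using False by (auto simp: indicator_def)
  qed
  have ae: "AE s in lborel. indicator {..<t} s * \<bar>l s - l (s - \<tau>)\<bar> \<le> ?r s"
    using AE_lborel_singleton[of \<tau>] by eventually_elim (use le in auto)
  show i: "integrable lborel (\<lambda>s. indicator {..<t} s * \<bar>l s - l (s - \<tau>)\<bar>)"
  proof (rule Bochner_Integration.integrable_bound[OF int])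
    show "AE x in lborel. norm (indicator {..<t} x * \<bar>l x - l (x - \<tau>)\<bar>) \<le> norm (?r x)"
      using ae by eventually_elim (auto simp: abs_mult)
  qed measurable
  have "(\<integral>s. indicator {..<t} s * \<bar>l s - l (s - \<tau>)\<bar> \<partial>lborel) \<le> (\<integral>s. ?r s \<partial>lborel)"
    by (rule integral_mono_AE[OF i int ae])
  also have "\<dots> = L (t - \<tau>) - L t + 2 * L \<tau>"
    unfolding L_shift_eq L_eq[of t] L_eq[of \<tau>]
    using Bochner_Integration.integral_add[OF
        Bochner_Integration.integrable_diff[OF l_shift_integrable[of \<tau> t, OF less_imp_le[OF assms]] l_integrable[of t]]
        integrable_mult_right[OF l_integrable[of \<tau>], of 2]]
      Bochner_Integration.integral_diff[OF l_shift_integrable[of \<tau> t, OF less_imp_le[OF assms]] l_integrable[of t]] by simp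
  also have "\<dots> \<le> 2 * L \<tau>" using L_mono[of "t - \<tau>" t] assms by simp
  finally show "(\<integral>s. indicator {..<t} s * \<bar>l s - l (s - \<tau>)\<bar> \<partial>lborel) \<le> 2 * L \<tau>" .
qed

text \<open>
  The primitive of a nonincreasing function is concave, hence subadditive.
\<close>

lemma L_subadditive:
  assumes "0 \<le> \<tau>" shows "L (t + \<tau>) \<le> L t + L \<tau>"
proof (cases "\<tau> = 0")
  case False
  have "L (t + \<tau>) - L (t + \<tau> - \<tau>) = (\<integral>s. indicator {..<t + \<tau>} s * l s - indicator {..<t + \<tau>} s * l (s - \<tau>) \<partial>lborel)"
    unfolding L_shift_eq L_eq[of "t + \<tau>"]
    by (intro Bochner_Integration.integral_diff[symmetric] l_shift_integrable l_integrable assms)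
  also have "\<dots> \<le> (\<integral>s. indicator {..<\<tau>} s * l s \<partial>lborel)"
  proof (rule integral_mono_AE)
    show "AE s in lborel. indicator {..<t + \<tau>} s * l s - indicator {..<t + \<tau>} s * l (s - \<tau>) \<le> indicator {..<\<tau>} s * l s"
      using AE_lborel_singleton[of \<tau>]
    proof eventually_elim
      case (elim s)
      show ?case
      proof (cases "s < \<tau>")
        case True
        then show ?thesis using causalD(2)[OF l(1), of "s - \<tau>"] l(2)[of s] by (auto simp: indicator_def)
      next
        case c: False
        then have "l s \<le> l (s - \<tau>)" using elim assms False by (intro l(3)) auto
        then show ?thesis using c by (auto simp: indicator_def)
      qed
    qed
  qed (intro Bochner_Integration.integrable_diff l_shift_integrable l_integrable assms)+
  finally show ?thesis by (simp add: L_eq)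
qed (use L_nonneg in \<open>simp add: L_0\<close>)

text \<open>
  On \<open>(0,\<tau>)\<close> the kernel \<open>k (\<tau> - s)\<close> is at least \<open>k \<tau>\<close>, so \<open>k \<tau> L \<tau> \<le> (k * l) \<tau> = 1\<close>. This balances
  the singularity of \<open>k\<close> at \<open>0\<close> against the smallness of \<open>L\<close>.
\<close>

lemma k_L_le_1:
  assumes "0 < \<tau>" shows "k \<tau> * L \<tau> \<le> 1"
proof -
  have int: "integrable lborel (\<lambda>s. k (\<tau> - s) * l s)"
    using kl[OF assms] not_integrable_integral_eq unfolding star_def by fastforce
  have "k \<tau> * L \<tau> = (\<integral>s. k \<tau> * (indicator {..<\<tau>} s * l s) \<partial>lborel)"
    by (simp add: L_eq)
  also have "\<dots> \<le> (\<integral>s. k (\<tau> - s) * l s \<partial>lborel)"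
  proof (rule integral_mono[OF _ int])
    fix s
    consider "s \<le> 0" | "s \<ge> \<tau>" | "0 < s" "s < \<tau>" by linarith
    then show "k \<tau> * (indicator {..<\<tau>} s * l s) \<le> k (\<tau> - s) * l s"
    proof cases
      case 3
      then have "k \<tau> \<le> k (\<tau> - s)" by (intro k(3)) auto
      then show ?thesis using 3 l(2)[of s] by (simp add: mult_right_mono)
    qed (use causalD(2)[OF l(1)] causalD(2)[OF k(1)] in auto)
  qed (intro integrable_mult_right l_integrable)
  finally show ?thesis using kl[OF assms] by (simp add: star_def)
qed

lemma L_tendsto_0: "(\<lambda>n. L (1 / real (Suc n))) \<longlonglongrightarrow> 0"
proof -
  have "(\<lambda>n. \<integral>s. indicator {..<1 / real (Suc n)} s * l s \<partial>lborel) \<longlonglongrightarrow> (\<integral>(s::real). 0 \<partial>lborel)"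
  proof (rule integral_dominated_convergence[where w="\<lambda>s. indicator {..<2} s * l s"])
    show "AE s in lborel. (\<lambda>n. indicator {..<1 / real (Suc n)} s * l s) \<longlonglongrightarrow> 0"
    proof (rule AE_I2)
      fix s :: real
      show "(\<lambda>n. indicator {..<1 / real (Suc n)} s * l s) \<longlonglongrightarrow> 0"
      proof (cases "s \<le> 0")
        case False
        have "\<forall>\<^sub>F n in sequentially. 1 / real (Suc n) < s"
          by (rule order_tendstoD(2)[OF LIMSEQ_Suc[OF lim_1_over_n]]) (use False in auto)
        then have "\<forall>\<^sub>F n in sequentially. indicator {..<1 / real (Suc n)} s * l s = 0"
          by eventually_elim (simp add: indicator_def)
        then show ?thesis by (rule tendsto_eventually)
      qed (simp add: causalD(2)[OF l(1)])
    qed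
    show "AE s in lborel. norm (indicator {..<1 / real (Suc n)} s * l s) \<le> indicator {..<2} s * l s" for n
    proof (rule AE_I2)
      fix s
      have "1 / real (Suc n) < 2" by (simp add: divide_less_eq)
      then show "norm (indicator {..<1 / real (Suc n)} s * l s) \<le> indicator {..<2} s * l s"
        using l(2)[of s] by (auto simp: indicator_def)
    qed
  qed (auto intro: l_integrable)
  then show ?thesis by (simp add: L_eq)
qed

lemma nn_kl: "(\<integral>\<^sup>+r. ennreal (k (x - r) * l r) \<partial>lborel) \<le> ennreal 1"
proof (cases "0 < x")
  case True
  have int: "integrable lborel (\<lambda>s. k (x - s) * l s)"
    using kl[OF True] not_integrable_integral_eq unfolding star_def by fastforce
  then have "(\<integral>\<^sup>+r. ennreal (k (x - r) * l r) \<partial>lborel) = ennreal ((k \<star> l) x)"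
    unfolding star_def using k(2) l(2) by (intro nn_integral_eq_integral) auto
  then show ?thesis using kl[OF True] by simp
next
  case False
  have "ennreal (k (x - r) * l r) = 0" for r
    using False causalD(2)[OF k(1), of "x - r"] causalD(2)[OF l(1), of r] by (cases "r \<le> 0") auto
  then show ?thesis by (simp only:) simp
qed

lemma kl_heaviside: "k \<star> l = heaviside" "l \<star> k = heaviside"
proof -
  have "(k \<star> l) t = heaviside t" for t
    using kl[of t] star_eq_0[OF k(1) l(1), of t] by (cases "0 < t") auto
  then show "k \<star> l = heaviside" by auto
  then show "l \<star> k = heaviside" by (metis star_commute ext)
qed

lemma k_l_star: "causal g \<Longrightarrow> (k \<star> (l \<star> g)) t = (heaviside \<star> g) t"
  using star_assoc[OF k(1,2) l(1,2), of g t 1] nn_kl by (simp add: kl_heaviside)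

lemma l_k_star: "causal g \<Longrightarrow> (l \<star> (k \<star> g)) t = (heaviside \<star> g) t"
  using star_assoc[OF l(1,2) k(1,2), of g t 1] nn_kl
  by (simp add: kl_heaviside nn_star_commute[of l k])

lemma heaviside_star_assoc:
  assumes "causal b" "\<And>x. 0 \<le> b x" "causal c"
  shows "(heaviside \<star> (b \<star> c)) t = ((heaviside \<star> b) \<star> c) t"
proof (rule star_assoc[OF causal_heaviside _ assms])
  show "(\<integral>\<^sup>+r. ennreal (heaviside (x - r) * b r) \<partial>lborel) \<le> ennreal (1 * (\<integral>r. indicator {..t} r * b r \<partial>lborel))"
    if "x \<le> t" for x
    by (rule nn_star_bound) (use assms that in \<open>auto simp: indicator_def\<close>)
qed auto

lemma L_k: "L \<star> k = heaviside \<star> heaviside"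
  unfolding L_def using heaviside_star_assoc[OF l(1,2) k(1)] kl_heaviside by fastforce

text \<open>
  As \<open>L * k = 1 * l * k = 1 * 1\<close>, integrating \<open>k * q\<close> against the weight \<open>L (T - t)\<close> removes the kernel
  altogether.
\<close>

lemma L_k_star:
  assumes q: "causal q"
  shows "(L \<star> (k \<star> q)) t = (heaviside \<star> (heaviside \<star> q)) t"
proof -
  have "(L \<star> (k \<star> q)) t = ((L \<star> k) \<star> q) t"
  proof (rule star_assoc[OF causal_L L_nonneg k(1,2) q])
    show "(\<integral>\<^sup>+r. ennreal (L (x - r) * k r) \<partial>lborel) \<le> ennreal (L t * (\<integral>r. indicator {..t} r * k r \<partial>lborel))"
      if "x \<le> t" for x
      by (rule nn_star_bound) (use k that L_mono L_nonneg L_0 in auto)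
  qed
  also have "\<dots> = (heaviside \<star> (heaviside \<star> q)) t"
    unfolding L_k by (subst heaviside_star_assoc[OF causal_heaviside _ q]) auto
  finally show ?thesis .
qed

lemma l_heaviside_star:
  assumes g: "causal g"
  shows "(l \<star> (heaviside \<star> g)) t = (heaviside \<star> (l \<star> g)) t" "(heaviside \<star> (l \<star> g)) t = (L \<star> g) t"
proof -
  show *: "(heaviside \<star> (l \<star> g)) t = (L \<star> g) t" for t
    unfolding L_def by (rule heaviside_star_assoc[OF l(1,2) g])
  have "(l \<star> (heaviside \<star> g)) t = ((l \<star> heaviside) \<star> g) t"
  proof (rule star_assoc[OF l(1,2) causal_heaviside _ g])
    show "(\<integral>\<^sup>+r. ennreal (l (x - r) * heaviside r) \<partial>lborel) \<le> ennreal (1 * (\<integral>r. indicator {..t} r * l r \<partial>lborel))"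
      if "x \<le> t" for x
      by (subst nn_star_commute, measurable, rule nn_star_bound) (use l that in \<open>auto simp: indicator_def\<close>)
  qed auto
  also have "l \<star> heaviside = L" unfolding L_def using star_commute by fastforce
  finally show "(l \<star> (heaviside \<star> g)) t = (heaviside \<star> (l \<star> g)) t" by (simp add: *)
qed

end

section \<open>The energy inequality for bounded forcing\<close>

text \<open>
  A bounded right-hand side \<open>g\<close>, for which \<open>z = l * g\<close> is defined everywhere and has an explicit
  modulus of continuity.
\<close>

locale bounded_forcing = kernel_pair +
  fixes g :: "real \<Rightarrow> real" and G :: real
  assumes g: "g \<in> borel_measurable borel" "\<And>x. x \<le> 0 \<Longrightarrow> g x = 0" "\<And>x. \<bar>g x\<bar> \<le> G"
begin

lemmas [measurable] = g(1)

lemma G_nonneg: "0 \<le> G" using g(3)[of 0] by linarith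

lemma causal_bounded_g: "causal_bounded g"
  unfolding causal_bounded_def using g by blast

definition z :: "real \<Rightarrow> real" where "z = l \<star> g"

lemma causal_bounded_z: "causal_bounded z"
  unfolding z_def by (rule causal_bounded_star[OF l(1) causal_bounded_g])

lemmas [measurable] = causal_boundedD(1)[OF causal_bounded_z]
lemmas z_0 = causal_boundedD(2)[OF causal_bounded_z]

lemma z_le: "\<bar>z t\<bar> \<le> G * L t"
proof -
  have "norm (\<integral>x. g (t - x) * l x \<partial>lborel) \<le> (\<integral>x. G * (indicator {..<t} x * l x) \<partial>lborel)"
  proof (rule Bochner_Integration.integral_norm_bound_integral)
    show "norm (g (t - x) * l x) \<le> G * (indicator {..<t} x * l x)" for x
      using g(2)[of "t - x"] g(3)[of "t - x"] l(2)[of x] G_nonneg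
      by (cases "x < t") (auto simp: abs_mult mult_right_mono)
  qed (intro star_integrable_causal' l causal_bounded_g integrable_mult_right l_integrable)+
  then show ?thesis by (simp add: z_def star_eq' L_eq)
qed

lemma z_le_const: "t \<le> T \<Longrightarrow> \<bar>z t\<bar> \<le> G * L T"
  using z_le[of t] L_mono[of t T] G_nonneg by (meson mult_left_mono order_trans)

text \<open>
  The variation of \<open>l\<close> under translation bounds the increments of \<open>l * g\<close>, whatever the
  regularity of \<open>g\<close>.
\<close>

lemma z_modulus:
  assumes "0 < \<tau>"
  shows "\<bar>z t - z (t - \<tau>)\<bar> \<le> 2 * G * L \<tau>"
proof -
  note sh = causal_shift[OF l(1) less_imp_le[OF assms]]
  have eq: "z t - z (t - \<tau>) = (\<integral>x. g (t - x) * (l x - l (x - \<tau>)) \<partial>lborel)"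
    unfolding z_def star_shift star_diff[OF l(1) sh causal_bounded_g, symmetric] by (rule star_eq')
  have "norm (\<integral>x. g (t - x) * (l x - l (x - \<tau>)) \<partial>lborel)
      \<le> (\<integral>x. G * (indicator {..<t} x * \<bar>l x - l (x - \<tau>)\<bar>) \<partial>lborel)"
  proof (rule Bochner_Integration.integral_norm_bound_integral)
    show "norm (g (t - x) * (l x - l (x - \<tau>))) \<le> G * (indicator {..<t} x * \<bar>l x - l (x - \<tau>)\<bar>)" for x
      using g(2)[of "t - x"] g(3)[of "t - x"] G_nonneg
      by (cases "x < t") (auto simp: abs_mult mult_right_mono)
    show "integrable lborel (\<lambda>x. g (t - x) * (l x - l (x - \<tau>)))"
      by (rule star_integrable_causal'[OF causal_diff[OF l(1) sh] causal_bounded_g])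
  qed (intro integrable_mult_right l_variation assms)+
  also have "\<dots> \<le> G * (2 * L \<tau>)"
    using l_variation(2)[OF assms] G_nonneg by (simp add: mult_left_mono)
  finally show ?thesis by (simp add: eq)
qed

lemma k_z: "(k \<star> z) t = (heaviside \<star> g) t"
  unfolding z_def by (rule k_l_star[OF causal_boundedD(4)[OF causal_bounded_g]])

text \<open>
  The increment of \<open>1 * g = k * z\<close> over a time step \<open>h\<close>; it approximates \<open>h g\<close>.
\<close>

definition D :: "real \<Rightarrow> real \<Rightarrow> real" where
  "D h t = (heaviside \<star> g) t - (heaviside \<star> g) (t - h)"

abbreviation q :: "real \<Rightarrow> real" where "q \<equiv> \<lambda>x. z x * z x"

lemma causal_bounded_q: "causal_bounded q"
  by (intro causal_bounded_mult causal_bounded_z)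

lemma causal_bounded_D: "0 \<le> h \<Longrightarrow> causal_bounded (D h)"
  unfolding D_def[abs_def]
  by (intro causal_bounded_diff causal_bounded_shift causal_bounded_star causal_heaviside causal_bounded_g)

text \<open>
  A discrete form of the chain rule inequality \<open>\<partial>\<^sub>t(k * z) z \<ge> 1/2 \<partial>\<^sub>t(k * z\<^sup>2)\<close>. The kernel
  \<open>\<kappa> x = k x - k (x - h)\<close> has total mass \<open>\<ge> 0\<close> on \<open>(0,t)\<close>, so that the terms with \<open>(z t)\<^sup>2\<close> may be dropped;
  the error \<open>2 G\<^sup>2 h L h\<close> comes from the interval \<open>(0,h)\<close> on which \<open>\<kappa>\<close> is positive.
\<close>

lemma pointwise_lower_bound:
  assumes h: "0 < h"
  shows "((k \<star> q) t - (k \<star> q) (t - h)) / 2 - 2 * G\<^sup>2 * h * L h \<le> D h t * z t"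
proof -
  define \<kappa> where "\<kappa> x = k x - k (x - h)" for x
  note sh = causal_shift[OF k(1) less_imp_le[OF h]]
  have \<kappa>: "causal \<kappa>" unfolding \<kappa>_def[abs_def] by (rule causal_diff[OF k(1) sh])
  have star_\<kappa>: "(\<kappa> \<star> c) t = (k \<star> c) t - (k \<star> c) (t - h)" if "causal_bounded c" for c
    unfolding \<kappa>_def[abs_def] star_shift by (rule star_diff[OF k(1) sh that])
  have "D h t = (\<kappa> \<star> z) t"
    by (simp add: D_def star_\<kappa> causal_bounded_z k_z)
  then have D: "D h t * z t = (\<integral>x. z (t - x) * \<kappa> x * z t \<partial>lborel)"
    by (simp add: star_eq')
  have int1: "integrable lborel (\<lambda>x. z (t - x) * \<kappa> x * z t)"
    by (intro integrable_mult_left star_integrable_causal' \<kappa> causal_bounded_z)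
  have int2: "integrable lborel (\<lambda>x. (z t)\<^sup>2 / 2 * (heaviside (t - x) * \<kappa> x))"
    by (intro integrable_mult_right star_integrable_causal' \<kappa> causal_bounded_heaviside)
  have int3: "integrable lborel (\<lambda>x. 1 / 2 * (q (t - x) * \<kappa> x))"
    by (intro integrable_mult_right star_integrable_causal'[OF \<kappa> causal_bounded_q])
  have int4: "integrable lborel (\<lambda>x. 2 * G\<^sup>2 * L h * indicator {0..h} x)"
    by (rule integrable_const_Icc)
  let ?lb = "\<lambda>x. (z t)\<^sup>2 / 2 * (heaviside (t - x) * \<kappa> x) + 1 / 2 * (q (t - x) * \<kappa> x)
    - 2 * G\<^sup>2 * L h * indicator {0..h} x"
  have "(\<integral>x. ?lb x \<partial>lborel) \<le> (\<integral>x. z (t - x) * \<kappa> x * z t \<partial>lborel)"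
  proof (rule integral_mono[OF _ int1])
    show "integrable lborel ?lb"
      by (intro Bochner_Integration.integrable_add Bochner_Integration.integrable_diff int2 int3 int4)
    fix x
    have err: "0 \<le> 2 * G\<^sup>2 * L h * indicator {0..h} x" using L_nonneg[of h] by simp
    have sq: "z (t - x) * \<kappa> x * z t = (z t)\<^sup>2 / 2 * \<kappa> x + 1 / 2 * (q (t - x) * \<kappa> x)
        - \<kappa> x / 2 * (z t - z (t - x))\<^sup>2"
      by (simp add: power2_eq_square field_simps)
    \<comment> \<open>Near \<open>0\<close> the error term is needed, beyond \<open>h\<close> the sign of \<open>\<kappa>\<close>; beyond \<open>t\<close> the function \<open>z (t - x)\<close> vanishes.\<close>
    consider "x \<le> 0" | "0 < x" "x \<le> h" "x < t" | "0 < x" "t \<le> x" "x \<le> h" | "h < x" "x < t" | "h < x" "t \<le> x"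
      by linarith
    then show "?lb x \<le> z (t - x) * \<kappa> x * z t"
    proof cases
      case 1
      then have "\<kappa> x = 0" using causalD(2)[OF \<kappa>] by blast
      then show ?thesis using err by simp
    next
      case 2
      have \<kappa>x: "\<kappa> x = k x" using 2 causalD(2)[OF k(1), of "x - h"] by (simp add: \<kappa>_def)
      have "\<bar>z t - z (t - x)\<bar>\<^sup>2 \<le> (2 * G * L x)\<^sup>2"
        by (intro power_mono z_modulus 2) auto
      then have "k x * (z t - z (t - x))\<^sup>2 \<le> k x * (2 * G * L x)\<^sup>2"
        using k(2)[of x] by (intro mult_left_mono) auto
      also have "\<dots> = 4 * G\<^sup>2 * L x * (k x * L x)"
        by (simp add: power2_eq_square)
      also have "\<dots> \<le> 4 * G\<^sup>2 * L x * 1"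
        using k_L_le_1[OF 2(1)] L_nonneg[of x] by (intro mult_left_mono) auto
      also have "\<dots> \<le> 4 * G\<^sup>2 * L h"
        using L_mono[OF 2(2)] by (simp add: mult_left_mono)
      finally show ?thesis using 2 unfolding \<kappa>x sq[unfolded \<kappa>x] by simp
    next
      case 3
      then show ?thesis using err z_0[of "t - x"] by simp
    next
      case 4
      then have "\<kappa> x \<le> 0" using h unfolding \<kappa>_def by (simp add: k(3))
      then have "\<kappa> x / 2 * (z t - z (t - x))\<^sup>2 \<le> 0" by (simp add: mult_nonpos_nonneg)
      then show ?thesis using 4 h by (simp add: sq)
    next
      case 5
      then show ?thesis using z_0[of "t - x"] by simp
    qed
  qed
  also have "(\<integral>x. ?lb x \<partial>lborel) = (z t)\<^sup>2 / 2 * (\<kappa> \<star> heaviside) t + 1 / 2 * (\<kappa> \<star> q) t - 2 * G\<^sup>2 * L h * h"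
  proof -
    have "(\<integral>x. ?lb x \<partial>lborel) = (\<integral>x. (z t)\<^sup>2 / 2 * (heaviside (t - x) * \<kappa> x) \<partial>lborel)
      + (\<integral>x. 1 / 2 * (q (t - x) * \<kappa> x) \<partial>lborel) - (\<integral>x. 2 * G\<^sup>2 * L h * indicator {0..h} x \<partial>lborel)"
      by (simp only: Bochner_Integration.integral_diff[OF Bochner_Integration.integrable_add[OF int2 int3] int4]
          Bochner_Integration.integral_add[OF int2 int3])
    then show ?thesis
      using h by (simp add: star_eq')
  qed
  finally have "(z t)\<^sup>2 / 2 * (\<kappa> \<star> heaviside) t + 1 / 2 * (\<kappa> \<star> q) t - 2 * G\<^sup>2 * L h * h \<le> D h t * z t"
    by (simp add: D)
  moreover have "0 \<le> (\<kappa> \<star> heaviside) t"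
    unfolding star_\<kappa>[OF causal_bounded_heaviside] star_commute[of k heaviside]
    using heaviside_star_mono[OF k(1,2), of "t - h" t] h by simp
  then have "0 \<le> (z t)\<^sup>2 / 2 * (\<kappa> \<star> heaviside) t" by simp
  ultimately show ?thesis
    by (simp add: star_\<kappa>[OF causal_bounded_q] algebra_simps)
qed

abbreviation Y :: "real \<Rightarrow> real" where "Y \<equiv> heaviside \<star> q"

lemma causal_bounded_Y: "causal_bounded Y"
  by (rule causal_bounded_star[OF causal_heaviside causal_bounded_q])

lemma Y_mono: "s \<le> t \<Longrightarrow> Y s \<le> Y t"
  by (rule heaviside_star_mono[OF causal_boundedD(4)[OF causal_bounded_q]]) auto

lemma Y_increment: 
  assumes h: "0 < h" "h \<le> T"
  shows "Y T - Y (T - h) \<le> h * (G * L T)\<^sup>2"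
proof -
  have i: "integrable lborel (\<lambda>s. indicator {..<r} s * q s)" for r
    by (rule causal_lt_integrable[OF causal_boundedD(4)[OF causal_bounded_q]])
  have "Y T - Y (T - h) = (\<integral>s. indicator {..<T} s * q s - indicator {..<T - h} s * q s \<partial>lborel)"
    unfolding heaviside_star_eq by (rule Bochner_Integration.integral_diff[OF i i, symmetric])
  also have "\<dots> \<le> (\<integral>s. (G * L T)\<^sup>2 * indicator {T - h..T} s \<partial>lborel)"
  proof (rule integral_mono)
    fix s
    have "q s \<le> (G * L T)\<^sup>2" if "s \<le> T"
      using power_mono[OF z_le_const[OF that] abs_ge_zero, of 2] by (simp add: power2_eq_square)
    then show "indicator {..<T} s * q s - indicator {..<T - h} s * q s \<le> (G * L T)\<^sup>2 * indicator {T - h..T} s"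
      using h by (auto simp: indicator_def)
  qed (intro Bochner_Integration.integrable_diff i integrable_const_Icc)+
  also have "\<dots> = h * (G * L T)\<^sup>2" using h by simp
  finally show ?thesis .
qed

text \<open>
  The pointwise bound integrated against \<open>L (T - t)\<close>: the increment of \<open>L * k * q = 1 * Y\<close> over
  \<open>(T - h, T)\<close> is at least \<open>h Y (T - h)\<close>, as \<open>Y\<close> is nondecreasing.
\<close>

lemma integrated_lower_bound:
  assumes h: "0 < h" "h \<le> T"
  shows "h * Y (T - h) / 2 - 2 * G\<^sup>2 * h * L h * L T * T \<le> (L \<star> (\<lambda>t. D h t * z t)) T"
proof -
  have kq: "causal_bounded (k \<star> q)" by (rule causal_bounded_star[OF k(1) causal_bounded_q])
  have kqs: "causal_bounded (\<lambda>t. (k \<star> q) (t - h))" by (rule causal_bounded_shift[OF kq]) (use h in simp)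
  let ?e = "2 * G\<^sup>2 * h * L h"
  have e0: "0 \<le> ?e" using h L_nonneg by simp
  let ?lb = "\<lambda>t. 1 / 2 * (L (T - t) * (k \<star> q) t) - 1 / 2 * (L (T - t) * (k \<star> q) (t - h)) - ?e * L T * indicator {0..T} t"
  have i1: "integrable lborel (\<lambda>t. 1 / 2 * (L (T - t) * (k \<star> q) t))"
    and i2: "integrable lborel (\<lambda>t. 1 / 2 * (L (T - t) * (k \<star> q) (t - h)))"
    by (intro integrable_mult_right star_integrable_causal[OF causal_L kq] star_integrable_causal[OF causal_L kqs])+
  have i3: "integrable lborel (\<lambda>t. ?e * L T * indicator {0..T} t)"
    by (rule integrable_const_Icc)
  have "(\<integral>t. ?lb t \<partial>lborel) \<le> (\<integral>t. L (T - t) * (D h t * z t) \<partial>lborel)"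
  proof (rule integral_mono)
    show "integrable lborel ?lb"
      by (intro Bochner_Integration.integrable_diff i1 i2 i3)
    show "integrable lborel (\<lambda>t. L (T - t) * (D h t * z t))"
      using h by (intro star_integrable_causal[OF causal_L] causal_bounded_mult causal_bounded_D causal_bounded_z) auto
    fix t
    consider "t \<le> 0" | "T < t" | "0 < t" "t \<le> T" by linarith
    then show "?lb t \<le> L (T - t) * (D h t * z t)"
    proof cases
      case 1
      then show ?thesis
        using causal_boundedD(2)[OF kq, of t] causal_boundedD(2)[OF kqs, of t] z_0[of t] e0 L_nonneg[of T] by simp
    next
      case 2
      then show ?thesis using L_0[of "T - t"] e0 L_nonneg[of T] by simp
    next
      case 3
      have "L (T - t) * (((k \<star> q) t - (k \<star> q) (t - h)) / 2 - ?e) \<le> L (T - t) * (D h t * z t)"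
        by (intro mult_left_mono pointwise_lower_bound h L_nonneg)
      moreover have "L (T - t) * ?e \<le> L T * ?e"
        using 3 e0 by (intro mult_right_mono L_mono) auto
      ultimately show ?thesis using 3 by (simp add: field_simps)
    qed
  qed
  also have "(\<integral>t. ?lb t \<partial>lborel) = 1 / 2 * (L \<star> (k \<star> q)) T - 1 / 2 * (\<integral>t. L (T - t) * (k \<star> q) (t - h) \<partial>lborel) - ?e * L T * T"
  proof -
    have "(\<integral>t. ?lb t \<partial>lborel) = (\<integral>t. 1 / 2 * (L (T - t) * (k \<star> q) t) \<partial>lborel)
        - (\<integral>t. 1 / 2 * (L (T - t) * (k \<star> q) (t - h)) \<partial>lborel) - (\<integral>t. ?e * L T * indicator {0..T} t \<partial>lborel)"
      by (simp only: Bochner_Integration.integral_diff[OF Bochner_Integration.integrable_diff[OF i1 i2] i3]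
          Bochner_Integration.integral_diff[OF i1 i2])
    then show ?thesis using h by (simp add: star_def[of L])
  qed
  also have "(\<integral>t. L (T - t) * (k \<star> q) (t - h) \<partial>lborel) = (L \<star> (k \<star> q)) (T - h)"
    unfolding star_def[of L]
    by (subst lborel_integral_real_affine[where c=1 and t=h]) (simp_all add: algebra_simps)
  finally have upper: "1 / 2 * (L \<star> (k \<star> q)) T - 1 / 2 * (L \<star> (k \<star> q)) (T - h) - ?e * L T * T
      \<le> (L \<star> (\<lambda>t. D h t * z t)) T"
    by (simp only: star_def[of L "\<lambda>t. D h t * z t"])
  moreover have "1 / 2 * (L \<star> (k \<star> q)) T - 1 / 2 * (L \<star> (k \<star> q)) (T - h) \<ge> h * Y (T - h) / 2"
  proof -
    note Yc = causal_boundedD(4)[OF causal_bounded_Y]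
    have "h * Y (T - h) = (\<integral>s. Y (T - h) * indicator {T - h..<T} s \<partial>lborel)" using h by simp
    also have "\<dots> \<le> (\<integral>s. indicator {..<T} s * Y s - indicator {..<T - h} s * Y s \<partial>lborel)"
    proof (rule integral_mono)
      show "Y (T - h) * indicator {T - h..<T} s \<le> indicator {..<T} s * Y s - indicator {..<T - h} s * Y s" for s
        using h Y_mono[of "T - h" s] by (auto simp: indicator_def)
    qed (intro Bochner_Integration.integrable_diff causal_lt_integrable[OF Yc] integrable_mult_right
        integrable_real_indicator; use h in simp)+
    also have "\<dots> = (heaviside \<star> Y) T - (heaviside \<star> Y) (T - h)"
      unfolding heaviside_star_eq[of Y]
      by (intro Bochner_Integration.integral_diff causal_lt_integrable[OF Yc])
    also have "\<dots> = (L \<star> (k \<star> q)) T - (L \<star> (k \<star> q)) (T - h)"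
      by (simp add: L_k_star[OF causal_boundedD(4)[OF causal_bounded_q]])
    finally show ?thesis by simp
  qed
  ultimately show ?thesis by linarith
qed

text \<open>
  Modulus of continuity of the product \<open>L (T - t) z t\<close>. The indicator function records that the
  product vanishes after time \<open>T\<close>.
\<close>

lemma weight_modulus:
  assumes s: "0 < s" "s < t" "t \<le> s + h"
  shows "\<bar>L (T - t) * z t - L (T - s) * z s\<bar> \<le> indicator {0..T} s * (3 * G * L T * L h)"
proof (cases "s \<le> T")
  case True
  have Lh: "L (t - s) \<le> L h" using s by (intro L_mono) auto
  have "\<bar>z t - z (t - (t - s))\<bar> \<le> 2 * G * L (t - s)" using s by (intro z_modulus) auto
  also have "\<dots> \<le> 2 * G * L h" using Lh G_nonneg by (intro mult_left_mono) auto
  finally have zz: "\<bar>z t - z s\<bar> \<le> 2 * G * L h" by simp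
  have 1: "L (T - t) * \<bar>z t - z s\<bar> \<le> L T * (2 * G * L h)"
    using s L_nonneg by (intro mult_mono zz L_mono) auto
  have "L (T - t + (t - s)) \<le> L (T - t) + L (t - s)" using s by (intro L_subadditive) auto
  then have "\<bar>L (T - t) - L (T - s)\<bar> \<le> L h"
    using Lh L_mono[of "T - t" "T - s"] s by auto
  then have 2: "\<bar>L (T - t) - L (T - s)\<bar> * \<bar>z s\<bar> \<le> L h * (G * L T)"
    using True z_le_const[OF True] L_nonneg by (intro mult_mono) auto
  have "\<bar>L (T - t) * z t - L (T - s) * z s\<bar>
      = \<bar>L (T - t) * (z t - z s) + (L (T - t) - L (T - s)) * z s\<bar>"
    by (simp add: algebra_simps)
  also have "\<dots> \<le> L (T - t) * \<bar>z t - z s\<bar> + \<bar>L (T - t) - L (T - s)\<bar> * \<bar>z s\<bar>"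
    using abs_triangle_ineq[of "L (T - t) * (z t - z s)" "(L (T - t) - L (T - s)) * z s"] L_nonneg
    by (simp add: abs_mult)
  also have "\<dots> \<le> L T * (2 * G * L h) + L h * (G * L T)" by (rule add_mono[OF 1 2])
  finally show ?thesis using True s by simp
next
  case False
  then show ?thesis using s L_0[of "T - s"] L_0[of "T - t"] by simp
qed

text \<open>
  \<open>D h t\<close> is the integral of \<open>g\<close> over \<open>(t - h, t)\<close>. Exchanging the order of integration moves the
  averaging from \<open>g\<close>, which is merely bounded, to the weight \<open>L (T - t) z t\<close>, which has a modulus
  of continuity.
\<close>

lemma integrated_upper_bound:
  assumes h: "0 < h" and T: "0 < T"
  shows "(L \<star> (\<lambda>t. D h t * z t)) T \<le> h * (L \<star> (\<lambda>t. g t * z t)) T + 3 * G\<^sup>2 * T * L T * L h * h"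
proof -
  define \<psi> where "\<psi> t = L (T - t) * z t" for t
  have [measurable]: "\<psi> \<in> borel_measurable borel" unfolding \<psi>_def[abs_def] by measurable
  define w where "w t s = (indicator {0<..h} (t - s) :: real)" for t s :: real
  have w_eq: "w t s = (indicator {0<..h} (- s + 1 * t) :: real)"
    "w t s = indicator {s<..s + h} t" for t s
    by (auto simp: w_def indicator_def)
  have [measurable]: "case_prod w \<in> borel_measurable (borel \<Otimes>\<^sub>M borel)"
    unfolding w_def[abs_def] by measurable
  have w_int: "integrable lborel (\<lambda>t. w t s)" "(\<integral>t. w t s \<partial>lborel) = h" for s
    unfolding w_eq(2) using h by (auto intro!: integrable_real_indicator)
  have D_eq: "D h t = (\<integral>s. w t s * g s \<partial>lborel)" for t
  proof -
    have "D h t = ((\<lambda>x. heaviside x - heaviside (x - h)) \<star> g) t"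
      unfolding D_def star_shift using h
      by (subst star_diff) (auto intro: causal_heaviside causal_shift causal_bounded_g)
    moreover have "heaviside x - heaviside (x - h) = (indicator {0<..h} x :: real)" for x
      using h by (auto simp: indicator_def)
    ultimately show ?thesis by (simp add: star_def w_def)
  qed
  have \<psi>_le: "\<bar>\<psi> t\<bar> \<le> L T * (G * L T) * indicator {0..T} t" for t
  proof -
    consider "t \<le> 0" | "T < t" | "0 < t" "t \<le> T" by linarith
    then show ?thesis
    proof cases
      case 3
      then show ?thesis using z_le_const[of t T] L_mono[of "T - t" T] L_nonneg
        by (auto simp: \<psi>_def abs_mult intro!: mult_mono)
    qed (use L_0[of "T - t"] z_0[of t] L_nonneg[of T] G_nonneg in \<open>auto simp: \<psi>_def\<close>)
  qed
  have \<psi>_int: "integrable lborel \<psi>"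
  proof (rule Bochner_Integration.integrable_bound)
    show "integrable lborel (\<lambda>t. L T * (G * L T) * indicator {0..T} t)"
      by (rule integrable_const_Icc)
    show "AE t in lborel. norm (\<psi> t) \<le> norm (L T * (G * L T) * indicator {0..T} t)"
    proof (rule AE_I2)
      fix t
      show "norm (\<psi> t) \<le> norm (L T * (G * L T) * indicator {0..T} t)"
        using \<psi>_le[of t] by (simp add: abs_le_iff) 
    qed
  qed measurable
  have int2: "integrable (lborel \<Otimes>\<^sub>M lborel) (\<lambda>(s, t). \<psi> t * w t s * g s)"
  proof (rule Bochner_Integration.integrable_bound)
    show "integrable (lborel \<Otimes>\<^sub>M lborel) (\<lambda>p. L T * (G * L T) * G * indicator ({0..T} \<times> {0..T}) p :: real)"
      by (intro integrable_mult_right integrable_real_indicator)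
        (auto simp: lborel.emeasure_pair_measure_Times emeasure_lborel_Icc_eq ennreal_mult_less_top)
    show "(\<lambda>(s, t). \<psi> t * w t s * g s) \<in> borel_measurable (lborel \<Otimes>\<^sub>M lborel)" by measurable
    have "\<bar>\<psi> t * w t s * g s\<bar> \<le> \<bar>L T * (G * L T) * G * indicator ({0..T} \<times> {0..T}) (s, t)\<bar>" for s t
    proof (cases "s \<in> {0..T} \<and> t \<in> {0..T}")
      case True
      have "\<bar>\<psi> t\<bar> * (w t s * \<bar>g s\<bar>) \<le> (L T * (G * L T)) * (1 * G)"
        using \<psi>_le[of t] g(3)[of s] True L_nonneg[of T] G_nonneg
        by (intro mult_mono) (auto simp: w_def indicator_def)
      then show ?thesis using True G_nonneg L_nonneg[of T] by (simp add: abs_mult w_def mult.assoc)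
    next
      case False
      have "\<psi> t * w t s * g s = 0"
      proof (cases "t \<in> {0..T}")
        case t: True
        then have "s < 0 \<or> T < s" using False by auto
        then show ?thesis using t g(2)[of s] by (auto simp: w_def indicator_def)
      next
        case t: False
        then show ?thesis using \<psi>_le[of t] by simp
      qed
      then show ?thesis by (simp only:)
    qed
    then show "AE p in lborel \<Otimes>\<^sub>M lborel. norm (case p of (s, t) \<Rightarrow> \<psi> t * w t s * g s)
        \<le> norm (L T * (G * L T) * G * indicator ({0..T} \<times> {0..T}) p)"
      by (intro AE_I2) (auto split: prod.split)
  qed
  have \<psi>w: "integrable lborel (\<lambda>t. \<psi> t * w t s)" for s
    by (rule Bochner_Integration.integrable_bound[OF \<psi>_int]) (auto simp: w_def indicator_def)
  have "(L \<star> (\<lambda>t. D h t * z t)) T = (\<integral>t. \<integral>s. \<psi> t * w t s * g s \<partial>lborel \<partial>lborel)"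
  proof -
    have "(\<integral>s. \<psi> t * w t s * g s \<partial>lborel) = \<psi> t * (\<integral>s. w t s * g s \<partial>lborel)" for t
      by (simp add: mult.assoc)
    also have "\<psi> t * (\<integral>s. w t s * g s \<partial>lborel) = L (T - t) * (D h t * z t)" for t
      by (simp add: \<psi>_def D_eq mult.assoc mult.commute[of "z t"])
    finally show ?thesis unfolding star_def[of L] by (simp only:)
  qed
  also have "\<dots> = (\<integral>s. \<integral>t. \<psi> t * w t s * g s \<partial>lborel \<partial>lborel)"
    by (rule lborel_pair.Fubini_integral[OF int2])
  also have "\<dots> = (\<integral>s. (\<integral>t. \<psi> t * w t s \<partial>lborel) * g s \<partial>lborel)" by simp
  finally have lhs: "(L \<star> (\<lambda>t. D h t * z t)) T = (\<integral>s. (\<integral>t. \<psi> t * w t s \<partial>lborel) * g s \<partial>lborel)" .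
  have lhs_int: "integrable lborel (\<lambda>s. (\<integral>t. \<psi> t * w t s \<partial>lborel) * g s)"
    using lborel_pair.integrable_fst[OF int2] by simp
  have rhs: "h * (L \<star> (\<lambda>t. g t * z t)) T = (\<integral>s. h * \<psi> s * g s \<partial>lborel)"
    by (simp add: star_def[of L] \<psi>_def mult_ac flip: integral_mult_right_zero)
  have rhs_int: "integrable lborel (\<lambda>s. h * \<psi> s * g s)"
  proof -
    have "integrable lborel (\<lambda>s. h * (L (T - s) * (g s * z s)))"
      by (intro integrable_mult_right star_integrable_causal[OF causal_L] causal_bounded_mult
          causal_bounded_g causal_bounded_z)
    then show ?thesis by (simp add: \<psi>_def mult_ac)
  qed
  have c_int: "integrable lborel (\<lambda>s. 3 * G\<^sup>2 * L T * L h * h * indicator {0..T} s)"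
    by (rule integrable_const_Icc)
  have "(\<integral>s. (\<integral>t. \<psi> t * w t s \<partial>lborel) * g s \<partial>lborel)
      \<le> (\<integral>s. h * \<psi> s * g s + 3 * G\<^sup>2 * L T * L h * h * indicator {0..T} s \<partial>lborel)"
  proof (rule integral_mono[OF lhs_int])
    show "integrable lborel (\<lambda>s. h * \<psi> s * g s + 3 * G\<^sup>2 * L T * L h * h * indicator {0..T} s)"
      by (intro Bochner_Integration.integrable_add rhs_int c_int)
    fix s
    show "(\<integral>t. \<psi> t * w t s \<partial>lborel) * g s \<le> h * \<psi> s * g s + 3 * G\<^sup>2 * L T * L h * h * indicator {0..T} s"
    proof (cases "0 < s")
      case True
      let ?C = "indicator {0..T} s * (3 * G * L T * L h)"
      have "(\<integral>t. \<psi> t * w t s \<partial>lborel) - h * \<psi> s = (\<integral>t. \<psi> t * w t s - \<psi> s * w t s \<partial>lborel)"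
        by (subst Bochner_Integration.integral_diff[OF \<psi>w integrable_mult_right[OF w_int(1)]])
          (simp add: w_int(2))
      moreover have "norm (\<integral>t. \<psi> t * w t s - \<psi> s * w t s \<partial>lborel) \<le> (\<integral>t. ?C * w t s \<partial>lborel)"
      proof (rule Bochner_Integration.integral_norm_bound_integral)
        fix t
        show "norm (\<psi> t * w t s - \<psi> s * w t s) \<le> ?C * w t s"
          using weight_modulus[of s t h T] True by (auto simp: w_eq(2) \<psi>_def indicator_def)
      qed (intro Bochner_Integration.integrable_diff \<psi>w integrable_mult_right w_int(1))+
      moreover have "(\<integral>t. ?C * w t s \<partial>lborel) = ?C * h" by (simp add: w_int(2))
      ultimately have "\<bar>(\<integral>t. \<psi> t * w t s \<partial>lborel) - h * \<psi> s\<bar> \<le> ?C * h"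
        by (simp only: real_norm_def)
      then have "\<bar>(\<integral>t. \<psi> t * w t s \<partial>lborel) - h * \<psi> s\<bar> * \<bar>g s\<bar> \<le> (?C * h) * G"
        using g(3)[of s] G_nonneg L_nonneg h by (intro mult_mono) auto
      then have "((\<integral>t. \<psi> t * w t s \<partial>lborel) - h * \<psi> s) * g s \<le> ?C * h * G"
        unfolding abs_mult[symmetric] by (rule order_trans[OF abs_ge_self])
      then show ?thesis by (simp add: algebra_simps power2_eq_square)
    next
      case False
      then show ?thesis using g(2)[of s] L_nonneg h by simp
    qed
  qed
  also have "\<dots> = h * (L \<star> (\<lambda>t. g t * z t)) T + 3 * G\<^sup>2 * L T * L h * h * T"
    using T by (simp add: Bochner_Integration.integral_add[OF rhs_int c_int] rhs)
  finally show ?thesis by (simp add: lhs mult_ac)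
qed

text \<open>
  The two integrated bounds divided by \<open>h\<close>, in the limit \<open>h \<rightarrow> 0\<close>.
\<close>

lemma energy_inequality_bounded:
  assumes T: "0 < T"
  shows "Y T / 2 \<le> (L \<star> (\<lambda>t. g t * z t)) T"
proof (rule LIMSEQ_le_const)
  let ?h = "\<lambda>n. 1 / real (Suc n)"
  let ?R = "(L \<star> (\<lambda>t. g t * z t)) T"
  have "(\<lambda>n. ?R + 5 * G\<^sup>2 * T * L T * L (?h n) + ?h n * (G * L T)\<^sup>2 / 2)
      \<longlonglongrightarrow> ?R + 5 * G\<^sup>2 * T * L T * 0 + 0 * (G * L T)\<^sup>2 / 2"
    by (intro tendsto_intros L_tendsto_0 LIMSEQ_Suc[OF lim_1_over_n]) simp
  then show "(\<lambda>n. ?R + 5 * G\<^sup>2 * T * L T * L (?h n) + ?h n * (G * L T)\<^sup>2 / 2) \<longlonglongrightarrow> ?R" by simp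
  have "\<forall>\<^sub>F n in sequentially. ?h n < T"
    by (rule order_tendstoD(2)[OF LIMSEQ_Suc[OF lim_1_over_n] T])
  then obtain N where N: "\<And>n. n \<ge> N \<Longrightarrow> ?h n < T" by (auto simp: eventually_sequentially)
  show "\<exists>N. \<forall>n\<ge>N. Y T / 2 \<le> ?R + 5 * G\<^sup>2 * T * L T * L (?h n) + ?h n * (G * L T)\<^sup>2 / 2"
  proof (intro exI[of _ N] allI impI)
    fix n assume "N \<le> n"
    define h where "h = ?h n"
    have h: "0 < h" "h \<le> T" using N[OF \<open>N \<le> n\<close>] by (auto simp: h_def)
    have "h * (Y (T - h) / 2 - 2 * G\<^sup>2 * T * L T * L h) \<le> h * (?R + 3 * G\<^sup>2 * T * L T * L h)"
      using integrated_lower_bound[OF h] integrated_upper_bound[OF h(1) T] by (simp add: algebra_simps)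
    then have "Y (T - h) / 2 - 2 * G\<^sup>2 * T * L T * L h \<le> ?R + 3 * G\<^sup>2 * T * L T * L h"
      using h by (simp only: mult_le_cancel_left_pos)
    then show "Y T / 2 \<le> ?R + 5 * G\<^sup>2 * T * L T * L (?h n) + ?h n * (G * L T)\<^sup>2 / 2"
      using Y_increment[OF h] unfolding h_def[symmetric] by linarith
  qed
qed

end

section \<open>The energy inequality for square-integrable forcing\<close>

lemma mult_le_half_squares: "\<bar>a * b\<bar> \<le> (a\<^sup>2 + b\<^sup>2) / (2::real)"
  using sum_squares_bound[of "\<bar>a\<bar>" "\<bar>b\<bar>"] by (simp add: abs_mult)

context kernel_pair
begin

definition nn_star_l :: "(real \<Rightarrow> real) \<Rightarrow> real \<Rightarrow> ennreal" where
  "nn_star_l g t = (\<integral>\<^sup>+s. ennreal (l (t - s) * \<bar>g s\<bar>) \<partial>lborel)"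

lemma nn_star_l_measurable [measurable]:
  assumes [measurable]: "g \<in> borel_measurable borel"
  shows "nn_star_l g \<in> borel_measurable borel"
  unfolding nn_star_l_def[abs_def] by measurable

lemma nn_L: "(\<integral>\<^sup>+s. ennreal (l (t - s) * heaviside s) \<partial>lborel) = ennreal (L t)"
proof -
  have "integrable lborel (\<lambda>s. l (t - s) * heaviside s)"
    by (rule star_integrable_causal[OF l(1) causal_bounded_heaviside])
  then have "(\<integral>\<^sup>+s. ennreal (l (t - s) * heaviside s) \<partial>lborel) = ennreal (\<integral>s. l (t - s) * heaviside s \<partial>lborel)"
    using l(2) by (intro nn_integral_eq_integral) auto
  then show ?thesis by (simp add: L_def star_eq')
qed

text \<open>
  The convolution of \<open>l\<close> with the absolute value of \<open>g\<close> is in \<open>L\<^sup>2\<close> up to time \<open>T\<close>. It dominates \<open>l * c\<close>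
  for every truncation \<open>c\<close> of \<open>g\<close>.
\<close>

lemma young_inequality:
  assumes g [measurable]: "g \<in> borel_measurable borel" and g0: "\<And>x. x \<le> 0 \<Longrightarrow> g x = 0"
  shows "(\<integral>\<^sup>+t. indicator {..<T} t * (nn_star_l g t)\<^sup>2 \<partial>lborel)
    \<le> ennreal (L T) * (ennreal (L T) * (\<integral>\<^sup>+s. ennreal ((g s)\<^sup>2) \<partial>lborel))"
proof -
  have cs: "(nn_star_l g t)\<^sup>2 \<le> ennreal (L t) * (\<integral>\<^sup>+s. ennreal (l (t - s)) * ennreal ((g s)\<^sup>2) \<partial>lborel)" for t
  proof -
    have "nn_star_l g t = (\<integral>\<^sup>+s. ennreal (sqrt (l (t - s)) * heaviside s) * ennreal (sqrt (l (t - s)) * \<bar>g s\<bar>) \<partial>lborel)"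
      unfolding nn_star_l_def
    proof (rule nn_integral_cong)
      fix s
      show "ennreal (l (t - s) * \<bar>g s\<bar>) = ennreal (sqrt (l (t - s)) * heaviside s) * ennreal (sqrt (l (t - s)) * \<bar>g s\<bar>)"
        using l(2)[of "t - s"] g0[of s] by (cases "0 < s") (auto simp flip: ennreal_mult)
    qed
    then have "(nn_star_l g t)\<^sup>2 \<le> (\<integral>\<^sup>+s. (ennreal (sqrt (l (t - s)) * heaviside s))\<^sup>2 \<partial>lborel)
        * (\<integral>\<^sup>+s. (ennreal (sqrt (l (t - s)) * \<bar>g s\<bar>))\<^sup>2 \<partial>lborel)"
      by (simp add: Cauchy_Schwarz_nn_integral)
    also have "(\<integral>\<^sup>+s. (ennreal (sqrt (l (t - s)) * heaviside s))\<^sup>2 \<partial>lborel) = ennreal (L t)"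
      unfolding nn_L[symmetric] using l(2)
      by (intro nn_integral_cong) (auto simp: ennreal_power power_mult_distrib indicator_def)
    also have "(\<integral>\<^sup>+s. (ennreal (sqrt (l (t - s)) * \<bar>g s\<bar>))\<^sup>2 \<partial>lborel) = (\<integral>\<^sup>+s. ennreal (l (t - s)) * ennreal ((g s)\<^sup>2) \<partial>lborel)"
      using l(2) by (intro nn_integral_cong) (auto simp: ennreal_power power_mult_distrib ennreal_mult')
    finally show ?thesis .
  qed
  have "(\<integral>\<^sup>+t. indicator {..<T} t * (nn_star_l g t)\<^sup>2 \<partial>lborel)
      \<le> (\<integral>\<^sup>+t. ennreal (L T) * (indicator {..<T} t * (\<integral>\<^sup>+s. ennreal (l (t - s)) * ennreal ((g s)\<^sup>2) \<partial>lborel)) \<partial>lborel)"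
  proof (rule nn_integral_mono)
    fix t
    show "indicator {..<T} t * (nn_star_l g t)\<^sup>2
        \<le> ennreal (L T) * (indicator {..<T} t * (\<integral>\<^sup>+s. ennreal (l (t - s)) * ennreal ((g s)\<^sup>2) \<partial>lborel))"
    proof (cases "t < T")
      case True
      note cs[of t]
      also have "ennreal (L t) * (\<integral>\<^sup>+s. ennreal (l (t - s)) * ennreal ((g s)\<^sup>2) \<partial>lborel)
          \<le> ennreal (L T) * (\<integral>\<^sup>+s. ennreal (l (t - s)) * ennreal ((g s)\<^sup>2) \<partial>lborel)"
        using True by (intro mult_right_mono ennreal_leI L_mono) auto
      finally show ?thesis using True by simp
    qed simp
  qed
  also have "\<dots> = ennreal (L T) * (\<integral>\<^sup>+t. indicator {..<T} t * (\<integral>\<^sup>+s. ennreal (l (t - s)) * ennreal ((g s)\<^sup>2) \<partial>lborel) \<partial>lborel)"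
    by (rule nn_integral_cmult) measurable
  also have "\<dots> \<le> ennreal (L T) * (ennreal (L T) * (\<integral>\<^sup>+s. ennreal ((g s)\<^sup>2) \<partial>lborel))"
    unfolding L_def using nn_conv_integral_le[OF l(1,2), of "\<lambda>s. ennreal ((g s)\<^sup>2)" T] g0
    by (intro mult_left_mono) auto
  finally show ?thesis .
qed

text \<open>
  Truncate \<open>g\<close> at height \<open>n\<close> and pass to the limit by dominated convergence on both sides.
\<close>

lemma energy_inequality:
  assumes T: "0 < T" and g [measurable]: "g \<in> borel_measurable borel"
    and g0: "\<And>x. x \<le> 0 \<Longrightarrow> g x = 0" and g2: "integrable lborel (\<lambda>x. (g x)\<^sup>2)"
  shows "integrable lborel (\<lambda>t. indicator {..<T} t * ((l \<star> g) t)\<^sup>2)"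
    and "integrable lborel (\<lambda>t. L (T - t) * (g t * (l \<star> g) t))"
    and "(\<integral>t. indicator {..<T} t * ((l \<star> g) t)\<^sup>2 \<partial>lborel) / 2 \<le> (\<integral>t. L (T - t) * (g t * (l \<star> g) t) \<partial>lborel)"
proof -
  \<comment> \<open>Square integrable by Young's inequality, and a common bound for \<open>l * g\<close> and its approximations.\<close>
  define W where "W t = indicator {..<T} t * enn2real (nn_star_l g t)" for t
  have [measurable]: "W \<in> borel_measurable borel" unfolding W_def[abs_def] by measurable
  have W0: "0 \<le> W t" for t by (simp add: W_def)
  have fin: "(\<integral>\<^sup>+t. indicator {..<T} t * (nn_star_l g t)\<^sup>2 \<partial>lborel) < \<infinity>"
  proof -
    have "(\<integral>\<^sup>+s. ennreal ((g s)\<^sup>2) \<partial>lborel) = ennreal (\<integral>s. (g s)\<^sup>2 \<partial>lborel)"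
      by (rule nn_integral_eq_integral[OF g2]) auto
    then show ?thesis
      using young_inequality[OF g g0, of T] by (simp add: le_less_trans ennreal_mult_less_top)
  qed
  have "AE t in lborel. indicator {..<T} t * (nn_star_l g t)\<^sup>2 \<noteq> \<infinity>"
    using fin by (intro nn_integral_noteq_infinite) auto
  then have ae: "AE t in lborel. t < T \<longrightarrow> nn_star_l g t < \<infinity>"
    by eventually_elim (auto simp: less_top[symmetric] power2_eq_square ennreal_mult_eq_top_iff)
  have W2: "integrable lborel (\<lambda>t. (W t)\<^sup>2)"
  proof (rule integrableI_bounded)
    have "(\<integral>\<^sup>+t. ennreal (norm ((W t)\<^sup>2)) \<partial>lborel) \<le> (\<integral>\<^sup>+t. indicator {..<T} t * (nn_star_l g t)\<^sup>2 \<partial>lborel)"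
      unfolding W_def by (intro nn_integral_mono)
        (auto simp: indicator_def ennreal_power[symmetric] ennreal_enn2real_if)
    then show "(\<integral>\<^sup>+t. ennreal (norm ((W t)\<^sup>2)) \<partial>lborel) < \<infinity>"
      using fin by (rule le_less_trans)
  qed measurable
  define c where "c n x = max (- real n) (min (real n) (g x))" for n x
  have [measurable]: "c n \<in> borel_measurable borel" for n unfolding c_def[abs_def] by measurable
  have c: "\<bar>c n x\<bar> \<le> \<bar>g x\<bar>" "\<bar>c n x\<bar> \<le> real n" "x \<le> 0 \<Longrightarrow> c n x = 0" for n x
    using g0[of x] by (auto simp: c_def)
  have c_lim: "(\<lambda>n. c n x) \<longlonglongrightarrow> g x" for x
  proof -
    obtain N where N: "\<bar>g x\<bar> \<le> real N" using real_arch_simple by blast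
    have "c n x = g x" if "n \<ge> N" for n
    proof -
      have "\<bar>g x\<bar> \<le> real n" using N that by linarith
      then show ?thesis by (auto simp: c_def)
    qed
    then have "\<forall>\<^sub>F n in sequentially. c n x = g x" unfolding eventually_sequentially by blast
    then show ?thesis by (rule tendsto_eventually)
  qed
  have key: "(\<lambda>n. (l \<star> c n) t) \<longlonglongrightarrow> (l \<star> g) t \<and> \<bar>(l \<star> g) t\<bar> \<le> W t \<and> (\<forall>n. \<bar>(l \<star> c n) t\<bar> \<le> W t)"
    if t: "t < T" "nn_star_l g t < \<infinity>" for t
  proof -
    have i: "integrable lborel (\<lambda>s. l (t - s) * \<bar>g s\<bar>)"
      using t(2) l(2) by (intro integrableI_bounded) (auto simp: nn_star_l_def abs_mult)
    have "ennreal (\<integral>s. l (t - s) * \<bar>g s\<bar> \<partial>lborel) = nn_star_l g t"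
      unfolding nn_star_l_def using l(2) by (intro nn_integral_eq_integral[symmetric] i) auto
    then have W: "W t = (\<integral>s. l (t - s) * \<bar>g s\<bar> \<partial>lborel)"
      using t(1) l(2) by (simp add: W_def flip: \<open>_ = nn_star_l g t\<close>)
    have dom: "norm (l (t - s) * b) \<le> l (t - s) * \<bar>g s\<bar>" if "\<bar>b\<bar> \<le> \<bar>g s\<bar>" for s b
      using l(2)[of "t - s"] that by (simp add: abs_mult mult_left_mono)
    have bound: "\<bar>(l \<star> b) t\<bar> \<le> W t" if [measurable]: "b \<in> borel_measurable borel" and b: "\<And>s. \<bar>b s\<bar> \<le> \<bar>g s\<bar>" for b
    proof -
      have "norm (\<integral>s. l (t - s) * b s \<partial>lborel) \<le> (\<integral>s. l (t - s) * \<bar>g s\<bar> \<partial>lborel)"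
      proof (rule Bochner_Integration.integral_norm_bound_integral[OF _ i])
        show "integrable lborel (\<lambda>s. l (t - s) * b s)"
          by (rule Bochner_Integration.integrable_bound[OF i]) (use dom[OF b] l(2) in \<open>auto simp: abs_mult\<close>)
      qed (rule dom[OF b])
      then show ?thesis by (simp add: W star_def)
    qed
    have "(\<lambda>n. (l \<star> c n) t) \<longlonglongrightarrow> (l \<star> g) t"
      unfolding star_def
    proof (rule integral_dominated_convergence[where w="\<lambda>s. l (t - s) * \<bar>g s\<bar>"])
      show "AE s in lborel. (\<lambda>n. l (t - s) * c n s) \<longlonglongrightarrow> l (t - s) * g s"
        by (intro AE_I2 tendsto_intros c_lim)
      show "AE s in lborel. norm (l (t - s) * c n s) \<le> l (t - s) * \<bar>g s\<bar>" for n
        by (intro AE_I2 dom c)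
    qed (use i in measurable)
    then show ?thesis using bound[of g] bound[OF _ c(1)] by auto
  qed
  have Tneg: "indicator {..<T} t = (0::real)" "L (T - t) = 0" if "\<not> t < T" for t
    using that L_0[of "T - t"] by auto
  have dom1: "integrable lborel (\<lambda>t. L T * (((g t)\<^sup>2 + (W t)\<^sup>2) / 2))"
    using g2 W2 by auto
  have est1: "norm (indicator {..<T} t * b\<^sup>2) \<le> (W t)\<^sup>2" if "t < T \<longrightarrow> \<bar>b\<bar> \<le> W t" for t b
    using that power_mono[of "\<bar>b\<bar>" "W t" 2] by (cases "t < T") auto
  have est2: "norm (L (T - t) * (a * b)) \<le> L T * (((g t)\<^sup>2 + (W t)\<^sup>2) / 2)"
    if "t < T \<longrightarrow> \<bar>b\<bar> \<le> W t" "\<bar>a\<bar> \<le> \<bar>g t\<bar>" for t a b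
  proof (cases "0 < t \<and> t < T")
    case True
    have "\<bar>a\<bar> * \<bar>b\<bar> \<le> \<bar>g t\<bar> * W t" using True that by (intro mult_mono) auto
    also have "\<dots> \<le> ((g t)\<^sup>2 + (W t)\<^sup>2) / 2"
      using mult_le_half_squares[of "g t" "W t"] W0[of t] by (simp add: abs_mult)
    finally have "L (T - t) * (\<bar>a\<bar> * \<bar>b\<bar>) \<le> L T * (((g t)\<^sup>2 + (W t)\<^sup>2) / 2)"
      using True L_nonneg by (intro mult_mono L_mono) auto
    then show ?thesis using L_nonneg[of "T - t"] by (simp add: abs_mult)
  next
    case False
    then have "L (T - t) * (a * b) = 0" using that g0[of t] Tneg(2)[of t] by auto
    then show ?thesis using L_nonneg[of T] by (simp only:) simp
  qed
  show i1: "integrable lborel (\<lambda>t. indicator {..<T} t * ((l \<star> g) t)\<^sup>2)"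
  proof (rule Bochner_Integration.integrable_bound[OF W2])
    show "AE t in lborel. norm (indicator {..<T} t * ((l \<star> g) t)\<^sup>2) \<le> norm ((W t)\<^sup>2)"
      using ae by eventually_elim (use est1 key in fastforce)
  qed measurable
  show i2: "integrable lborel (\<lambda>t. L (T - t) * (g t * (l \<star> g) t))"
  proof (rule Bochner_Integration.integrable_bound[OF dom1])
    show "AE t in lborel. norm (L (T - t) * (g t * (l \<star> g) t)) \<le> norm (L T * (((g t)\<^sup>2 + (W t)\<^sup>2) / 2))"
      using ae
    proof eventually_elim
      case (elim t)
      then have "norm (L (T - t) * (g t * (l \<star> g) t)) \<le> L T * (((g t)\<^sup>2 + (W t)\<^sup>2) / 2)"
        by (intro est2) (use key in auto)
      then show ?case by (metis abs_ge_self order_trans real_norm_def)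
    qed
  qed measurable
  have lim1: "(\<lambda>n. \<integral>t. indicator {..<T} t * ((l \<star> c n) t)\<^sup>2 \<partial>lborel)
      \<longlonglongrightarrow> (\<integral>t. indicator {..<T} t * ((l \<star> g) t)\<^sup>2 \<partial>lborel)"
  proof (rule integral_dominated_convergence[OF _ _ W2])
    show "AE t in lborel. (\<lambda>n. indicator {..<T} t * ((l \<star> c n) t)\<^sup>2) \<longlonglongrightarrow> indicator {..<T} t * ((l \<star> g) t)\<^sup>2"
      using ae
    proof eventually_elim
      case (elim t)
      then show ?case using key[of t] by (cases "t < T") (auto intro!: tendsto_intros)
    qed
    show "AE t in lborel. norm (indicator {..<T} t * ((l \<star> c n) t)\<^sup>2) \<le> (W t)\<^sup>2" for n
      using ae by eventually_elim (intro est1, use key in auto)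
  qed measurable
  have lim2: "(\<lambda>n. \<integral>t. L (T - t) * (c n t * (l \<star> c n) t) \<partial>lborel)
      \<longlonglongrightarrow> (\<integral>t. L (T - t) * (g t * (l \<star> g) t) \<partial>lborel)"
  proof (rule integral_dominated_convergence[OF _ _ dom1])
    show "AE t in lborel. (\<lambda>n. L (T - t) * (c n t * (l \<star> c n) t)) \<longlonglongrightarrow> L (T - t) * (g t * (l \<star> g) t)"
      using ae
    proof eventually_elim
      case (elim t)
      then show ?case using key[of t] c_lim[of t] Tneg(2)[of t] by (cases "t < T") (auto intro!: tendsto_intros)
    qed
    show "AE t in lborel. norm (L (T - t) * (c n t * (l \<star> c n) t)) \<le> L T * (((g t)\<^sup>2 + (W t)\<^sup>2) / 2)" for n
      using ae by eventually_elim (intro est2 c, use key in auto)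
  qed measurable
  have "(\<integral>t. indicator {..<T} t * ((l \<star> c n) t)\<^sup>2 \<partial>lborel) / 2 \<le> (\<integral>t. L (T - t) * (c n t * (l \<star> c n) t) \<partial>lborel)" for n
  proof -
    interpret B: bounded_forcing k l "c n" "real n"
      by unfold_locales (use c in auto)
    show ?thesis
      using B.energy_inequality_bounded[OF T]
      by (simp add: heaviside_star_eq star_def[of L] B.z_def power2_eq_square)
  qed
  then show "(\<integral>t. indicator {..<T} t * ((l \<star> g) t)\<^sup>2 \<partial>lborel) / 2 \<le> (\<integral>t. L (T - t) * (g t * (l \<star> g) t) \<partial>lborel)"
    by (intro LIMSEQ_le[OF tendsto_divide[OF lim1 tendsto_const] lim2]) auto
qed

end

section \<open>Inversion of the Volterra equation\<close>

lemma AE_eq_0_if_integrals_eq_0: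
  fixes f :: "real \<Rightarrow> real"
  assumes f: "integrable lborel f" and 0: "\<And>r. (\<integral>x. indicator {..<r} x * f x \<partial>lborel) = 0"
  shows "AE x in lborel. f x = 0"
proof -
  have [measurable]: "f \<in> borel_measurable borel" using f by auto
  have i: "integrable lborel (\<lambda>x. indicator A x * f x)" if [measurable]: "A \<in> sets borel" for A
    by (rule Bochner_Integration.integrable_bound[OF f]) (auto simp: indicator_def)
  have "(\<lambda>n. \<integral>x. indicator {..<real n} x * f x \<partial>lborel) \<longlonglongrightarrow> (\<integral>x. f x \<partial>lborel)"
  proof (rule integral_dominated_convergence[where w="\<lambda>x. \<bar>f x\<bar>"])
    show "AE x in lborel. (\<lambda>n. indicator {..<real n} x * f x) \<longlonglongrightarrow> f x"
    proof (rule AE_I2)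
      fix x :: real
      have "\<forall>\<^sub>F n in sequentially. x < real n"
        using filterlim_real_sequentially filterlim_at_top_dense by blast
      then have "\<forall>\<^sub>F n in sequentially. indicator {..<real n} x * f x = f x"
        by eventually_elim simp
      then show "(\<lambda>n. indicator {..<real n} x * f x) \<longlonglongrightarrow> f x" by (rule tendsto_eventually)
    qed
  qed (use f in \<open>auto simp: indicator_def\<close>)
  then have tot: "(\<integral>x. f x \<partial>lborel) = 0"
    using LIMSEQ_unique[OF _ tendsto_const] 0 by simp
  have gt: "(\<integral>x. indicator {r<..} x * f x \<partial>lborel) = 0" for r
  proof -
    have "(\<integral>x. indicator {r<..} x * f x \<partial>lborel) = (\<integral>x. f x - indicator {..<r} x * f x \<partial>lborel)"
    proof (rule integral_cong_AE)
      show "AE x in lborel. indicator {r<..} x * f x = f x - indicator {..<r} x * f x"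
        using AE_lborel_singleton[of r] by eventually_elim (auto simp: indicator_def)
    qed measurable
    also have "\<dots> = 0"
      by (subst Bochner_Integration.integral_diff[OF f i]) (auto simp: 0 tot)
    finally show ?thesis .
  qed
  \<comment> \<open>As \<^const>\<open>ennreal\<close> cuts off negative numbers, these are the measures given by the positive and the negative part of \<open>f\<close>.\<close>
  let ?P = "density lborel (\<lambda>x. ennreal (f x))" and ?N = "density lborel (\<lambda>x. ennreal (- f x))"
  have em: "emeasure ?P {r<..} = ennreal (\<integral>x. indicator {r<..} x * max 0 (f x) \<partial>lborel)"
    "emeasure ?N {r<..} = ennreal (\<integral>x. indicator {r<..} x * max 0 (- f x) \<partial>lborel)"
    "integrable lborel (\<lambda>x. indicator {r<..} x * max 0 (f x))"
    "integrable lborel (\<lambda>x. indicator {r<..} x * max 0 (- f x))" for r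
  proof -
    show *: "integrable lborel (\<lambda>x. indicator {r<..} x * max 0 (f x))"
      "integrable lborel (\<lambda>x. indicator {r<..} x * max 0 (- f x))"
      by (rule Bochner_Integration.integrable_bound[OF f]; auto simp: indicator_def)+
    have "emeasure ?P {r<..} = (\<integral>\<^sup>+x. ennreal (f x) * indicator {r<..} x \<partial>lborel)"
      by (rule emeasure_density) auto
    also have "\<dots> = (\<integral>\<^sup>+x. ennreal (indicator {r<..} x * max 0 (f x)) \<partial>lborel)"
      by (intro nn_integral_cong) (auto simp: indicator_def max_def ennreal_neg)
    also have "\<dots> = ennreal (\<integral>x. indicator {r<..} x * max 0 (f x) \<partial>lborel)"
      by (rule nn_integral_eq_integral[OF *(1)]) auto
    finally show "emeasure ?P {r<..} = ennreal (\<integral>x. indicator {r<..} x * max 0 (f x) \<partial>lborel)" .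
    have "emeasure ?N {r<..} = (\<integral>\<^sup>+x. ennreal (- f x) * indicator {r<..} x \<partial>lborel)"
      by (rule emeasure_density) auto
    also have "\<dots> = (\<integral>\<^sup>+x. ennreal (indicator {r<..} x * max 0 (- f x)) \<partial>lborel)"
      by (intro nn_integral_cong) (auto simp: indicator_def max_def ennreal_neg)
    also have "\<dots> = ennreal (\<integral>x. indicator {r<..} x * max 0 (- f x) \<partial>lborel)"
      by (rule nn_integral_eq_integral[OF *(2)]) auto
    finally show "emeasure ?N {r<..} = ennreal (\<integral>x. indicator {r<..} x * max 0 (- f x) \<partial>lborel)" .
  qed
  have "?P = ?N"
  proof (rule measure_eqI_lessThan)
    fix r
    have "(\<integral>x. indicator {r<..} x * max 0 (f x) - indicator {r<..} x * max 0 (- f x) \<partial>lborel)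
        = (\<integral>x. indicator {r<..} x * f x \<partial>lborel)"
      by (rule Bochner_Integration.integral_cong) (auto simp: indicator_def)
    then have "0 = (\<integral>x. indicator {r<..} x * max 0 (f x) - indicator {r<..} x * max 0 (- f x) \<partial>lborel)"
      by (simp only: gt)
    also have "\<dots> = (\<integral>x. indicator {r<..} x * max 0 (f x) \<partial>lborel) - (\<integral>x. indicator {r<..} x * max 0 (- f x) \<partial>lborel)"
      by (rule Bochner_Integration.integral_diff[OF em(3,4)])
    finally show "emeasure ?P {r<..} = emeasure ?N {r<..}" by (simp add: em(1,2))
    show "emeasure ?P {r<..} < \<infinity>" by (simp add: em(1))
  qed auto
  then have "AE x in lborel. ennreal (f x) = ennreal (- f x)"
    by (subst (asm) sigma_finite_measure.density_unique_iff[OF lborel.sigma_finite_measure_axioms]) auto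
  then show ?thesis
    by eventually_elim (metis ennreal_eq_0_iff ennreal_neg le_minus_iff linorder_le_cases neg_0_equal_iff_equal neg_le_0_iff_le order_antisym)
qed

text \<open>
  The kernels and convolutions are handled with Borel functions on the line and \<^const>\<open>lborel\<close>, where
  products are measurable without further ado; the functions in the theorem are Lebesgue
  measurable on an interval. The next lemmas pass from one setting to the other.
\<close>

lemma lebesgue_on_integral_eq:
  fixes f h :: "real \<Rightarrow> real"
  assumes h: "h \<in> borel_measurable borel" and S: "S \<in> sets borel"
    and f: "f \<in> borel_measurable (lebesgue_on S)"
    and eq: "AE x in lborel. h x = indicator S x * f x"
  shows "integrable (lebesgue_on S) f \<longleftrightarrow> integrable lborel h"
    and "(\<integral>x. f x \<partial>lebesgue_on S) = (\<integral>x. h x \<partial>lborel)"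
proof -
  have S': "S \<in> sets lebesgue" using S by simp
  have m: "(\<lambda>x. indicator S x * f x) \<in> borel_measurable lebesgue"
    using f S' by (simp add: borel_measurable_restrict_space_iff mult.commute)
  have hm: "h \<in> borel_measurable lebesgue" using h by (intro measurable_completion) simp
  have eq': "AE x in lebesgue. indicator S x * f x = h x"
    using AE_completion[OF eq] by eventually_elim simp
  show "integrable (lebesgue_on S) f \<longleftrightarrow> integrable lborel h"
    using integrable_cong_AE[OF m hm eq'] h S'
    by (simp add: integrable_restrict_space integrable_completion)
  show "(\<integral>x. f x \<partial>lebesgue_on S) = (\<integral>x. h x \<partial>lborel)"
    using integral_cong_AE[OF m hm eq'] h S'
    by (simp add: integral_restrict_space integral_completion)
qed

lemma borel_representative:
  fixes f :: "real \<Rightarrow> real"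
  assumes f: "f \<in> borel_measurable (lebesgue_on S)" and S: "S \<in> sets borel"
  obtains h where "h \<in> borel_measurable borel" "\<And>x. x \<notin> S \<Longrightarrow> h x = 0"
    "AE x in lborel. x \<in> S \<longrightarrow> h x = f x"
proof -
  have "(\<lambda>x. indicator S x * f x) \<in> borel_measurable lebesgue"
    using f S by (simp add: borel_measurable_restrict_space_iff mult.commute)
  from completion_ex_borel_measurable_real[OF this]
  obtain h' where h': "h' \<in> borel_measurable lborel" "AE x in lborel. indicator S x * f x = h' x" by blast
  show ?thesis
  proof (rule that[of "\<lambda>x. indicator S x * h' x"])
    show "(\<lambda>x. indicator S x * h' x) \<in> borel_measurable borel"
      using h' S by auto
    show "AE x in lborel. x \<in> S \<longrightarrow> indicator S x * h' x = f x"
      using h'(2) by eventually_elim auto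
  qed auto
qed

lemma AE_lebesgue_on_iff:
  assumes "S \<in> sets lebesgue"
  shows "(AE x in lebesgue_on S. P x) \<longleftrightarrow> (AE x in lborel. x \<in> S \<longrightarrow> P x)"
  using assms by (simp add: AE_restrict_space_iff AE_completion_iff)

lemma integrable_of_square_integrable:
  fixes f :: "real \<Rightarrow> real"
  assumes [measurable]: "f \<in> borel_measurable borel" and 0: "\<And>x. x \<notin> {0<..<T} \<Longrightarrow> f x = 0"
    and 2: "integrable lborel (\<lambda>x. (f x)\<^sup>2)"
  shows "integrable lborel f"
proof (rule Bochner_Integration.integrable_bound)
  show "integrable lborel (\<lambda>x. indicator {0..T} x + (f x)\<^sup>2)"
    using integrable_const_Icc[of 1 0 T] by (intro Bochner_Integration.integrable_add 2) simp
  have "\<bar>f x\<bar> \<le> 1 + (f x)\<^sup>2" for x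
    using mult_le_half_squares[of 1 "f x"] zero_le_power2[of "f x"] by (simp add: field_simps)
  then show "AE x in lborel. norm (f x) \<le> norm (indicator {0..T} x + (f x)\<^sup>2)"
    using 0 by (intro AE_I2) (auto simp: indicator_def)
qed measurable

context kernel_pair
begin

text \<open>
  Convolving the equation \<open>k * z = 1 * g\<close> with \<open>l\<close> yields \<open>1 * z = 1 * (l * g)\<close> at every time up to \<open>T\<close>.
\<close>

lemma solve_volterra:
  assumes z: "causal z" and g [measurable]: "g \<in> borel_measurable borel"
    and g0: "\<And>x. x \<notin> {0<..<T} \<Longrightarrow> g x = 0" and g2: "integrable lborel (\<lambda>x. (g x)\<^sup>2)"
    and T: "0 < T" and eq: "AE t in lborel. t \<in> {0<..<T} \<longrightarrow> (k \<star> z) t = (heaviside \<star> g) t"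
  shows "AE t in lborel. t \<in> {0<..<T} \<longrightarrow> z t = (l \<star> g) t"
    and "(heaviside \<star> z) T = (L \<star> g) T"
proof -
  note [measurable] = causalD(1)[OF z]
  have gi: "integrable lborel g" by (rule integrable_of_square_integrable[OF g g0 g2])
  have cg: "causal g" by (rule causal_integrableI[OF gi]) (auto intro: g0)
  have *: "(heaviside \<star> z) r = (heaviside \<star> (l \<star> g)) r" if "r \<le> T" for r
  proof -
    have "(l \<star> (k \<star> z)) r = (l \<star> (heaviside \<star> g)) r"
    proof (rule star_cong_AE[OF l(1)])
      show "AE s in lborel. s < r \<longrightarrow> (k \<star> z) s = (heaviside \<star> g) s"
        using eq
      proof eventually_elim
        case (elim s)
        then show ?case
          using that star_eq_0[OF k(1) z, of s] star_eq_0[OF causal_heaviside cg, of s]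
          by (cases "0 < s") auto
      qed
    qed measurable
    then show ?thesis by (simp add: l_k_star[OF z] l_heaviside_star(1)[OF cg])
  qed
  show "(heaviside \<star> z) T = (L \<star> g) T"
    using * [of T] l_heaviside_star(2)[OF cg] by simp
  let ?lg = "\<lambda>t. indicator {..<T} t * (l \<star> g) t"
  have lg0: "(l \<star> g) t = 0" if "t \<le> 0" for t by (rule star_eq_0[OF l(1) cg that])
  have lgi: "integrable lborel ?lg"
  proof (rule integrable_of_square_integrable[of _ T])
    have "integrable lborel (\<lambda>t. indicator {..<T} t * ((l \<star> g) t)\<^sup>2)"
      by (rule energy_inequality(1)[OF T g _ g2]) (auto intro: g0)
    moreover have "(?lg t)\<^sup>2 = indicator {..<T} t * ((l \<star> g) t)\<^sup>2" for t by (auto simp: indicator_def)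
    ultimately show "integrable lborel (\<lambda>t. (?lg t)\<^sup>2)" by simp
    show "?lg t = 0" if "t \<notin> {0<..<T}" for t using that lg0[of t] by (auto simp: indicator_def)
  qed measurable
  let ?f = "\<lambda>t. indicator {..<T} t * z t - ?lg t"
  have zi: "integrable lborel (\<lambda>t. indicator {..<r} t * z t)" for r by (rule causal_lt_integrable[OF z])
  have "AE t in lborel. ?f t = 0"
  proof (rule AE_eq_0_if_integrals_eq_0)
    show "integrable lborel ?f" by (intro Bochner_Integration.integrable_diff zi lgi)
    fix r
    \<comment> \<open>The difference vanishes after \<open>T\<close>, so integrals beyond \<open>T\<close> reduce to the integral up to \<open>T\<close>.\<close>
    let ?r = "min r T"
    have ind: "indicator {..<r} t * ?f t = indicator {..<?r} t * z t - indicator {..<?r} t * (l \<star> g) t" for t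
      by (auto simp: indicator_def)
    have i2: "integrable lborel (\<lambda>t. indicator {..<?r} t * (l \<star> g) t)"
      by (rule Bochner_Integration.integrable_bound[OF lgi]) (auto simp: indicator_def)
    have "(\<integral>t. indicator {..<r} t * ?f t \<partial>lborel) = (heaviside \<star> z) ?r - (heaviside \<star> (l \<star> g)) ?r"
      unfolding ind heaviside_star_eq by (rule Bochner_Integration.integral_diff[OF zi i2])
    then show "(\<integral>t. indicator {..<r} t * ?f t \<partial>lborel) = 0"
      using *[of ?r] by simp
  qed
  then show "AE t in lborel. t \<in> {0<..<T} \<longrightarrow> z t = (l \<star> g) t"
    by eventually_elim auto
qed

text \<open>
  With \<open>z = w - a\<close> the additional terms are \<open>a \<integral> z\<close> on the left and \<open>a \<integral> L (T - t) g dt\<close> on the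
  right, which agree.
\<close>

lemma energy_inequality_with_initial_value:
  assumes T: "0 < T"
    and w: "w \<in> borel_measurable (time_measure T)" "integrable (time_measure T) (\<lambda>t. (w t)\<^sup>2)"
    and g: "g \<in> borel_measurable (time_measure T)" "integrable (time_measure T) (\<lambda>t. (g t)\<^sup>2)"
    and eq: "AE t in time_measure T.
      (\<integral>s. k (t - s) * (w s - a) \<partial>lebesgue_on {0<..<t}) = (\<integral>s. indicator {..t} s * g s \<partial>time_measure T)"
  shows "(\<integral>t. (w t)\<^sup>2 \<partial>time_measure T) / 2 - T * a\<^sup>2 / 2 \<le> (\<integral>t. L (T - t) * (g t * w t) \<partial>time_measure T)"
proof -
  let ?S = "{0<..<T}"
  have S: "?S \<in> sets borel" "?S \<in> sets lebesgue" by auto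
  obtain w' where w' [measurable]: "w' \<in> borel_measurable borel" and w'0: "\<And>x. x \<notin> ?S \<Longrightarrow> w' x = 0"
    and ww': "AE x in lborel. x \<in> ?S \<longrightarrow> w' x = w x"
    using borel_representative[OF w(1) S(1)] by blast
  obtain g' where g' [measurable]: "g' \<in> borel_measurable borel" and g'0: "\<And>x. x \<notin> ?S \<Longrightarrow> g' x = 0"
    and gg': "AE x in lborel. x \<in> ?S \<longrightarrow> g' x = g x"
    using borel_representative[OF g(1) S(1)] by blast
  have wm2: "(\<lambda>t. (w t)\<^sup>2) \<in> borel_measurable (time_measure T)" 
    and gm2: "(\<lambda>t. (g t)\<^sup>2) \<in> borel_measurable (time_measure T)" using w g by auto
  have w2: "integrable lborel (\<lambda>t. (w' t)\<^sup>2)" "(\<integral>t. (w t)\<^sup>2 \<partial>time_measure T) = (\<integral>t. (w' t)\<^sup>2 \<partial>lborel)"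
  proof -
    have "AE x in lborel. (w' x)\<^sup>2 = indicator ?S x * (w x)\<^sup>2"
      using ww' by eventually_elim (use w'0 in \<open>auto simp: indicator_def\<close>)
    from lebesgue_on_integral_eq[OF _ S(1) wm2 this] w(2)
    show "integrable lborel (\<lambda>t. (w' t)\<^sup>2)" "(\<integral>t. (w t)\<^sup>2 \<partial>time_measure T) = (\<integral>t. (w' t)\<^sup>2 \<partial>lborel)" by auto
  qed
  have g2: "integrable lborel (\<lambda>t. (g' t)\<^sup>2)"
  proof -
    have "AE x in lborel. (g' x)\<^sup>2 = indicator ?S x * (g x)\<^sup>2"
      using gg' by eventually_elim (use g'0 in \<open>auto simp: indicator_def\<close>)
    from lebesgue_on_integral_eq(1)[OF _ S(1) gm2 this] g(2) show ?thesis by auto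
  qed
  define z where "z t = w' t - a * indicator ?S t" for t
  have [measurable]: "z \<in> borel_measurable borel" unfolding z_def[abs_def] by measurable
  have wi: "integrable lborel w'" by (rule integrable_of_square_integrable[OF w' w'0 w2(1)])
  have ai: "integrable lborel (\<lambda>t. c * indicator ?S t :: real)" for c
    using T by (intro integrable_mult_right integrable_real_indicator) auto
  have zi: "integrable lborel z" unfolding z_def[abs_def]
    by (intro Bochner_Integration.integrable_diff wi ai)
  have z0: "z x = 0" if "x \<notin> ?S" for x using that w'0 by (simp add: z_def)
  have cz: "causal z" by (rule causal_integrableI[OF zi]) (auto intro: z0)
  have volterra: "AE t in lborel. t \<in> ?S \<longrightarrow> (k \<star> z) t = (heaviside \<star> g') t"
    using eq unfolding AE_lebesgue_on_iff[OF S(2)]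
  proof eventually_elim
    case (elim t)
    show ?case
    proof
      assume t: "t \<in> ?S"
      have "(\<integral>s. k (t - s) * (w s - a) \<partial>lebesgue_on {0<..<t}) = (\<integral>s. k (t - s) * z s \<partial>lborel)"
      proof (rule lebesgue_on_integral_eq)
        have km: "(\<lambda>s. k (t - s)) \<in> borel_measurable (lebesgue_on {0<..<t})"
          by (intro measurable_restrict_space1 measurable_completion) measurable
        have "w \<in> borel_measurable (lebesgue_on {0<..<t})"
          by (rule measurable_restrict_mono[OF w(1)]) (use t in auto)
        then show "(\<lambda>s. k (t - s) * (w s - a)) \<in> borel_measurable (lebesgue_on {0<..<t})"
          using km by (intro borel_measurable_times borel_measurable_diff) auto
        show "AE s in lborel. k (t - s) * z s = indicator {0<..<t} s * (k (t - s) * (w s - a))"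
          using ww'
        proof eventually_elim
          case (elim s)
          then show ?case
            using t z0[of s] causalD(2)[OF k(1), of "t - s"] by (auto simp: z_def indicator_def)
        qed
      qed auto
      moreover have "(\<integral>s. indicator {..t} s * g s \<partial>time_measure T) = (\<integral>s. indicator {..<t} s * g' s \<partial>lborel)"
      proof (rule lebesgue_on_integral_eq)
        have "(\<lambda>s. indicator {..t} s :: real) \<in> borel_measurable (time_measure T)"
          by (intro measurable_restrict_space1 measurable_completion) measurable
        then show "(\<lambda>s. indicator {..t} s * g s) \<in> borel_measurable (time_measure T)"
          using g(1) by (rule borel_measurable_times)
        show "AE s in lborel. indicator {..<t} s * g' s = indicator ?S s * (indicator {..t} s * g s)"
          using gg' AE_lborel_singleton[of t]
          by eventually_elim (use g'0 in \<open>auto simp: indicator_def\<close>)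
      qed auto
      ultimately show "(k \<star> z) t = (heaviside \<star> g') t"
        using elim t by (simp add: star_def[of k] heaviside_star_eq)
    qed
  qed
  have sol: "AE t in lborel. t \<in> ?S \<longrightarrow> z t = (l \<star> g') t" "(heaviside \<star> z) T = (L \<star> g') T"
    by (rule solve_volterra[OF cz g' g'0 g2 T volterra]; assumption)+
  have g'0': "g' x = 0" if "x \<le> 0" for x using that by (intro g'0) auto
  have en: "integrable lborel (\<lambda>t. L (T - t) * (g' t * (l \<star> g') t))"
    "(\<integral>t. indicator {..<T} t * ((l \<star> g') t)\<^sup>2 \<partial>lborel) / 2 \<le> (\<integral>t. L (T - t) * (g' t * (l \<star> g') t) \<partial>lborel)"
    by (rule energy_inequality[OF T g' g'0' g2]; assumption)+
  have gi: "integrable lborel g'" by (rule integrable_of_square_integrable[OF g' g'0 g2])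
  have cg: "causal g'" by (rule causal_integrableI[OF gi g'0'])
  have z2: "(\<integral>t. indicator {..<T} t * ((l \<star> g') t)\<^sup>2 \<partial>lborel) = (\<integral>t. (z t)\<^sup>2 \<partial>lborel)"
  proof (rule integral_cong_AE)
    show "AE t in lborel. indicator {..<T} t * ((l \<star> g') t)\<^sup>2 = (z t)\<^sup>2"
      using sol(1)
    proof eventually_elim
      case (elim t)
      then show ?case using z0[of t] star_eq_0[OF l(1) cg, of t] by (cases "0 < t") (auto simp: indicator_def)
    qed
  qed measurable
  have gz_ae: "AE t in lborel. L (T - t) * (g' t * (l \<star> g') t) = L (T - t) * (g' t * z t)"
    using sol(1) by eventually_elim (use g'0 in auto)
  have gz: "(\<integral>t. L (T - t) * (g' t * (l \<star> g') t) \<partial>lborel) = (\<integral>t. L (T - t) * (g' t * z t) \<partial>lborel)"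
    by (rule integral_cong_AE[OF _ _ gz_ae]) measurable
  have gzi: "integrable lborel (\<lambda>t. L (T - t) * (g' t * z t))"
    by (rule integrable_cong_AE_imp[OF en(1) _ gz_ae]) measurable
  have Lg: "integrable lborel (\<lambda>t. L (T - t) * g' t)"
    using star_integrable_causal'[OF cg causal_bounded_L] .
  have "(\<integral>t. (w' t)\<^sup>2 \<partial>lborel) = (\<integral>t. (z t)\<^sup>2 \<partial>lborel) + 2 * a * (\<integral>t. z t \<partial>lborel) + a\<^sup>2 * T"
  proof -
    have p: "(z t)\<^sup>2 = (w' t)\<^sup>2 - 2 * a * w' t + a\<^sup>2 * indicator ?S t" for t
      using w'0[of t] by (auto simp: z_def indicator_def power2_eq_square algebra_simps)
    have "(\<integral>t. (z t)\<^sup>2 \<partial>lborel) = (\<integral>t. (w' t)\<^sup>2 \<partial>lborel) - 2 * a * (\<integral>t. w' t \<partial>lborel) + a\<^sup>2 * T"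
      unfolding p using T w2(1) wi ai by simp
    moreover have "(\<integral>t. z t \<partial>lborel) = (\<integral>t. w' t \<partial>lborel) - a * T"
      unfolding z_def using T wi ai by simp
    ultimately show ?thesis by (simp only: power2_eq_square) (simp add: algebra_simps)
  qed
  moreover have "(\<integral>t. z t \<partial>lborel) = (\<integral>t. L (T - t) * g' t \<partial>lborel)"
  proof -
    have ind: "indicator {..<T} t * z t = z t" for t using z0[of t] by (auto simp: indicator_def)
    then show ?thesis using sol(2) by (simp only: heaviside_star_eq star_def[of L] ind)
  qed
  moreover have "(\<integral>t. L (T - t) * (g t * w t) \<partial>time_measure T)
      = (\<integral>t. L (T - t) * (g' t * z t) \<partial>lborel) + a * (\<integral>t. L (T - t) * g' t \<partial>lborel)"
  proof -
    have "(\<integral>t. L (T - t) * (g t * w t) \<partial>time_measure T) = (\<integral>t. L (T - t) * (g' t * z t) + a * (L (T - t) * g' t) \<partial>lborel)"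
    proof (rule lebesgue_on_integral_eq)
      have "(\<lambda>t. L (T - t)) \<in> borel_measurable (time_measure T)"
        by (intro measurable_restrict_space1 measurable_completion) measurable
      then show "(\<lambda>t. L (T - t) * (g t * w t)) \<in> borel_measurable (time_measure T)"
        using g(1) w(1) by (intro borel_measurable_times)
      show "AE t in lborel. L (T - t) * (g' t * z t) + a * (L (T - t) * g' t) = indicator ?S t * (L (T - t) * (g t * w t))"
        using ww' gg' by eventually_elim (use g'0 in \<open>auto simp: z_def indicator_def algebra_simps\<close>)
    qed auto
    also have "\<dots> = (\<integral>t. L (T - t) * (g' t * z t) \<partial>lborel) + a * (\<integral>t. L (T - t) * g' t \<partial>lborel)"
      using gzi Lg by simp
    finally show ?thesis .
  qed
  ultimately show ?thesis
    using en(2) unfolding z2 gz w2(2) by (simp add: field_simps)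
qed

end

section \<open>From scalars to a Hilbert space\<close>

text \<open>
  The orthogonal projection onto the span of a finite orthogonal set. The set may contain \<open>0\<close>,
  which contributes nothing because \<open>x / 0 = 0\<close>.
\<close>

definition orth_proj :: "'a::real_inner set \<Rightarrow> 'a \<Rightarrow> 'a" where
  "orth_proj C x = (\<Sum>c\<in>C. ((x \<bullet> c) / (c \<bullet> c)) *\<^sub>R c)"

lemma orth_proj_residual:
  assumes "finite C" "pairwise orthogonal C" "y \<in> span C"
  shows "orthogonal (x - orth_proj C x) y"
proof (rule orthogonal_to_span[OF assms(3)])
  fix c assume c: "c \<in> C"
  have "orth_proj C x \<bullet> c = (\<Sum>b\<in>C. (x \<bullet> b) / (b \<bullet> b) * (b \<bullet> c))"
    unfolding orth_proj_def by (simp add: inner_sum_left)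
  also have "\<dots> = (\<Sum>b\<in>C. if b = c then x \<bullet> c else 0)"
  proof (rule sum.cong)
    fix b assume "b \<in> C"
    then show "(x \<bullet> b) / (b \<bullet> b) * (b \<bullet> c) = (if b = c then x \<bullet> c else 0)"
      using assms(2) c by (auto simp: pairwise_def orthogonal_def)
  qed simp
  also have "\<dots> = x \<bullet> c" using assms(1) c by simp
  finally show "orthogonal (x - orth_proj C x) c" by (simp add: orthogonal_def inner_diff_left)
qed

lemma orth_proj_in_span: "orth_proj C x \<in> span C"
  unfolding orth_proj_def by (intro span_sum span_scale span_base)

lemma orth_proj_pythagoras:
  assumes "finite C" "pairwise orthogonal C" "y \<in> span C"
  shows "(norm (x - y))\<^sup>2 = (norm (x - orth_proj C x))\<^sup>2 + (norm (orth_proj C x - y))\<^sup>2"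
  using norm_add_Pythagorean[OF orth_proj_residual[OF assms(1,2), of "orth_proj C x - y" x]]
    span_diff[OF orth_proj_in_span assms(3)] by simp

text \<open>
  Parseval's identity; with \<open>g = x\<close> it reads \<open>\<parallel>P x\<parallel>\<^sup>2 = \<Sum> (x, c)\<^sup>2 / (c, c)\<close>.
\<close>

lemma orth_proj_inner: "g \<bullet> orth_proj C x = (\<Sum>c\<in>C. (g \<bullet> c) * (x \<bullet> c) / (c \<bullet> c))"
  unfolding orth_proj_def by (simp add: inner_sum_right mult.commute)

lemma norm_orth_proj_le:
  assumes "finite C" "pairwise orthogonal C"
  shows "norm (orth_proj C x) \<le> norm x"
proof -
  have "(norm (orth_proj C x))\<^sup>2 \<le> (norm x)\<^sup>2"
    using orth_proj_pythagoras[OF assms span_zero, of x] by simp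
  then show ?thesis by (rule power2_le_imp_le) simp
qed

text \<open>
  The projection realises the distance to its range, and the ranges eventually contain every point
  of the dense sequence.
\<close>

lemma orth_proj_tendsto:
  assumes C: "\<And>n. finite (C n)" "\<And>n. pairwise orthogonal (C n)" "\<And>n. span (C n) = span (d ` {..n::nat})"
    and x: "x \<in> closure (range d)"
  shows "(\<lambda>n. orth_proj (C n) x) \<longlonglongrightarrow> x"
proof (rule tendstoI)
  fix \<epsilon> :: real assume "0 < \<epsilon>"
  then obtain m where m: "dist (d m) x < \<epsilon>"
    using x by (auto simp: closure_approachable)
  have "dist (orth_proj (C n) x) x < \<epsilon>" if "n \<ge> m" for n
  proof -
    have "d m \<in> span (C n)" unfolding C(3) using that by (intro span_base) auto
    from orth_proj_pythagoras[OF C(1,2) this, of x]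
    have "(norm (x - orth_proj (C n) x))\<^sup>2 \<le> (norm (x - d m))\<^sup>2" by simp
    then have "norm (x - orth_proj (C n) x) \<le> norm (x - d m)" by (rule power2_le_imp_le) simp
    then show ?thesis using m by (simp add: dist_norm norm_minus_commute)
  qed
  then show "\<forall>\<^sub>F n in sequentially. dist (orth_proj (C n) x) x < \<epsilon>"
    by (auto simp: eventually_sequentially)
qed

text \<open>
  Strongly measurable functions are almost separably valued. This is what makes countably many
  directions sufficient in a Hilbert space that need not be separable.
\<close>

lemma strongly_measurable_separable:
  assumes "strongly_measurable M f"
  obtains d :: "nat \<Rightarrow> 'a::real_normed_vector" where "AE x in M. f x \<in> closure (range d)"
proof -
  obtain s where s: "\<And>n::nat. simple_function M (s n)" and lim: "AE x in M. (\<lambda>n. s n x) \<longlonglongrightarrow> f x"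
    using assms unfolding strongly_measurable_def by auto
  \<comment> \<open>Inserting \<open>0\<close> makes the set nonempty, so that it can be enumerated.\<close>
  let ?D = "insert 0 (\<Union>n. s n ` space M)"
  have "countable (s n ` space M)" for n
    using s[of n] by (auto simp: simple_function_def intro: countable_finite)
  then have "countable ?D" by (intro countable_insert countable_UN) auto
  then have D: "range (from_nat_into ?D) = ?D" by (intro range_from_nat_into) auto
  have "AE x in M. f x \<in> closure (range (from_nat_into ?D))"
    using lim AE_space
  proof eventually_elim
    case (elim x)
    then show ?case
      unfolding D closure_sequential by (intro exI[of _ "\<lambda>n. s n x"]) auto
  qed
  then show ?thesis by (rule that)
qed

lemma strongly_measurable_time_borel:
  fixes f :: "real \<Rightarrow> real"
  shows "strongly_measurable (time_measure T) f \<longleftrightarrow> f \<in> borel_measurable (time_measure T)"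
  by (rule strongly_measurable_iff_borel) simp

lemma L2_inner_integrable:
  fixes f g :: "real \<Rightarrow> 'a::real_inner"
  assumes f: "L2 T f" and g: "L2 T g"
  shows "(\<lambda>t. f t \<bullet> g t) \<in> borel_measurable (time_measure T)"
    and "integrable (time_measure T) (\<lambda>t. norm (f t) * norm (g t))"
    and "integrable (time_measure T) (\<lambda>t. f t \<bullet> g t)"
proof -
  let ?M = "time_measure T"
  have sm: "strongly_measurable ?M f" "strongly_measurable ?M g" and
    i: "integrable ?M (\<lambda>t. (norm (f t))\<^sup>2)" "integrable ?M (\<lambda>t. (norm (g t))\<^sup>2)"
    using f g by (auto simp: L2_def)
  show m: "(\<lambda>t. f t \<bullet> g t) \<in> borel_measurable ?M"
    using strongly_measurable_inner[OF sm] by (simp add: strongly_measurable_time_borel)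
  have nm: "(\<lambda>t. norm (f t)) \<in> borel_measurable ?M" "(\<lambda>t. norm (g t)) \<in> borel_measurable ?M"
    using strongly_measurable_norm sm by (simp_all add: strongly_measurable_time_borel[symmetric])
  show i2: "integrable ?M (\<lambda>t. norm (f t) * norm (g t))"
  proof (rule Bochner_Integration.integrable_bound)
    show "integrable ?M (\<lambda>t. ((norm (f t))\<^sup>2 + (norm (g t))\<^sup>2) / 2)" using i by auto
    show "AE t in ?M. norm (norm (f t) * norm (g t)) \<le> norm (((norm (f t))\<^sup>2 + (norm (g t))\<^sup>2) / 2)"
    proof (rule AE_I2)
      fix t
      have "norm (norm (f t) * norm (g t)) \<le> ((norm (f t))\<^sup>2 + (norm (g t))\<^sup>2) / 2"
        using mult_le_half_squares[of "norm (f t)" "norm (g t)"] by simp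
      then show "norm (norm (f t) * norm (g t)) \<le> norm (((norm (f t))\<^sup>2 + (norm (g t))\<^sup>2) / 2)"
        by (metis abs_ge_self order_trans real_norm_def)
    qed
  qed (intro borel_measurable_times nm)
  show "integrable ?M (\<lambda>t. f t \<bullet> g t)"
    by (rule Bochner_Integration.integrable_bound[OF i2 m]) (simp add: Cauchy_Schwarz_ineq2)
qed

lemma L2_const: "L2 T (\<lambda>t. c)"
proof -
  have "integrable (time_measure T) (\<lambda>t. (norm c)\<^sup>2 :: real)"
    using emeasure_bounded_finite[of "{0<..<T}"]
    by (intro finite_measure.integrable_const finite_measureI)
      (simp add: emeasure_restrict_space)
  then show ?thesis by (simp add: L2_def strongly_measurable_const)
qed

lemma L2_diff:
  fixes f g :: "real \<Rightarrow> 'a::real_inner"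
  assumes f: "L2 T f" and g: "L2 T g" shows "L2 T (\<lambda>t. f t - g t)"
proof -
  have "integrable (time_measure T) (\<lambda>t. (norm (f t))\<^sup>2 + (norm (g t))\<^sup>2 - 2 * (f t \<bullet> g t))"
    using f g L2_inner_integrable(3)[OF f g] by (auto simp: L2_def)
  moreover have "(norm (f t))\<^sup>2 + (norm (g t))\<^sup>2 - 2 * (f t \<bullet> g t) = (norm (f t - g t))\<^sup>2" for t
    by (simp add: power2_norm_eq_inner inner_diff_left inner_diff_right inner_commute algebra_simps)
  ultimately show ?thesis using f g by (simp add: L2_def strongly_measurable_diff)
qed

lemma L2_norm_integrable:
  fixes f :: "real \<Rightarrow> 'a::real_inner"
  assumes "L2 T f" shows "integrable (time_measure T) (\<lambda>t. norm (f t))"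
proof -
  have "integrable (time_measure T) (\<lambda>t. norm (f t) * norm (norm (1::real)))"
  proof -
    have "L2 T (\<lambda>t. norm (f t))"
      using assms by (auto simp: L2_def strongly_measurable_norm)
    from L2_inner_integrable(2)[OF this L2_const[of T "1::real"]] show ?thesis by simp
  qed
  then show ?thesis by simp
qed

lemma L2_inner:
  fixes f :: "real \<Rightarrow> 'h::real_inner"
  assumes f: "L2 T f"
  shows "L2 T (\<lambda>t. f t \<bullet> e)"
proof -
  let ?M = "time_measure T"
  have m: "(\<lambda>t. f t \<bullet> e) \<in> borel_measurable ?M" by (rule L2_inner_integrable(1)[OF f L2_const])
  have "integrable ?M (\<lambda>t. (norm e)\<^sup>2 * (norm (f t))\<^sup>2)" using f by (simp add: L2_def)
  then have "integrable ?M (\<lambda>t. (f t \<bullet> e)\<^sup>2)"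
  proof (rule Bochner_Integration.integrable_bound)
    show "(\<lambda>t. (f t \<bullet> e)\<^sup>2) \<in> borel_measurable ?M" by (intro borel_measurable_power m)
    show "AE t in ?M. norm ((f t \<bullet> e)\<^sup>2) \<le> norm ((norm e)\<^sup>2 * (norm (f t))\<^sup>2)"
    proof (rule AE_I2)
      fix t
      have "\<bar>f t \<bullet> e\<bar>\<^sup>2 \<le> (norm (f t) * norm e)\<^sup>2"
        by (intro power_mono Cauchy_Schwarz_ineq2) simp
      then show "norm ((f t \<bullet> e)\<^sup>2) \<le> norm ((norm e)\<^sup>2 * (norm (f t))\<^sup>2)"
        by (simp add: power_mult_distrib mult.commute)
    qed
  qed
  then show ?thesis using m by (simp add: L2_def strongly_measurable_time_borel)
qed

context kernel_pair
begin

lemma L_weight: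
  shows "(\<lambda>t. L (T - t)) \<in> borel_measurable (time_measure T)"
    and "t \<in> {0<..<T} \<Longrightarrow> \<bar>L (T - t)\<bar> \<le> L T"
proof -
  show "(\<lambda>t. L (T - t)) \<in> borel_measurable (time_measure T)"
    by (intro measurable_restrict_space1 measurable_completion) measurable
  show "\<bar>L (T - t)\<bar> \<le> L T" if "t \<in> {0<..<T}"
    using that L_nonneg[of "T - t"] L_mono[of "T - t" T] by auto
qed

lemma L_weight_integrable:
  fixes h :: "real \<Rightarrow> real"
  assumes "integrable (time_measure T) h"
  shows "integrable (time_measure T) (\<lambda>t. L (T - t) * h t)"
proof (rule Bochner_Integration.integrable_bound)
  show "integrable (time_measure T) (\<lambda>t. L T * h t)" using assms by simp
  show "(\<lambda>t. L (T - t) * h t) \<in> borel_measurable (time_measure T)"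
    using assms by (intro borel_measurable_times L_weight) auto
  show "AE t in time_measure T. norm (L (T - t) * h t) \<le> norm (L T * h t)"
    using L_weight(2)[of _ T] L_nonneg[of T] by (intro AE_I2) (auto simp: abs_mult intro!: mult_right_mono)
qed

text \<open>
  Summing the scalar inequality over an orthogonal basis yields the same inequality with the
  projections of \<open>w\<close>, \<open>g\<close> and \<open>w\<^sub>0\<close>. For \<open>w\<^sub>0\<close>, which may be orthogonal to the range of \<open>w\<close>, Bessel's inequality
  is enough; only the projections of \<open>w\<close> have to converge.
\<close>

lemma energy_inequality_vector:
  fixes w g :: "real \<Rightarrow> 'h::real_inner"
  assumes w: "L2 T w" and g: "L2 T g"
    and scalar: "\<And>e. (\<integral>t. (w t \<bullet> e)\<^sup>2 \<partial>time_measure T) / 2 - T * (w0 \<bullet> e)\<^sup>2 / 2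
      \<le> (\<integral>t. L (T - t) * ((g t \<bullet> e) * (w t \<bullet> e)) \<partial>time_measure T)"
    and T: "0 < T"
  shows "(\<integral>t. (norm (w t))\<^sup>2 \<partial>time_measure T) / 2 - T * (norm w0)\<^sup>2 / 2
    \<le> (\<integral>t. L (T - t) * (g t \<bullet> w t) \<partial>time_measure T)"
proof -
  let ?M = "time_measure T"
  have "strongly_measurable ?M w" using w by (simp add: L2_def)
  then obtain d :: "nat \<Rightarrow> 'h" where d: "AE t in ?M. w t \<in> closure (range d)"
    by (rule strongly_measurable_separable)
  have "\<exists>C. finite C \<and> card C \<le> card (d ` {..n}) \<and> span C = span (d ` {..n}) \<and> pairwise orthogonal C" for n
    by (rule basis_orthogonal) simp
  then obtain C where C: "\<And>n. finite (C n)" "\<And>n. span (C n) = span (d ` {..n})" "\<And>n. pairwise orthogonal (C n)"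
    by metis
  let ?P = "\<lambda>n. orth_proj (C n)"
  note P_lim = orth_proj_tendsto[OF C(1,3,2)]
  have we: "(\<lambda>t. w t \<bullet> e) \<in> borel_measurable ?M" "L2 T (\<lambda>t. w t \<bullet> e)"
    and ge: "L2 T (\<lambda>t. g t \<bullet> e)" for e
  proof -
    show "L2 T (\<lambda>t. w t \<bullet> e)" "L2 T (\<lambda>t. g t \<bullet> e)" by (rule L2_inner[OF w] L2_inner[OF g])+
    show "(\<lambda>t. w t \<bullet> e) \<in> borel_measurable ?M" by (rule L2_inner_integrable(1)[OF w L2_const])
  qed
  have w2i: "integrable ?M (\<lambda>t. (w t \<bullet> e)\<^sup>2)" for e
    using we(2)[of e] by (simp add: L2_def)
  have gwi: "integrable ?M (\<lambda>t. L (T - t) * ((g t \<bullet> e) * (w t \<bullet> e)))" for e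
    using L2_inner_integrable(3)[OF ge we(2), of e e] by (intro L_weight_integrable) simp
  have step: "(\<integral>t. w t \<bullet> ?P n (w t) \<partial>?M) / 2 - T * (norm w0)\<^sup>2 / 2
      \<le> (\<integral>t. L (T - t) * (g t \<bullet> ?P n (w t)) \<partial>?M)" for n
  proof -
    let ?C = "C n"
    have 1: "(\<integral>t. w t \<bullet> ?P n (w t) \<partial>?M) = (\<Sum>c\<in>?C. (\<integral>t. (w t \<bullet> c)\<^sup>2 \<partial>?M) / (c \<bullet> c))"
    proof -
      have "(\<integral>t. w t \<bullet> ?P n (w t) \<partial>?M) = (\<integral>t. (\<Sum>c\<in>?C. (w t \<bullet> c)\<^sup>2 / (c \<bullet> c)) \<partial>?M)"
        by (simp add: orth_proj_inner power2_eq_square)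
      also have "\<dots> = (\<Sum>c\<in>?C. (\<integral>t. (w t \<bullet> c)\<^sup>2 / (c \<bullet> c) \<partial>?M))"
        by (rule Bochner_Integration.integral_sum) (use w2i in auto)
      finally show ?thesis by simp
    qed
    have 2: "(\<integral>t. L (T - t) * (g t \<bullet> ?P n (w t)) \<partial>?M)
        = (\<Sum>c\<in>?C. (\<integral>t. L (T - t) * ((g t \<bullet> c) * (w t \<bullet> c)) \<partial>?M) / (c \<bullet> c))"
    proof -
      have "(\<integral>t. L (T - t) * (g t \<bullet> ?P n (w t)) \<partial>?M)
          = (\<integral>t. (\<Sum>c\<in>?C. L (T - t) * ((g t \<bullet> c) * (w t \<bullet> c)) / (c \<bullet> c)) \<partial>?M)"
        by (simp add: orth_proj_inner sum_distrib_left)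
      also have "\<dots> = (\<Sum>c\<in>?C. (\<integral>t. L (T - t) * ((g t \<bullet> c) * (w t \<bullet> c)) / (c \<bullet> c) \<partial>?M))"
        by (rule Bochner_Integration.integral_sum) (use gwi in auto)
      finally show ?thesis by simp
    qed
    have 3: "(\<Sum>c\<in>?C. (w0 \<bullet> c)\<^sup>2 / (c \<bullet> c)) \<le> (norm w0)\<^sup>2"
    proof -
      have "(\<Sum>c\<in>?C. (w0 \<bullet> c)\<^sup>2 / (c \<bullet> c)) = w0 \<bullet> ?P n w0"
        by (simp add: orth_proj_inner power2_eq_square)
      also have "\<dots> \<le> norm w0 * norm (?P n w0)" by (rule norm_cauchy_schwarz)
      also have "\<dots> \<le> norm w0 * norm w0"
        by (intro mult_left_mono norm_orth_proj_le C) auto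
      finally show ?thesis by (simp add: power2_eq_square)
    qed
    have "(\<Sum>c\<in>?C. ((\<integral>t. (w t \<bullet> c)\<^sup>2 \<partial>?M) / 2 - T * (w0 \<bullet> c)\<^sup>2 / 2) / (c \<bullet> c))
        \<le> (\<Sum>c\<in>?C. (\<integral>t. L (T - t) * ((g t \<bullet> c) * (w t \<bullet> c)) \<partial>?M) / (c \<bullet> c))"
      by (intro sum_mono divide_right_mono scalar) simp
    also have "(\<Sum>c\<in>?C. ((\<integral>t. (w t \<bullet> c)\<^sup>2 \<partial>?M) / 2 - T * (w0 \<bullet> c)\<^sup>2 / 2) / (c \<bullet> c))
        = (\<Sum>c\<in>?C. (\<integral>t. (w t \<bullet> c)\<^sup>2 \<partial>?M) / (c \<bullet> c)) / 2 - T / 2 * (\<Sum>c\<in>?C. (w0 \<bullet> c)\<^sup>2 / (c \<bullet> c))"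
      by (simp add: diff_divide_distrib sum_subtractf sum_divide_distrib sum_distrib_left mult_ac)
    finally have "(\<Sum>c\<in>?C. (\<integral>t. (w t \<bullet> c)\<^sup>2 \<partial>?M) / (c \<bullet> c)) / 2 - T / 2 * (\<Sum>c\<in>?C. (w0 \<bullet> c)\<^sup>2 / (c \<bullet> c))
      \<le> (\<integral>t. L (T - t) * (g t \<bullet> ?P n (w t)) \<partial>?M)" unfolding 2 .
    moreover have "T / 2 * (\<Sum>c\<in>?C. (w0 \<bullet> c)\<^sup>2 / (c \<bullet> c)) \<le> T / 2 * (norm w0)\<^sup>2"
      using 3 T by (intro mult_left_mono) auto
    ultimately show ?thesis unfolding 1 by simp
  qed
  have ig: "integrable ?M (\<lambda>t. norm (w t) * norm (w t))" "integrable ?M (\<lambda>t. L T * (norm (g t) * norm (w t)))"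
    using L2_inner_integrable(2)[OF w w] L2_inner_integrable(2)[OF g w] by auto
  have Pn_le: "\<bar>x \<bullet> ?P n y\<bar> \<le> norm x * norm y" for n x y
    using Cauchy_Schwarz_ineq2[of x "?P n y"] norm_orth_proj_le[OF C(1,3), of n y]
    by (meson mult_left_mono norm_ge_zero order_trans)
  have Pm: "(\<lambda>t. f t \<bullet> ?P n (w t)) \<in> borel_measurable ?M" if "\<And>e. (\<lambda>t. f t \<bullet> e) \<in> borel_measurable ?M" for f n
    unfolding orth_proj_inner using that we(1)
    by (intro borel_measurable_sum borel_measurable_divide borel_measurable_times) auto
  have gm: "(\<lambda>t. g t \<bullet> e) \<in> borel_measurable ?M" for e by (rule L2_inner_integrable(1)[OF g L2_const])
  have lim1: "(\<lambda>n. \<integral>t. w t \<bullet> ?P n (w t) \<partial>?M) \<longlonglongrightarrow> (\<integral>t. w t \<bullet> w t \<partial>?M)"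
  proof (rule integral_dominated_convergence[OF _ _ ig(1)])
    show "AE t in ?M. (\<lambda>n. w t \<bullet> ?P n (w t)) \<longlonglongrightarrow> w t \<bullet> w t"
      using d by eventually_elim (intro tendsto_intros P_lim)
    show "AE t in ?M. norm (w t \<bullet> ?P n (w t)) \<le> norm (w t) * norm (w t)" for n
      using Pn_le by auto
  qed (intro Pm we(1) L2_inner_integrable(1)[OF w w])+
  have lim2: "(\<lambda>n. \<integral>t. L (T - t) * (g t \<bullet> ?P n (w t)) \<partial>?M) \<longlonglongrightarrow> (\<integral>t. L (T - t) * (g t \<bullet> w t) \<partial>?M)"
  proof (rule integral_dominated_convergence[OF _ _ ig(2)])
    show "AE t in ?M. (\<lambda>n. L (T - t) * (g t \<bullet> ?P n (w t))) \<longlonglongrightarrow> L (T - t) * (g t \<bullet> w t)"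
      using d by eventually_elim (intro tendsto_intros P_lim)
    show "AE t in ?M. norm (L (T - t) * (g t \<bullet> ?P n (w t))) \<le> L T * (norm (g t) * norm (w t))" for n
    proof (rule AE_I2)
      fix t assume "t \<in> space ?M"
      then show "norm (L (T - t) * (g t \<bullet> ?P n (w t))) \<le> L T * (norm (g t) * norm (w t))"
        using L_weight(2)[of t T] Pn_le[of "g t" n "w t"] L_nonneg[of T] by (auto simp: abs_mult intro!: mult_mono)
    qed
  qed (intro borel_measurable_times L_weight Pm gm L2_inner_integrable(1)[OF g w])+
  show ?thesis
    unfolding power2_norm_eq_inner[of "w _"]
    by (rule LIMSEQ_le[OF tendsto_diff[OF tendsto_divide[OF lim1 tendsto_const] tendsto_const] lim2])
      (use step in auto)
qed

end

section \<open>Differences of strong solutions\<close>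

text \<open>
  The values of the given kernels at times \<open>\<le> 0\<close> are arbitrary and are replaced by \<open>0\<close>.
\<close>

definition on_positive :: "(real \<Rightarrow> real) \<Rightarrow> real \<Rightarrow> real" where
  "on_positive k x = (if 0 < x then k x else 0)"

lemma antimono_on_positive_measurable:
  assumes "antimono_on {0<..} k"
  shows "on_positive k \<in> borel_measurable borel"
proof -
  have "mono_on {0<..} (\<lambda>x. - k x)"
    using assms by (auto simp: monotone_on_def)
  then have "(\<lambda>x. - k x) \<in> borel_measurable (restrict_space borel {0<..})"
    by (rule borel_measurable_mono_on_fnc)
  then have "(\<lambda>x. - k x * indicator {0<..} x) \<in> borel_measurable borel"
    by (subst (asm) borel_measurable_restrict_space_iff) (auto simp: mult.commute)
  then have "(\<lambda>x. - (- k x * indicator {0<..} x)) \<in> borel_measurable borel" by measurable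
  moreover have "- (- k x * indicator {0<..} x) = on_positive k x" for x by (simp add: on_positive_def)
  ultimately show ?thesis by (simp only:)
qed

lemma causal_on_positive:
  assumes anti: "antimono_on {0<..} k" and L1: "L1_loc k"
  shows "causal (on_positive k)"
  unfolding causal_def
proof (intro conjI allI impI)
  show m [measurable]: "on_positive k \<in> borel_measurable borel" by (rule antimono_on_positive_measurable[OF anti])
  show "on_positive k x = 0" if "x \<le> 0" for x using that by (simp add: on_positive_def)
  fix t
  let ?f = "\<lambda>x. indicator {..t} x * on_positive k x"
  have "integrable lebesgue (\<lambda>x. indicator {0..max t 1} x *\<^sub>R k x)"
    using L1 by (auto simp: L1_loc_def set_integrable_def)
  then have "integrable lebesgue ?f"
  proof (rule Bochner_Integration.integrable_bound)
    show "?f \<in> borel_measurable lebesgue" by (intro measurable_completion) measurable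
    show "AE x in lebesgue. norm (?f x) \<le> norm (indicator {0..max t 1} x *\<^sub>R k x)"
      by (intro AE_I2) (auto simp: indicator_def on_positive_def)
  qed
  then show "integrable lborel ?f"
    by (subst (asm) integrable_completion) measurable
qed

lemma kernel_pair_of_PC:
  assumes "PC k l"
  shows "kernel_pair (on_positive k) (on_positive l)"
proof
  have a: "antimono_on {0<..} k" "antimono_on {0<..} l" and L1: "L1_loc k" "L1_loc l"
    and nn: "\<And>t. t > 0 \<Longrightarrow> 0 \<le> k t" "\<And>t. t > 0 \<Longrightarrow> 0 \<le> l t"
    and conv: "\<And>t. t > 0 \<Longrightarrow> convolution k l t = 1"
    using assms by (auto simp: PC_def)
  show c: "causal (on_positive k)" "causal (on_positive l)" by (intro causal_on_positive a L1)+
  show "0 \<le> on_positive k x" "0 \<le> on_positive l x" for x using nn by (auto simp: on_positive_def)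
  show "on_positive k y \<le> on_positive k x" "on_positive l y \<le> on_positive l x" if "0 < x" "x \<le> y" for x y
    using a that by (auto simp: on_positive_def monotone_on_def)
  fix t :: real assume t: "0 < t"
  note [measurable] = causalD(1)[OF c(1)] causalD(1)[OF c(2)]
  have "(\<integral>s. k (t - s) * l s \<partial>lebesgue_on {0<..<t}) = (\<integral>s. on_positive k (t - s) * on_positive l s \<partial>lborel)"
  proof (rule lebesgue_on_integral_eq)
    have "(\<lambda>s. on_positive k (t - s) * on_positive l s) \<in> borel_measurable (lebesgue_on {0<..<t})"
      by (intro measurable_restrict_space1 measurable_completion) measurable
    then show "(\<lambda>s. k (t - s) * l s) \<in> borel_measurable (lebesgue_on {0<..<t})"
      by (rule measurable_cong[THEN iffD1, rotated]) (auto simp: on_positive_def)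
    show "AE s in lborel. on_positive k (t - s) * on_positive l s = indicator {0<..<t} s * (k (t - s) * l s)"
      by (intro AE_I2) (auto simp: on_positive_def indicator_def)
  qed auto
  then show "(on_positive k \<star> on_positive l) t = 1"
    using conv[OF t] unfolding convolution_def star_def
    by (simp add: bochner_int_eq_lebesgue_integral)
qed

text \<open>
  For merely integrable \<open>n\<close> the convolution integral exists at almost every time.
\<close>

lemma star_integrable_AE:
  assumes a: "causal a" "\<And>x. 0 \<le> a x" and n [measurable]: "integrable lborel n"
    and n0: "\<And>x. x \<le> 0 \<Longrightarrow> n x = 0"
  shows "AE t in lborel. t < T \<longrightarrow> integrable lborel (\<lambda>s. a (t - s) * n s)"
proof -
  note [measurable] = causalD(1)[OF a(1)]
  have "(\<integral>\<^sup>+t. indicator {..<T} t * (\<integral>\<^sup>+s. ennreal (a (t - s)) * ennreal \<bar>n s\<bar> \<partial>lborel) \<partial>lborel)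
      \<le> ennreal ((heaviside \<star> a) T) * (\<integral>\<^sup>+s. ennreal \<bar>n s\<bar> \<partial>lborel)"
    by (rule nn_conv_integral_le[OF a]) (auto simp: n0)
  also have "\<dots> < \<infinity>"
    using n by (simp add: integrable_iff_bounded ennreal_mult_less_top)
  finally have "AE t in lborel. indicator {..<T} t * (\<integral>\<^sup>+s. ennreal (a (t - s)) * ennreal \<bar>n s\<bar> \<partial>lborel) \<noteq> \<infinity>"
    by (intro nn_integral_noteq_infinite) auto
  then show ?thesis
  proof eventually_elim
    case (elim t)
    show ?case
    proof
      assume "t < T"
      then have "(\<integral>\<^sup>+s. ennreal (a (t - s) * \<bar>n s\<bar>) \<partial>lborel) < \<infinity>"
        using elim a(2) by (simp add: less_top ennreal_mult')
      then show "integrable lborel (\<lambda>s. a (t - s) * n s)"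
        using a(2) by (intro integrableI_bounded) (auto simp: abs_mult)
    qed
  qed
qed

lemma bochner_int_cong:
  assumes eq: "\<And>x. x \<in> space M \<Longrightarrow> f x = g x"
  shows "bochner_int M f = bochner_int M g"
proof -
  have "strongly_measurable M f \<longleftrightarrow> strongly_measurable M g"
    unfolding strongly_measurable_def using eq by (simp cong: AE_cong)
  moreover have "(\<integral>\<^sup>+ x. ennreal (norm (f x - s x)) \<partial>M) = (\<integral>\<^sup>+ x. ennreal (norm (g x - s x)) \<partial>M)" for s
    using eq by (intro nn_integral_cong) simp
  ultimately have "has_bochner_int M f = has_bochner_int M g"
    unfolding has_bochner_int_def by (intro ext) (simp only:)
  then show ?thesis unfolding bochner_int_def by (simp only:)
qed

text \<open>
  At almost every time the vector-valued convolution integral exists, simultaneously for all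
  directions \<open>e\<close>, and commutes with the inner product.
\<close>

lemma convolution_inner_AE:
  fixes w :: "real \<Rightarrow> 'h::{real_inner, banach}"
  assumes k: "causal (on_positive k)" "\<And>x. 0 \<le> on_positive k x"
    and w: "strongly_measurable (time_measure T) w" "integrable (time_measure T) (\<lambda>t. norm (w t))"
  shows "AE t in time_measure T. \<forall>e. integrable (lebesgue_on {0<..<t}) (\<lambda>s. on_positive k (t - s) * (w s \<bullet> e)) \<and>
    convolution k w t \<bullet> e = (\<integral>s. on_positive k (t - s) * (w s \<bullet> e) \<partial>lebesgue_on {0<..<t})"
proof -
  note [measurable] = causalD(1)[OF k(1)]
  let ?S = "{0<..<T}"
  have wm: "(\<lambda>t. norm (w t)) \<in> borel_measurable (time_measure T)" using w(2) by auto
  obtain n where n [measurable]: "n \<in> borel_measurable borel" and n0: "\<And>x. x \<notin> ?S \<Longrightarrow> n x = 0"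
    and nw: "AE x in lborel. x \<in> ?S \<longrightarrow> n x = norm (w x)"
    by (rule borel_representative[OF wm, of thesis]) auto
  have "AE x in lborel. n x = indicator ?S x * norm (w x)"
    using nw by eventually_elim (use n0 in \<open>auto simp: indicator_def\<close>)
  from lebesgue_on_integral_eq(1)[OF n _ wm this] w(2) have ni: "integrable lborel n" by simp
  have "AE t in lborel. t < T \<longrightarrow> integrable lborel (\<lambda>s. on_positive k (t - s) * n s)"
    by (rule star_integrable_AE[OF k ni]) (auto intro: n0)
  then have "AE t in lborel. t \<in> ?S \<longrightarrow> (\<forall>e. integrable (lebesgue_on {0<..<t}) (\<lambda>s. on_positive k (t - s) * (w s \<bullet> e)) \<and>
    convolution k w t \<bullet> e = (\<integral>s. on_positive k (t - s) * (w s \<bullet> e) \<partial>lebesgue_on {0<..<t}))"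
  proof eventually_elim
    case (elim t)
    show ?case
    proof (intro impI allI)
      fix e
      assume t: "t \<in> ?S"
      let ?R = "{0<..<t}"
      have R: "?R \<in> sets lebesgue" "?R \<subseteq> ?S" "?S \<in> sets lebesgue" using t by auto
      have km: "(\<lambda>s. on_positive k (t - s)) \<in> borel_measurable (lebesgue_on ?R)"
        by (intro measurable_restrict_space1 measurable_completion) measurable
      have "strongly_measurable (lebesgue_on ?R) w"
        by (rule strongly_measurable_restrict[OF w(1) R(3,1,2)])
      moreover have ksm: "strongly_measurable (lebesgue_on ?R) (\<lambda>s. on_positive k (t - s))"
        using km by (simp add: strongly_measurable_iff_borel)
      ultimately have sm: "strongly_measurable (lebesgue_on ?R) (\<lambda>s. on_positive k (t - s) *\<^sub>R w s)"
        by (intro strongly_measurable_scaleR)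
      have nm: "(\<lambda>s. norm (on_positive k (t - s) *\<^sub>R w s)) \<in> borel_measurable (lebesgue_on ?R)"
        using strongly_measurable_norm[OF sm] by (simp add: strongly_measurable_iff_borel)
      have "AE s in lborel. on_positive k (t - s) * n s = indicator ?R s * norm (on_positive k (t - s) *\<^sub>R w s)"
        using nw
      proof eventually_elim
        case (elim s)
        then show ?case using n0[of s] k(2)[of "t - s"] t
          by (auto simp: indicator_def on_positive_def)
      qed
      from lebesgue_on_integral_eq(1)[OF _ _ nm this]
      have ki: "integrable (lebesgue_on ?R) (\<lambda>s. norm (on_positive k (t - s) *\<^sub>R w s))"
        using elim t by simp
      have fin: "emeasure lebesgue ?R < \<infinity>" using emeasure_bounded_finite[of ?R] by simp
      have im: "(\<lambda>s. (on_positive k (t - s) *\<^sub>R w s) \<bullet> e) \<in> borel_measurable (lebesgue_on ?R)"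
        using strongly_measurable_inner[OF sm strongly_measurable_const] by (simp add: strongly_measurable_iff_borel)
      have "integrable (lebesgue_on ?R) (\<lambda>s. norm e * norm (on_positive k (t - s) *\<^sub>R w s))"
        by (rule integrable_mult_right[OF ki])
      then have "integrable (lebesgue_on ?R) (\<lambda>s. (on_positive k (t - s) *\<^sub>R w s) \<bullet> e)"
      proof (rule Bochner_Integration.integrable_bound[OF _ im])
        show "AE s in lebesgue_on ?R. norm ((on_positive k (t - s) *\<^sub>R w s) \<bullet> e)
            \<le> norm (norm e * norm (on_positive k (t - s) *\<^sub>R w s))"
        proof (rule AE_I2)
          fix s
          show "norm ((on_positive k (t - s) *\<^sub>R w s) \<bullet> e) \<le> norm (norm e * norm (on_positive k (t - s) *\<^sub>R w s))"
            using Cauchy_Schwarz_ineq2[of "on_positive k (t - s) *\<^sub>R w s" e] by (simp add: mult.commute)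
        qed
      qed
      moreover have "convolution k w t = bochner_int (lebesgue_on ?R) (\<lambda>s. on_positive k (t - s) *\<^sub>R w s)"
      proof -
        have "convolution k w t = bochner_int (lebesgue_on ?R) (\<lambda>s. k (t - s) *\<^sub>R w s)"
          by (simp add: convolution_def)
        also have "\<dots> = bochner_int (lebesgue_on ?R) (\<lambda>s. on_positive k (t - s) *\<^sub>R w s)"
          by (rule bochner_int_cong) (simp add: on_positive_def)
        finally show ?thesis .
      qed
      ultimately show "integrable (lebesgue_on ?R) (\<lambda>s. on_positive k (t - s) * (w s \<bullet> e)) \<and>
          convolution k w t \<bullet> e = (\<integral>s. on_positive k (t - s) * (w s \<bullet> e) \<partial>lebesgue_on ?R)"
        using bochner_int_inner[OF R(1) fin sm ki, of e] by simp
    qed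
  qed
  then show ?thesis by (simp add: AE_lebesgue_on_iff)
qed


lemma test_function_bounds:
  assumes "test_function T \<eta>"
  obtains B where "\<eta> \<in> borel_measurable (time_measure T)" "deriv \<eta> \<in> borel_measurable (time_measure T)"
    "\<And>t. t \<in> {0..T} \<Longrightarrow> \<bar>\<eta> t\<bar> \<le> B" "\<And>t. t \<in> {0..T} \<Longrightarrow> \<bar>deriv \<eta> t\<bar> \<le> B"
proof -
  have d: "(deriv ^^ n) \<eta> differentiable (at t)" for n t
    using assms by (simp add: test_function_def)
  have c: "continuous_on A \<eta>" "continuous_on A (deriv \<eta>)" for A
    using d[of 0] d[of 1]
    by (auto intro!: continuous_at_imp_continuous_on differentiable_imp_continuous_within)
  have m: "f \<in> borel_measurable (time_measure T)" if "\<And>A. continuous_on A f" for f :: "real \<Rightarrow> real"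
    by (intro continuous_imp_measurable_on_sets_lebesgue that) simp
  have b: "\<exists>B. \<forall>t\<in>{0..T}. \<bar>f t\<bar> \<le> B" if "\<And>A. continuous_on A f" for f :: "real \<Rightarrow> real"
  proof -
    have "bounded (f ` {0..T})"
      by (intro compact_imp_bounded compact_continuous_image that) simp
    then show ?thesis unfolding bounded_iff by auto
  qed
  obtain B1 B2 where "\<forall>t\<in>{0..T}. \<bar>\<eta> t\<bar> \<le> B1" "\<forall>t\<in>{0..T}. \<bar>deriv \<eta> t\<bar> \<le> B2"
    using b[of \<eta>] b[of "deriv \<eta>"] c by metis
  then show ?thesis
    by (intro that[of "max B1 B2"] m c) (auto simp: le_max_iff_disj)
qed

lemma bochner_int_scaleR_inner:
  fixes v :: "real \<Rightarrow> 'h::{real_inner, banach}"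
  assumes v: "L2 T v" and m: "m \<in> borel_measurable (time_measure T)"
    and B: "\<And>t. t \<in> {0..T} \<Longrightarrow> \<bar>m t\<bar> \<le> B"
  shows "bochner_int (time_measure T) (\<lambda>t. m t *\<^sub>R v t) \<bullet> e = (\<integral>t. m t * (v t \<bullet> e) \<partial>time_measure T)"
proof -
  have sm: "strongly_measurable (time_measure T) (\<lambda>t. m t *\<^sub>R v t)"
    using v m by (intro strongly_measurable_scaleR) (auto simp: strongly_measurable_time_borel L2_def)
  have i: "integrable (time_measure T) (\<lambda>t. norm (m t *\<^sub>R v t))"
  proof (rule Bochner_Integration.integrable_bound)
    show "integrable (time_measure T) (\<lambda>t. B * norm (v t))"
      by (intro integrable_mult_right L2_norm_integrable v)
    show "(\<lambda>t. norm (m t *\<^sub>R v t)) \<in> borel_measurable (time_measure T)"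
      using strongly_measurable_norm[OF sm] by (simp add: strongly_measurable_time_borel)
    show "AE t in time_measure T. norm (norm (m t *\<^sub>R v t)) \<le> norm (B * norm (v t))"
    proof (rule AE_I2)
      fix t assume "t \<in> space (time_measure T)"
      then have "\<bar>m t\<bar> \<le> B" using B by simp
      then have "\<bar>m t\<bar> * norm (v t) \<le> \<bar>B\<bar> * norm (v t)" by (intro mult_right_mono) auto
      then show "norm (norm (m t *\<^sub>R v t)) \<le> norm (B * norm (v t))" by (simp add: abs_mult)
    qed
  qed
  have "emeasure lebesgue {0<..<T} < \<infinity>" using emeasure_bounded_finite[of "{0<..<T}"] by simp
  from bochner_int_inner[OF _ this sm i] show ?thesis by simp
qed

text \<open>
  The equation \<open>k * (u - u\<^sub>0) = 1 * v'\<close> in the direction \<open>e\<close>. The initial value \<open>0\<close> fixes the constant of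
  integration.
\<close>

lemma solution_scalar_equation:
  fixes u v' :: "real \<Rightarrow> 'h::{real_inner, banach}"
  assumes k: "causal (on_positive k)" "\<And>x. 0 \<le> on_positive k x" and u: "L2 T u"
    and init: "has_initial_value T (convolution k (\<lambda>s. u s - u0)) 0"
    and v': "W12_derivative T (convolution k (\<lambda>s. u s - u0)) v'"
  shows "AE t in time_measure T.
      integrable (lebesgue_on {0<..<t}) (\<lambda>s. on_positive k (t - s) * ((u s - u0) \<bullet> e)) \<and>
      (\<integral>s. on_positive k (t - s) * ((u s - u0) \<bullet> e) \<partial>lebesgue_on {0<..<t})
        = (\<integral>s. indicator {..t} s * (v' s \<bullet> e) \<partial>time_measure T)"
proof -
  let ?M = "time_measure T" and ?v = "convolution k (\<lambda>s. u s - u0)"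
  obtain V where V: "continuous_on {0..T} V" "AE t in ?M. V t = ?v t" "V 0 = 0"
    using init unfolding has_initial_value_def by blast
  have L2: "L2 T ?v" "L2 T v'" and weak: "has_weak_derivative T ?v v'"
    using v' by (auto simp: W12_derivative_def)
  have w: "L2 T (\<lambda>s. u s - u0)" by (intro L2_diff u L2_const)
  have Vc: "continuous_on {0..T} (\<lambda>t. V t \<bullet> e)" by (intro continuous_intros V)
  have prim: "V b \<bullet> e = (\<integral>t. indicator {..b} t * (v' t \<bullet> e) \<partial>?M)" if b: "0 < b" "b < T" for b
  proof (rule primitive_of_weak_derivative[OF Vc _ _ _ b])
    show "V 0 \<bullet> e = 0" by (simp add: V)
    show "integrable ?M (\<lambda>t. v' t \<bullet> e)" by (rule L2_inner_integrable(3)[OF L2(2) L2_const])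
    fix \<eta> assume \<eta>: "test_function T \<eta>"
    obtain B where B: "\<eta> \<in> borel_measurable ?M" "deriv \<eta> \<in> borel_measurable ?M"
      "\<And>t. t \<in> {0..T} \<Longrightarrow> \<bar>\<eta> t\<bar> \<le> B" "\<And>t. t \<in> {0..T} \<Longrightarrow> \<bar>deriv \<eta> t\<bar> \<le> B"
      by (rule test_function_bounds[OF \<eta>]) (rule that; assumption)
    have Vm: "(\<lambda>t. V t \<bullet> e) \<in> borel_measurable ?M"
      by (intro continuous_imp_measurable_on_sets_lebesgue continuous_on_subset[OF Vc]) auto
    have "(\<integral>t. deriv \<eta> t * (V t \<bullet> e) \<partial>?M) = (\<integral>t. deriv \<eta> t * (?v t \<bullet> e) \<partial>?M)"
    proof (rule integral_cong_AE)
      show "(\<lambda>t. deriv \<eta> t * (V t \<bullet> e)) \<in> borel_measurable ?M"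
        "(\<lambda>t. deriv \<eta> t * (?v t \<bullet> e)) \<in> borel_measurable ?M"
        by (intro borel_measurable_times B Vm L2_inner_integrable(1)[OF L2(1) L2_const])+
      show "AE t in ?M. deriv \<eta> t * (V t \<bullet> e) = deriv \<eta> t * (?v t \<bullet> e)"
        using V(2) by eventually_elim simp
    qed
    also have "\<dots> = bochner_int ?M (\<lambda>t. deriv \<eta> t *\<^sub>R ?v t) \<bullet> e"
      by (rule bochner_int_scaleR_inner[OF L2(1) B(2,4), symmetric])
    also have "\<dots> = (- bochner_int ?M (\<lambda>t. \<eta> t *\<^sub>R v' t)) \<bullet> e"
      using weak \<eta> unfolding has_weak_derivative_def by simp
    also have "\<dots> = - (\<integral>t. \<eta> t * (v' t \<bullet> e) \<partial>?M)"
      using bochner_int_scaleR_inner[OF L2(2) B(1,3), of e] by (simp add: inner_minus_left)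
    finally show "(\<integral>t. deriv \<eta> t * (V t \<bullet> e) \<partial>?M) = - (\<integral>t. \<eta> t * (v' t \<bullet> e) \<partial>?M)" .
  qed
  have "strongly_measurable ?M (\<lambda>s. u s - u0)" using w by (simp add: L2_def)
  from convolution_inner_AE[OF k this L2_norm_integrable[OF w]] V(2) AE_space
  show ?thesis
  proof eventually_elim
    case (elim t)
    then have "0 < t" "t < T" by auto
    from prim[OF this] elim show ?case by metis
  qed
qed

lemma subdifferential_monotone:
  fixes \<phi> :: "'h::real_inner \<Rightarrow> ereal"
  assumes p: "proper_functional \<phi>" and dom: "x \<in> subdiff_domain \<phi>" "y \<in> subdiff_domain \<phi>"
    and sub: "\<xi> \<in> subdifferential \<phi> x" "\<zeta> \<in> subdifferential \<phi> y"
  shows "0 \<le> (\<xi> - \<zeta>) \<bullet> (x - y)"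
proof -
  have d: "x \<in> eff_domain \<phi>" "y \<in> eff_domain \<phi>" using dom by (auto simp: subdiff_domain_def)
  then obtain a b where ab: "\<phi> x = ereal a" "\<phi> y = ereal b"
    using p by (cases "\<phi> x"; cases "\<phi> y") (auto simp: eff_domain_def proper_functional_def)
  have "ereal (\<xi> \<bullet> (y - x)) \<le> \<phi> y - \<phi> x" "ereal (\<zeta> \<bullet> (x - y)) \<le> \<phi> x - \<phi> y"
    using sub d by (auto simp: subdifferential_def)
  then have "\<xi> \<bullet> (y - x) \<le> b - a" "\<zeta> \<bullet> (x - y) \<le> a - b" by (simp_all add: ab)
  moreover have "\<xi> \<bullet> (y - x) = - (\<xi> \<bullet> (x - y))" by (simp add: inner_diff_right)
  ultimately show ?thesis by (simp add: inner_diff_left)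
qed

lemma L2_time_norm_squared: "(L2_time_norm T f)\<^sup>2 = (\<integral>t. (norm (f t))\<^sup>2 \<partial>time_measure T)"
  unfolding L2_time_norm_def by (intro real_sqrt_pow2 Bochner_Integration.integral_nonneg) simp

lemma solution_difference_energy:
  fixes \<phi> :: "real \<Rightarrow> 'h::{real_inner, banach} \<Rightarrow> ereal"
  assumes T: "0 < T" and kp: "kernel_pair (on_positive k) l"
    and s1: "strong_solution_pair T k \<phi> u01 f1 u1 \<xi>1" and s2: "strong_solution_pair T k \<phi> u02 f2 u2 \<xi>2"
    and f: "L2 T f1" "L2 T f2"
    and proper: "\<And>t. t \<in> {0..T} \<Longrightarrow> proper_functional (\<phi> t)"
  shows "(\<integral>t. (norm (u1 t - u2 t))\<^sup>2 \<partial>time_measure T) / 2 - T * (norm (u01 - u02))\<^sup>2 / 2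
    \<le> (\<integral>t. kernel_pair.L l (T - t) * ((f1 t - f2 t) \<bullet> (u1 t - u2 t)) \<partial>time_measure T)"
proof -
  interpret kernel_pair "on_positive k" l by (rule kp)
  let ?M = "time_measure T" and ?w = "\<lambda>t. u1 t - u2 t" and ?f = "\<lambda>t. f1 t - f2 t"
  obtain v1 where v1: "W12_derivative T (convolution k (\<lambda>s. u1 s - u01)) v1" "AE t in ?M. v1 t + \<xi>1 t = f1 t"
    using s1 unfolding strong_solution_pair_def by blast
  obtain v2 where v2: "W12_derivative T (convolution k (\<lambda>s. u2 s - u02)) v2" "AE t in ?M. v2 t + \<xi>2 t = f2 t"
    using s2 unfolding strong_solution_pair_def by blast
  let ?g = "\<lambda>t. v1 t - v2 t"
  have u: "L2 T u1" "L2 T u2" and v: "L2 T v1" "L2 T v2"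
    using s1 s2 v1 v2 by (auto simp: strong_solution_pair_def W12_derivative_def)
  have w: "L2 T ?w" and g: "L2 T ?g" and ff: "L2 T ?f" by (intro L2_diff u v f)+
  have scalar: "(\<integral>t. (?w t \<bullet> e)\<^sup>2 \<partial>?M) / 2 - T * ((u01 - u02) \<bullet> e)\<^sup>2 / 2
      \<le> (\<integral>t. L (T - t) * ((?g t \<bullet> e) * (?w t \<bullet> e)) \<partial>?M)" for e
  proof (rule energy_inequality_with_initial_value[OF T])
    have sq: "integrable ?M (\<lambda>t. (h t \<bullet> e)\<^sup>2)" if h: "L2 T h" for h :: "real \<Rightarrow> 'h"
      using L2_inner[OF h, of e] by (simp add: L2_def)
    show "integrable ?M (\<lambda>t. (?w t \<bullet> e)\<^sup>2)" "integrable ?M (\<lambda>t. (?g t \<bullet> e)\<^sup>2)"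
      by (rule sq[OF w] sq[OF g])+
    show "(\<lambda>t. ?w t \<bullet> e) \<in> borel_measurable ?M" "(\<lambda>t. ?g t \<bullet> e) \<in> borel_measurable ?M"
      by (rule L2_inner_integrable(1)[OF w L2_const] L2_inner_integrable(1)[OF g L2_const])+
    have i1: "has_initial_value T (convolution k (\<lambda>s. u1 s - u01)) 0"
      and i2: "has_initial_value T (convolution k (\<lambda>s. u2 s - u02)) 0"
      using s1 s2 by (auto simp: strong_solution_pair_def)
    have vi: "integrable ?M (\<lambda>s. indicator {..t} s * (v s \<bullet> e))" if v: "L2 T v" for t and v :: "real \<Rightarrow> 'h"
    proof (rule Bochner_Integration.integrable_bound[OF L2_inner_integrable(3)[OF v L2_const[of T e]]])
      show "(\<lambda>s. indicator {..t} s * (v s \<bullet> e)) \<in> borel_measurable ?M"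
        by (intro borel_measurable_times borel_measurable_lebesgue_onI L2_inner_integrable(1)[OF v L2_const]) auto
    qed (auto simp: indicator_def)
    show "AE t in ?M. (\<integral>s. on_positive k (t - s) * (?w s \<bullet> e - (u01 - u02) \<bullet> e) \<partial>lebesgue_on {0<..<t})
        = (\<integral>s. indicator {..t} s * (?g s \<bullet> e) \<partial>?M)"
      using solution_scalar_equation[OF k(1,2) u(1) i1 v1(1), of e]
        solution_scalar_equation[OF k(1,2) u(2) i2 v2(1), of e]
    proof eventually_elim
      case (elim t)
      have "(\<integral>s. on_positive k (t - s) * (?w s \<bullet> e - (u01 - u02) \<bullet> e) \<partial>lebesgue_on {0<..<t})
          = (\<integral>s. on_positive k (t - s) * ((u1 s - u01) \<bullet> e) - on_positive k (t - s) * ((u2 s - u02) \<bullet> e) \<partial>lebesgue_on {0<..<t})"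
        by (simp add: inner_diff_left algebra_simps)
      also have "\<dots> = (\<integral>s. indicator {..t} s * (v1 s \<bullet> e) \<partial>?M) - (\<integral>s. indicator {..t} s * (v2 s \<bullet> e) \<partial>?M)"
        using elim by (subst Bochner_Integration.integral_diff) auto
      also have "\<dots> = (\<integral>s. indicator {..t} s * (?g s \<bullet> e) \<partial>?M)"
        by (subst Bochner_Integration.integral_diff[OF vi[OF v(1)] vi[OF v(2)], symmetric])
          (simp add: inner_diff_left right_diff_distrib)
      finally show ?case .
    qed
  qed
  have "(\<integral>t. (norm (?w t))\<^sup>2 \<partial>?M) / 2 - T * (norm (u01 - u02))\<^sup>2 / 2 \<le> (\<integral>t. L (T - t) * (?g t \<bullet> ?w t) \<partial>?M)"
    by (rule energy_inequality_vector[OF w g scalar T])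
  also have "\<dots> \<le> (\<integral>t. L (T - t) * (?f t \<bullet> ?w t) \<partial>?M)"
  proof (rule integral_mono_AE)
    show "integrable ?M (\<lambda>t. L (T - t) * (?g t \<bullet> ?w t))" "integrable ?M (\<lambda>t. L (T - t) * (?f t \<bullet> ?w t))"
      by (intro L_weight_integrable L2_inner_integrable(3) w g ff)+
    have "AE t in ?M. u1 t \<in> subdiff_domain (\<phi> t)" "AE t in ?M. u2 t \<in> subdiff_domain (\<phi> t)"
      "AE t in ?M. \<xi>1 t \<in> subdifferential (\<phi> t) (u1 t)" "AE t in ?M. \<xi>2 t \<in> subdifferential (\<phi> t) (u2 t)"
      using s1 s2 by (auto simp: strong_solution_pair_def)
    then show "AE t in ?M. L (T - t) * (?g t \<bullet> ?w t) \<le> L (T - t) * (?f t \<bullet> ?w t)"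
      using v1(2) v2(2) AE_space
    proof eventually_elim
      case (elim t)
      then have "proper_functional (\<phi> t)" by (intro proper) auto
      from subdifferential_monotone[OF this] elim
      have "0 \<le> (\<xi>1 t - \<xi>2 t) \<bullet> ?w t" by blast
      moreover have "?f t = ?g t + (\<xi>1 t - \<xi>2 t)" using elim by (metis add_diff_add)
      ultimately have "?g t \<bullet> ?w t \<le> ?f t \<bullet> ?w t" by (simp add: inner_add_left)
      then show ?case by (intro mult_left_mono L_nonneg)
    qed
  qed
  finally show ?thesis .
qed

text \<open>
  With \<open>a b \<le> a\<^sup>2 + b\<^sup>2 / 4\<close> for \<open>a = L T \<parallel>f\<parallel>\<close> and \<open>b = \<parallel>w\<parallel>\<close>, half of the left-hand side of the energy
  inequality absorbs the contribution of \<open>w\<close>.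
\<close>

lemma solution_difference_estimate:
  fixes \<phi> :: "real \<Rightarrow> 'h::{real_inner, banach} \<Rightarrow> ereal"
  assumes T: "0 < T" and kp: "kernel_pair (on_positive k) l"
    and s1: "strong_solution_pair T k \<phi> u01 f1 u1 \<xi>1" and s2: "strong_solution_pair T k \<phi> u02 f2 u2 \<xi>2"
    and f: "L2 T f1" "L2 T f2"
    and proper: "\<And>t. t \<in> {0..T} \<Longrightarrow> proper_functional (\<phi> t)"
  shows "(L2_time_norm T (\<lambda>t. u1 t - u2 t))\<^sup>2
    \<le> (2 * T + 4 * (kernel_pair.L l T)\<^sup>2) * ((norm (u01 - u02))\<^sup>2 + (L2_time_norm T (\<lambda>t. f1 t - f2 t))\<^sup>2)"
proof -
  interpret kernel_pair "on_positive k" l by (rule kp)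
  let ?M = "time_measure T" and ?w = "\<lambda>t. u1 t - u2 t" and ?f = "\<lambda>t. f1 t - f2 t"
  have w: "L2 T ?w" and ff: "L2 T ?f"
    using s1 s2 by (auto intro!: L2_diff f simp: strong_solution_pair_def)
  have wi: "integrable ?M (\<lambda>t. (norm (?w t))\<^sup>2)" and fi: "integrable ?M (\<lambda>t. (norm (?f t))\<^sup>2)"
    using w ff by (auto simp: L2_def)
  define A where "A = (\<integral>t. (norm (?w t))\<^sup>2 \<partial>?M)"
  define F where "F = (\<integral>t. (norm (?f t))\<^sup>2 \<partial>?M)"
  have F0: "0 \<le> F" unfolding F_def by (rule Bochner_Integration.integral_nonneg) simp
  have "(\<integral>t. L (T - t) * (?f t \<bullet> ?w t) \<partial>?M) \<le> (\<integral>t. (L T)\<^sup>2 * (norm (?f t))\<^sup>2 + (norm (?w t))\<^sup>2 / 4 \<partial>?M)"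
  proof (rule integral_mono)
    show "integrable ?M (\<lambda>t. L (T - t) * (?f t \<bullet> ?w t))"
      by (intro L_weight_integrable L2_inner_integrable(3) w ff)
    show "integrable ?M (\<lambda>t. (L T)\<^sup>2 * (norm (?f t))\<^sup>2 + (norm (?w t))\<^sup>2 / 4)" using wi fi by auto
    fix t assume "t \<in> space ?M"
    then have "\<bar>L (T - t)\<bar> \<le> L T" by (intro L_weight) simp
    then have "\<bar>L (T - t)\<bar> * \<bar>?f t \<bullet> ?w t\<bar> \<le> L T * (norm (?f t) * norm (?w t))"
      by (intro mult_mono Cauchy_Schwarz_ineq2) (auto simp: L_nonneg)
    also have "\<dots> \<le> (L T)\<^sup>2 * (norm (?f t))\<^sup>2 + (norm (?w t))\<^sup>2 / 4"
      using zero_le_power2[of "L T * norm (?f t) - norm (?w t) / 2"]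
      by (simp add: power2_eq_square field_simps)
    finally show "L (T - t) * (?f t \<bullet> ?w t) \<le> (L T)\<^sup>2 * (norm (?f t))\<^sup>2 + (norm (?w t))\<^sup>2 / 4"
      unfolding abs_mult[symmetric] by (rule order_trans[OF abs_ge_self])
  qed
  also have "\<dots> = (L T)\<^sup>2 * F + A / 4" using wi fi by (simp add: A_def F_def)
  finally have "A / 2 - T * (norm (u01 - u02))\<^sup>2 / 2 \<le> (L T)\<^sup>2 * F + A / 4"
    using solution_difference_energy[OF T kp s1 s2 f proper] unfolding A_def by linarith
  then have "A \<le> 2 * T * (norm (u01 - u02))\<^sup>2 + 4 * (L T)\<^sup>2 * F" by simp
  also have "\<dots> \<le> (2 * T + 4 * (L T)\<^sup>2) * (norm (u01 - u02))\<^sup>2 + (2 * T + 4 * (L T)\<^sup>2) * F"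
    using T F0 by (intro add_mono mult_right_mono) auto
  finally show ?thesis
    unfolding L2_time_norm_squared A_def F_def by (simp add: distrib_left)
qed

theorem theorem2p2:
  fixes T :: real
    and k l :: "real \<Rightarrow> real"
    and \<phi> :: "real \<Rightarrow> 'h::{real_inner, banach} \<Rightarrow> ereal"
  assumes "0 < T"
    and "\<And>t. t \<in> {0..T} \<Longrightarrow> proper_functional (\<phi> t)"
    and "\<And>t. t \<in> {0..T} \<Longrightarrow> lsc_functional (\<phi> t)"
    and "\<And>t. t \<in> {0..T} \<Longrightarrow> convex_functional (\<phi> t)"
    and "PC k l"
  shows "(\<exists>c\<ge>0. \<forall>u01 u02 f1 f2 u1 u2 \<xi>1 \<xi>2.
            L2 T f1 \<and> L2 T f2 \<and>
            strong_solution_pair T k \<phi> u01 f1 u1 \<xi>1 \<and>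
            strong_solution_pair T k \<phi> u02 f2 u2 \<xi>2 \<longrightarrow>
            (L2_time_norm T (\<lambda>t. u1 t - u2 t))\<^sup>2
              \<le> c * ((norm (u01 - u02))\<^sup>2 + (L2_time_norm T (\<lambda>t. f1 t - f2 t))\<^sup>2)) \<and>
         (\<forall>u01 u02 f1 f2 u1 u2 \<xi>1 \<xi>2.
            L2 T f1 \<and> L2 T f2 \<and>
            strong_solution_pair T k \<phi> u01 f1 u1 \<xi>1 \<and>
            strong_solution_pair T k \<phi> u02 f2 u2 \<xi>2 \<and>
            u01 = u02 \<and> (AE t in time_measure T. f1 t = f2 t) \<longrightarrow>
            (AE t in time_measure T. u1 t = u2 t))"
proof -
  note kp = kernel_pair_of_PC[OF assms(5)]
  define c where "c = 2 * T + 4 * (kernel_pair.L (on_positive l) T)\<^sup>2"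
  have c: "0 \<le> c" using assms(1) by (simp add: c_def)
  have est: "(L2_time_norm T (\<lambda>t. u1 t - u2 t))\<^sup>2
      \<le> c * ((norm (u01 - u02))\<^sup>2 + (L2_time_norm T (\<lambda>t. f1 t - f2 t))\<^sup>2)"
    if "L2 T f1" "L2 T f2" "strong_solution_pair T k \<phi> u01 f1 u1 \<xi>1" "strong_solution_pair T k \<phi> u02 f2 u2 \<xi>2"
    for u01 u02 f1 f2 u1 u2 \<xi>1 \<xi>2
    unfolding c_def by (rule solution_difference_estimate[OF assms(1) kp that(3,4,1,2) assms(2)])
  have unique: "AE t in time_measure T. u1 t = u2 t"
    if sol: "L2 T f1" "L2 T f2" "strong_solution_pair T k \<phi> u0 f1 u1 \<xi>1" "strong_solution_pair T k \<phi> u0 f2 u2 \<xi>2"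
      and f: "AE t in time_measure T. f1 t = f2 t" for u0 f1 f2 u1 u2 \<xi>1 \<xi>2
  proof -
    have "(\<integral>t. (norm (f1 t - f2 t))\<^sup>2 \<partial>time_measure T) = 0"
      by (rule integral_eq_zero_AE) (use f in \<open>eventually_elim, simp\<close>)
    then have "(\<integral>t. (norm (u1 t - u2 t))\<^sup>2 \<partial>time_measure T) \<le> 0"
      using est[OF sol] by (simp add: L2_time_norm_squared)
    then have 0: "(\<integral>t. (norm (u1 t - u2 t))\<^sup>2 \<partial>time_measure T) = 0"
      by (intro order_antisym Bochner_Integration.integral_nonneg) auto
    have "L2 T (\<lambda>t. u1 t - u2 t)"
      using sol by (auto intro!: L2_diff simp: strong_solution_pair_def)
    then have "AE t in time_measure T. (norm (u1 t - u2 t))\<^sup>2 = 0"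
      using 0 by (subst (asm) integral_nonneg_eq_0_iff_AE) (auto simp: L2_def)
    then show ?thesis by eventually_elim simp
  qed
  show ?thesis
    using c est unique by blast
qed

end
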